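(* Let $P\subset\mathbb R^3$ be a parallelohedron, and let $\Lambda(P)$ be the translation lattice of its face-to-face tiling. Then there are an ordered basis $B$ of $\Lambda(P)$ and vectors $\mathbf t_\sigma\in\mathbb R^3$, $\sigma\in S_3$, such that $$P=\operatorname{conv}\bigcup_{\sigma\in S_3}\bigl(\mathbf t_\sigma+\Delta_\sigma(B)\bigr).$$
   Context: A parallelohedron in $\mathbb R^3$ is a (full-dimensional) convex polytope which tiles space by lattice translations. For a parallelohedron $P$, $\Lambda(P)$ denotes the translation lattice of its face-to-face tiling, i.e. the lattice tiling by translates of $P$ in which the intersection of any two tiles is a face of both (this tiling is determined by $P$ up to an overall translation). For an ordered basis $B=(\mathbf b_1,\mathbf b_2,\mathbf b_3)$ of a full-rank lattice in $\mathbb R^3$ and a permutation $\sigma\in S_3$, $$\Delta_\sigma(B)=\operatorname{conv}\{\mathbf 0,\ \mathbf b_{\sigma(1)},\ \mathbf b_{\sigma(1)}+\mathbf b_{\sigma(2)},\ \mathbf b_1+\mathbf b_2+\mathbf b_3\}.$$ *)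

theory Defs
  imports "HOL-Analysis.Analysis"
begin

text \<open>
  Indices range over the three-element type \<open>3\<close>, whose elements are \<open>1\<close>, \<open>2\<close>, \<open>3\<close>
  (arithmetic there is modulo 3, so \<open>3 = 0\<close>); the symmetric group on three letters is
  \<open>{\<sigma>. \<sigma> permutes (UNIV :: 3 set)}\<close>.
\<close>

definition lattice_basis :: "(3 \<Rightarrow> real^3) \<Rightarrow> (real^3) set \<Rightarrow> bool" where
  "lattice_basis B L \<longleftrightarrow>
     inj B \<and> independent (range B) \<and>
     L = {(\<Sum>i\<in>UNIV. of_int (c i) *\<^sub>R B i) | c :: 3 \<Rightarrow> int. True}"

definition full_rank_lattice :: "(real^3) set \<Rightarrow> bool" where
  "full_rank_lattice L \<longleftrightarrow> (\<exists>B. lattice_basis B L)"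

definition lattice_tiling :: "(real^3) set \<Rightarrow> (real^3) set \<Rightarrow> bool" where
  "lattice_tiling P L \<longleftrightarrow>
     full_rank_lattice L \<and>
     (\<Union>x\<in>L. (+) x ` P) = UNIV \<and>
     (\<forall>x\<in>L. \<forall>y\<in>L. x \<noteq> y \<longrightarrow> interior ((+) x ` P) \<inter> interior ((+) y ` P) = {})"

definition parallelohedron :: "(real^3) set \<Rightarrow> bool" where
  "parallelohedron P \<longleftrightarrow> polytope P \<and> aff_dim P = 3 \<and> (\<exists>L. lattice_tiling P L)"

text \<open>The library relation \<open>face_of\<close> counts the empty set as a face, so disjoint tiles are allowed.\<close>

definition face_to_face_tiling :: "(real^3) set \<Rightarrow> (real^3) set \<Rightarrow> bool" where
  "face_to_face_tiling P L \<longleftrightarrow>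
     lattice_tiling P L \<and>
     (\<forall>x\<in>L. \<forall>y\<in>L. ((+) x ` P \<inter> (+) y ` P) face_of ((+) x ` P) \<and>
                    ((+) x ` P \<inter> (+) y ` P) face_of ((+) y ` P))"

text \<open>
  Every parallelohedron has exactly one face-to-face lattice tiling up to an overall translation.
  Such a translation does not affect the lattice, so the description below is meaningful for
  parallelohedra. A parallelohedron may also have lattice tilings that are not face-to-face.
\<close>

definition translation_lattice :: "(real^3) set \<Rightarrow> (real^3) set" where
  "translation_lattice P = (THE L. face_to_face_tiling P L)"

definition Delta :: "(3 \<Rightarrow> 3) \<Rightarrow> (3 \<Rightarrow> real^3) \<Rightarrow> (real^3) set" where
  "Delta \<sigma> B = convex hull {0, B (\<sigma> 1), B (\<sigma> 1) + B (\<sigma> 2), B 1 + B 2 + B 3}"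

end

theory Submission
  imports Defs
begin

text \<open>
  Let \<open>P\<close> tile space by a lattice. Up to translation \<open>P\<close> is a
  zonotope whose edge directions are among \<open>a\<^sub>i\<close> and \<open>a\<^sub>i - a\<^sub>j\<close> for some basis
  \<open>a\<^sub>1, a\<^sub>2, a\<^sub>3\<close>, and for such a body both the lattice and the six simplices can be written down.

  \<^emph>\<open>Symmetry\<close> (\<open>lattice_tile_centrally_symmetric\<close>). The set \<open>(K - K) / 2\<close>, with \<open>K\<close> the interior of
  \<open>P\<close>, has disjoint lattice translates as soon as \<open>K\<close> has, so its volume is at most that of \<open>P\<close>. This
  forces \<open>K\<close> to be centrally symmetric. That equality case of the Brunn--Minkowski inequality is obtained
  from Steiner symmetrisation: for every direction, symmetrising in the two orthogonal directions reduces
  the question to bodies invariant under a half-turn, where it becomes a statement about one concave and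
  one convex function on a segment.

  \<^emph>\<open>Edges\<close> (\<open>edges_equal_length\<close>, \<open>three_planes\<close>). The tiling need not be face-to-face, so the usual
  belts of facets are not available. Instead look at a point \<open>x\<close> of an edge of direction \<open>w\<close> that is
  interior, along \<open>w\<close>, to every tile containing it. Any two tiles at \<open>x\<close> are separated by a plane parallel
  to \<open>w\<close>, and there are at least three of them. Modulo \<open>w\<close>, the positions of \<open>x\<close> in three such tiles and
  their negatives span a hexagon which already contains \<open>P\<close>. Hence every edge of direction \<open>w\<close> has a
  translate, or reflected translate, through \<open>x\<close>, and \<open>P\<close> projects along \<open>w\<close> onto a parallelogram
  or hexagon. A double count of these translates along two edges shows that all edges of direction \<open>w\<close>
  have the same length; here a vertex of the projection with a single preimage counts as an edge of length zero.

  \<^emph>\<open>Shape\<close> (\<open>zonotope_if_equal_edges\<close>, \<open>K4_classification\<close>). Equality of parallel edges lets one split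
  off one edge at a time as a Minkowski summand, so \<open>P\<close> is a zonotope. The hexagonal projections say that among
  any four edge directions some two lie in a common plane with a given fifth, and this restricts the directions to
  those of the complete graph on four vertices.

  \<^emph>\<open>Lattice and simplices\<close> (\<open>body_translation_lattice\<close>, \<open>body_as_hull\<close>). Such a zonotope is the Voronoi cell
  of a quadratic form on an explicit lattice with basis \<open>B\<close>. Voronoi cells tile face-to-face, and a
  face-to-face tiling lattice is determined by the cell because it contains the vectors across all
  facets. The vertices of the zonotope belong to the orderings of \<open>{0, 1, 2, 3}\<close>; moving a last
  element \<open>i \<noteq> 0\<close> of an ordering to the front adds the basis vector \<open>B i\<close>, so the four orderings of one
  cyclic class are the vertices of a translate of one simplex \<open>Delta \<sigma> B\<close>.
\<close>

section \<open>Central symmetry of lattice tiles\<close>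

text \<open>
  The difference body, scaled so that it is a translate of \<open>K\<close> when \<open>K\<close> is convex and centrally symmetric.
\<close>

definition half_diff :: "(real^3) set \<Rightarrow> (real^3) set" where
  "half_diff K = {(1/2) *\<^sub>R (x - y) | x y. x \<in> K \<and> y \<in> K}"

text \<open>
  Steiner symmetrisation in direction \<open>e\<close>: on a line parallel to \<open>e\<close> that meets \<open>K\<close> in an interval,
  the heights \<open>(p - q) / 2\<close> of differences of its points form the interval of the same length centred at
  height zero. This form turns the comparison with difference bodies into a substitution.
\<close>

definition steiner :: "real^3 \<Rightarrow> (real^3) set \<Rightarrow> (real^3) set" where
  "steiner e K = {y. \<exists>p q. y + p *\<^sub>R e \<in> K \<and> y + q *\<^sub>R e \<in> K \<and> e \<bullet> y = (p - q) / 2}"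

text \<open>
  Fubini along an arbitrary unit vector, without choosing orthogonal coordinates: every line parallel
  to \<open>e\<close> meets the slab in a segment of length one.
\<close>

lemma nn_integral_along_direction:
  fixes f :: "real^3 \<Rightarrow> ennreal"
  assumes e: "norm e = 1" and f: "f \<in> borel_measurable borel"
  shows "(\<integral>\<^sup>+x. f x \<partial>lborel) = (\<integral>\<^sup>+x. indicator {x. 0 \<le> e \<bullet> x \<and> e \<bullet> x \<le> 1} x * (\<integral>\<^sup>+t. f (x + t *\<^sub>R e) \<partial>lborel) \<partial>lborel)"
proof -
  let ?B = "{x. 0 \<le> e \<bullet> x \<and> e \<bullet> x \<le> 1}"
  have B: "?B \<in> sets borel" by measurable
  have ee: "e \<bullet> e = 1" using e by (simp add: dot_square_norm)
  have indB: "(indicator ?B :: real^3 \<Rightarrow> ennreal) \<in> borel_measurable borel" using B by measurable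
  have trans: "(\<integral>\<^sup>+x. h (x + c) \<partial>lborel) = (\<integral>\<^sup>+x. h x \<partial>lborel)" if h: "h \<in> borel_measurable borel" for h :: "real^3 \<Rightarrow> ennreal" and c
  proof -
    have "(\<integral>\<^sup>+x. h x \<partial>lborel) = (\<integral>\<^sup>+x. h x \<partial>distr lborel borel ((+) c))" by (simp add: lborel_distr_plus)
    also have "\<dots> = (\<integral>\<^sup>+x. h (c + x) \<partial>lborel)" using h by (subst nn_integral_distr) auto
    finally show ?thesis by (simp add: add.commute)
  qed
  have m1: "(\<lambda>(x::real^3, t::real). indicator ?B x * f (x + t *\<^sub>R e)) \<in> borel_measurable (lborel \<Otimes>\<^sub>M lborel)"
    using indB f by measurable
  have m2: "(\<lambda>(x::real^3, t::real). indicator ?B (x - t *\<^sub>R e) * f x) \<in> borel_measurable (lborel \<Otimes>\<^sub>M lborel)"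
    using indB f by measurable
  have "(\<integral>\<^sup>+x. indicator ?B x * (\<integral>\<^sup>+t. f (x + t *\<^sub>R e) \<partial>lborel) \<partial>lborel)
      = (\<integral>\<^sup>+x. \<integral>\<^sup>+t. indicator ?B x * f (x + t *\<^sub>R e) \<partial>lborel \<partial>lborel)"
    using f by (subst nn_integral_cmult) auto
  also have "\<dots> = (\<integral>\<^sup>+t. \<integral>\<^sup>+x. indicator ?B x * f (x + t *\<^sub>R e) \<partial>lborel \<partial>lborel)"
    using lborel_pair.Fubini'[OF m1] by simp
  also have "\<dots> = (\<integral>\<^sup>+t. \<integral>\<^sup>+x. indicator ?B (x - t *\<^sub>R e) * f x \<partial>lborel \<partial>lborel)"
  proof (rule nn_integral_cong)
    fix t :: real
    have "(\<lambda>x. indicator ?B (x - t *\<^sub>R e) * f x) \<in> borel_measurable borel" using indB f by measurable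
    from trans[OF this, of "t *\<^sub>R e"]
    show "(\<integral>\<^sup>+x. indicator ?B x * f (x + t *\<^sub>R e) \<partial>lborel) = (\<integral>\<^sup>+x. indicator ?B (x - t *\<^sub>R e) * f x \<partial>lborel)"
      by simp
  qed
  also have "\<dots> = (\<integral>\<^sup>+x. \<integral>\<^sup>+t. indicator ?B (x - t *\<^sub>R e) * f x \<partial>lborel \<partial>lborel)"
    using lborel_pair.Fubini'[OF m2] by simp
  also have "\<dots> = (\<integral>\<^sup>+x. f x \<partial>lborel)"
  proof (rule nn_integral_cong)
    fix x :: "real^3"
    have "(\<integral>\<^sup>+t. indicator ?B (x - t *\<^sub>R e) * f x \<partial>lborel) = (\<integral>\<^sup>+t. f x * indicator {e \<bullet> x - 1 .. e \<bullet> x} t \<partial>lborel)"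
      using ee by (intro nn_integral_cong) (auto simp: indicator_def inner_diff_right)
    also have "\<dots> = f x" by (subst nn_integral_cmult_indicator) auto
    finally show "(\<integral>\<^sup>+t. indicator ?B (x - t *\<^sub>R e) * f x \<partial>lborel) = f x" .
  qed
  finally show ?thesis by simp
qed

lemma open_convex_bounded_real:
  fixes I :: "real set"
  assumes "open I" "convex I" "bounded I" "I \<noteq> {}"
  shows "I = {Inf I <..< Sup I}"
proof
  have bd: "bdd_above I" "bdd_below I" using assms(3) bounded_imp_bdd_above bounded_imp_bdd_below by auto
  show "I \<subseteq> {Inf I<..<Sup I}"
  proof
    fix x assume x: "x \<in> I"
    obtain d where d: "d > 0" "cball x d \<subseteq> I" using assms(1) x open_contains_cball by blast
    have "x + d \<in> I" "x - d \<in> I" using d by (auto simp: dist_real_def subset_iff)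
    then have "x + d \<le> Sup I" "Inf I \<le> x - d" using bd by (auto intro: cSup_upper cInf_lower)
    then show "x \<in> {Inf I<..<Sup I}" using d(1) by simp
  qed
  show "{Inf I<..<Sup I} \<subseteq> I"
  proof
    fix x assume x: "x \<in> {Inf I<..<Sup I}"
    obtain p where p: "p \<in> I" "p < x" using x cInf_less_iff[OF assms(4) bd(2)] by auto
    obtain q where q: "q \<in> I" "x < q" using x less_cSup_iff[OF assms(4) bd(1)] by auto
    have "is_interval I" using assms(2) is_interval_convex_1 by blast
    then show "x \<in> I" using mem_is_interval_1_I[of I p q x] p q by auto
  qed
qed

lemma interval_half_differences:
  fixes a b c :: real
  assumes "a < b"
  shows "{(p - q) / 2 - c | p q. p \<in> {a<..<b} \<and> q \<in> {a<..<b}} = {- (b - a) / 2 - c <..< (b - a) / 2 - c}"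
proof
  show "{(p - q) / 2 - c | p q. p \<in> {a<..<b} \<and> q \<in> {a<..<b}} \<subseteq> {- (b - a) / 2 - c <..< (b - a) / 2 - c}"
    by auto
  show "{- (b - a) / 2 - c <..< (b - a) / 2 - c} \<subseteq> {(p - q) / 2 - c | p q. p \<in> {a<..<b} \<and> q \<in> {a<..<b}}"
  proof
    fix t assume t: "t \<in> {- (b - a) / 2 - c <..< (b - a) / 2 - c}"
    have "t = (((a + b) / 2 + (t + c)) - ((a + b) / 2 - (t + c))) / 2 - c" by (simp add: field_simps)
    moreover have "(a + b) / 2 + (t + c) \<in> {a<..<b}" "(a + b) / 2 - (t + c) \<in> {a<..<b}"
      using t by (auto simp: field_simps)
    ultimately show "t \<in> {(p - q) / 2 - c | p q. p \<in> {a<..<b} \<and> q \<in> {a<..<b}}" by blast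
  qed
qed

lemma line_section:
  fixes K :: "(real^3) set"
  assumes "open K" "convex K" "bounded K" and e: "norm e = 1"
  shows "open {t. x + t *\<^sub>R e \<in> K}" "convex {t. x + t *\<^sub>R e \<in> K}" "bounded {t. x + t *\<^sub>R e \<in> K}"
proof -
  have "open ((\<lambda>t. x + t *\<^sub>R e) -` K)"
    by (rule continuous_open_vimage) (auto intro!: assms continuous_intros)
  then show "open {t. x + t *\<^sub>R e \<in> K}" by (simp add: vimage_def)
  show "convex {t. x + t *\<^sub>R e \<in> K}"
  proof (rule convexI)
    fix a b u v :: real assume *: "a \<in> {t. x + t *\<^sub>R e \<in> K}" "b \<in> {t. x + t *\<^sub>R e \<in> K}" "0 \<le> u" "0 \<le> v" "u + v = 1"
    have "u *\<^sub>R (x + a *\<^sub>R e) + v *\<^sub>R (x + b *\<^sub>R e) \<in> K" using convexD[OF assms(2)] * by auto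
    moreover have "u *\<^sub>R (x + a *\<^sub>R e) + v *\<^sub>R (x + b *\<^sub>R e) = (u + v) *\<^sub>R x + (u * a + v * b) *\<^sub>R e"
      by (simp add: algebra_simps)
    ultimately show "u *\<^sub>R a + v *\<^sub>R b \<in> {t. x + t *\<^sub>R e \<in> K}" using *(5) by simp
  qed
  obtain C where C: "\<And>z. z \<in> K \<Longrightarrow> norm z \<le> C" using assms(3) bounded_iff by metis
  show "bounded {t. x + t *\<^sub>R e \<in> K}"
    unfolding bounded_iff
  proof (intro exI ballI)
    fix s assume "s \<in> {t. x + t *\<^sub>R e \<in> K}"
    then have "norm (x + s *\<^sub>R e) \<le> C" using C by simp
    then show "norm s \<le> C + norm x" using norm_triangle_ineq4[of "x + s *\<^sub>R e" x] e by simp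
  qed
qed

lemma open_steiner: assumes "open K" shows "open (steiner e K)"
proof -
  have "steiner e K = (\<Union>q. (\<lambda>y. y + (q + 2 * (e \<bullet> y)) *\<^sub>R e) -` K \<inter> (\<lambda>y. y + q *\<^sub>R e) -` K)"
  proof
    show "steiner e K \<subseteq> (\<Union>q. (\<lambda>y. y + (q + 2 * (e \<bullet> y)) *\<^sub>R e) -` K \<inter> (\<lambda>y. y + q *\<^sub>R e) -` K)"
    proof
      fix y assume "y \<in> steiner e K"
      then obtain p q where pq: "y + p *\<^sub>R e \<in> K" "y + q *\<^sub>R e \<in> K" "e \<bullet> y = (p - q) / 2" unfolding steiner_def by blast
      then have "q + 2 * (e \<bullet> y) = p" by simp
      then have "y + (q + 2 * (e \<bullet> y)) *\<^sub>R e \<in> K" using pq(1) by (simp only:)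
      then have "y \<in> (\<lambda>y. y + (q + 2 * (e \<bullet> y)) *\<^sub>R e) -` K \<inter> (\<lambda>y. y + q *\<^sub>R e) -` K"
        using pq(2) by (intro IntI vimageI2)
      then show "y \<in> (\<Union>q. (\<lambda>y. y + (q + 2 * (e \<bullet> y)) *\<^sub>R e) -` K \<inter> (\<lambda>y. y + q *\<^sub>R e) -` K)" by blast
    qed
    show "(\<Union>q. (\<lambda>y. y + (q + 2 * (e \<bullet> y)) *\<^sub>R e) -` K \<inter> (\<lambda>y. y + q *\<^sub>R e) -` K) \<subseteq> steiner e K"
    proof
      fix y assume "y \<in> (\<Union>q. (\<lambda>y. y + (q + 2 * (e \<bullet> y)) *\<^sub>R e) -` K \<inter> (\<lambda>y. y + q *\<^sub>R e) -` K)"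
      then obtain q where "y + (q + 2 * (e \<bullet> y)) *\<^sub>R e \<in> K" "y + q *\<^sub>R e \<in> K" by blast
      moreover have "e \<bullet> y = ((q + 2 * (e \<bullet> y)) - q) / 2" by simp
      ultimately show "y \<in> steiner e K" unfolding steiner_def by blast
    qed
  qed
  moreover have "open ((\<lambda>y. y + (q + 2 * (e \<bullet> y)) *\<^sub>R e) -` K)" "open ((\<lambda>y. y + q *\<^sub>R e) -` K)" for q
    by (rule continuous_open_vimage; auto intro!: assms continuous_intros)+
  ultimately show ?thesis by (simp add: open_Int open_UN)
qed

lemma convex_steiner: assumes "convex K" shows "convex (steiner e K)"
proof (rule convexI)
  fix x y and u v :: real assume *: "x \<in> steiner e K" "y \<in> steiner e K" "0 \<le> u" "0 \<le> v" "u + v = 1"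
  obtain p q where x: "x + p *\<^sub>R e \<in> K" "x + q *\<^sub>R e \<in> K" "e \<bullet> x = (p - q) / 2" using *(1) unfolding steiner_def by blast
  obtain p' q' where y: "y + p' *\<^sub>R e \<in> K" "y + q' *\<^sub>R e \<in> K" "e \<bullet> y = (p' - q') / 2" using *(2) unfolding steiner_def by blast
  have "u *\<^sub>R (x + p *\<^sub>R e) + v *\<^sub>R (y + p' *\<^sub>R e) \<in> K" "u *\<^sub>R (x + q *\<^sub>R e) + v *\<^sub>R (y + q' *\<^sub>R e) \<in> K"
    using convexD[OF assms] x y * by auto
  then have "(u *\<^sub>R x + v *\<^sub>R y) + (u * p + v * p') *\<^sub>R e \<in> K" "(u *\<^sub>R x + v *\<^sub>R y) + (u * q + v * q') *\<^sub>R e \<in> K"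
    by (simp_all add: algebra_simps)
  moreover have "e \<bullet> (u *\<^sub>R x + v *\<^sub>R y) = ((u * p + v * p') - (u * q + v * q')) / 2"
    unfolding inner_add_right inner_scaleR_right x(3) y(3) by (simp add: field_simps)
  ultimately show "u *\<^sub>R x + v *\<^sub>R y \<in> steiner e K" unfolding steiner_def by blast
qed

lemma bounded_steiner: assumes "bounded K" "norm e = 1" shows "bounded (steiner e K)"
proof -
  obtain C where C: "\<And>z. z \<in> K \<Longrightarrow> norm z \<le> C" using assms(1) bounded_iff by metis
  have "norm y \<le> 2 * C" if yS: "y \<in> steiner e K" for y
  proof -
    have ee: "e \<bullet> e = 1" using assms(2) by (simp add: dot_square_norm)
    obtain p q where x: "y + p *\<^sub>R e \<in> K" "y + q *\<^sub>R e \<in> K" "e \<bullet> y = (p - q) / 2" using yS unfolding steiner_def by blast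
    have "y = (y + p *\<^sub>R e) - p *\<^sub>R e" by simp
    have "\<bar>e \<bullet> (y + p *\<^sub>R e)\<bar> \<le> C" "\<bar>e \<bullet> (y + q *\<^sub>R e)\<bar> \<le> C"
      using Cauchy_Schwarz_ineq2[of e] assms(2) C[OF x(1)] C[OF x(2)] by (metis mult_1 order_trans)+
    moreover have "e \<bullet> (y + q *\<^sub>R e) = (p + q) / 2" using ee unfolding inner_add_right x(3) by (simp add: field_simps)
    ultimately have "\<bar>p + q\<bar> \<le> 2 * C" by simp
    have "(1/2) *\<^sub>R (y + p *\<^sub>R e) + (1/2) *\<^sub>R (y + q *\<^sub>R e) = y + ((p + q) / 2) *\<^sub>R e"
      by (simp add: vec_eq_iff field_simps)
    then have "norm (y + ((p + q) / 2) *\<^sub>R e) \<le> norm ((1/2) *\<^sub>R (y + p *\<^sub>R e)) + norm ((1/2) *\<^sub>R (y + q *\<^sub>R e))"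
      by (metis norm_triangle_ineq)
    also have "\<dots> \<le> C" using C[OF x(1)] C[OF x(2)] by simp
    finally have 1: "norm (y + ((p + q) / 2) *\<^sub>R e) \<le> C" .
    have "norm (((p + q) / 2) *\<^sub>R e) \<le> C" using \<open>\<bar>p + q\<bar> \<le> 2 * C\<close> assms(2) by simp
    then show ?thesis using 1 norm_triangle_ineq4[of "y + ((p + q) / 2) *\<^sub>R e" "((p + q) / 2) *\<^sub>R e"] by simp
  qed
  then show ?thesis unfolding bounded_iff by blast
qed

text \<open>
  On each line parallel to \<open>e\<close> the two sets have sections of equal length and \<open>h\<close> is constant. The weight
  \<open>h\<close> is what later transfers information about heights over a plane parallel to \<open>e\<close>.
\<close>

lemma nn_integral_steiner:
  fixes K :: "(real^3) set" and h :: "real^3 \<Rightarrow> ennreal"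
  assumes K: "open K" "convex K" "bounded K" and e: "norm e = 1"
    and h: "h \<in> borel_measurable borel" "\<And>x t. h (x + t *\<^sub>R e) = h x"
  shows "(\<integral>\<^sup>+x. indicator (steiner e K) x * h x \<partial>lborel) = (\<integral>\<^sup>+x. indicator K x * h x \<partial>lborel)"
proof -
  have ee: "e \<bullet> e = 1" using e by (simp add: dot_square_norm)
  have sec: "(\<integral>\<^sup>+t. indicator (steiner e K) (x + t *\<^sub>R e) * h (x + t *\<^sub>R e) \<partial>lborel)
      = (\<integral>\<^sup>+t. indicator K (x + t *\<^sub>R e) * h (x + t *\<^sub>R e) \<partial>lborel)" for x
  proof -
    let ?I = "{t. x + t *\<^sub>R e \<in> K}"
    let ?J = "{t. x + t *\<^sub>R e \<in> steiner e K}"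
    have J: "?J = {(p - q) / 2 - e \<bullet> x | p q. p \<in> ?I \<and> q \<in> ?I}"
    proof
      show "?J \<subseteq> {(p - q) / 2 - e \<bullet> x | p q. p \<in> ?I \<and> q \<in> ?I}"
      proof
        fix t assume "t \<in> ?J"
        then obtain p q where pq: "(x + t *\<^sub>R e) + p *\<^sub>R e \<in> K" "(x + t *\<^sub>R e) + q *\<^sub>R e \<in> K" "e \<bullet> (x + t *\<^sub>R e) = (p - q) / 2"
          unfolding steiner_def by blast
        have "t + p \<in> ?I" "t + q \<in> ?I" using pq by (simp_all add: algebra_simps)
        moreover have "t = ((t + p) - (t + q)) / 2 - e \<bullet> x" using pq(3) ee unfolding inner_add_right by (simp add: field_simps)
        ultimately show "t \<in> {(p - q) / 2 - e \<bullet> x | p q. p \<in> ?I \<and> q \<in> ?I}" by blast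
      qed
      show "{(p - q) / 2 - e \<bullet> x | p q. p \<in> ?I \<and> q \<in> ?I} \<subseteq> ?J"
      proof
        fix t assume "t \<in> {(p - q) / 2 - e \<bullet> x | p q. p \<in> ?I \<and> q \<in> ?I}"
        then obtain p q where pq: "t = (p - q) / 2 - e \<bullet> x" "x + p *\<^sub>R e \<in> K" "x + q *\<^sub>R e \<in> K" by blast
        have "(x + t *\<^sub>R e) + (p - t) *\<^sub>R e \<in> K" "(x + t *\<^sub>R e) + (q - t) *\<^sub>R e \<in> K" using pq by (simp_all add: algebra_simps)
        moreover have "e \<bullet> (x + t *\<^sub>R e) = ((p - t) - (q - t)) / 2" using pq(1) ee by (simp add: inner_add_right)
        ultimately show "t \<in> ?J" unfolding steiner_def by blast
      qed
    qed
    have eq: "emeasure lborel ?J = emeasure lborel ?I"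
    proof (cases "?I = {}")
      case True then show ?thesis using J by simp
    next
      case False
      note I = open_convex_bounded_real[OF line_section[OF K e, of x] False]
      define a b where "a = Inf ?I" and "b = Sup ?I"
      have Iab: "?I = {a<..<b}" using I by (simp add: a_def b_def)
      then have ab: "a < b" using False by (metis greaterThanLessThan_empty_iff not_less)
      show ?thesis unfolding J Iab interval_half_differences[OF ab] using ab by (simp add: field_simps)
    qed
    have IJ: "?I \<in> sets lborel" "?J \<in> sets lborel"
      using line_section(1)[OF K e] line_section(1)[OF open_steiner[OF K(1)] convex_steiner[OF K(2)] bounded_steiner[OF K(3) e] e] by auto
    have "(\<integral>\<^sup>+t. indicator (steiner e K) (x + t *\<^sub>R e) * h (x + t *\<^sub>R e) \<partial>lborel) = (\<integral>\<^sup>+t. h x * indicator ?J t \<partial>lborel)"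
      unfolding h(2) by (intro nn_integral_cong) (simp add: indicator_def)
    also have "\<dots> = h x * emeasure lborel ?J" using IJ by (rule_tac nn_integral_cmult_indicator)
    also have "\<dots> = (\<integral>\<^sup>+t. h x * indicator ?I t \<partial>lborel)" unfolding eq using IJ by (rule_tac nn_integral_cmult_indicator[symmetric])
    also have "\<dots> = (\<integral>\<^sup>+t. indicator K (x + t *\<^sub>R e) * h (x + t *\<^sub>R e) \<partial>lborel)"
      unfolding h(2) by (intro nn_integral_cong) (simp add: indicator_def)
    finally show ?thesis .
  qed
  have m: "(\<lambda>x. indicator A x * h x) \<in> borel_measurable borel" if "open A" for A
    using h(1) borel_open[OF that] by measurable
  show ?thesis
    unfolding nn_integral_along_direction[OF e m[OF open_steiner[OF K(1)]]] nn_integral_along_direction[OF e m[OF K(1)]] sec ..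
qed

lemma emeasure_steiner:
  assumes "open K" "convex K" "bounded K" "norm e = 1"
  shows "emeasure lborel (steiner e K) = emeasure lborel K"
  using nn_integral_steiner[OF assms, of "\<lambda>_. 1"] assms(1) open_steiner[OF assms(1), of e] by simp

lemma half_diff_steiner: "half_diff (steiner e K) \<subseteq> steiner e (half_diff K)"
proof
  fix y assume "y \<in> half_diff (steiner e K)"
  then obtain y1 y2 where y: "y = (1/2) *\<^sub>R (y1 - y2)" "y1 \<in> steiner e K" "y2 \<in> steiner e K" unfolding half_diff_def by blast
  obtain p q where 1: "y1 + p *\<^sub>R e \<in> K" "y1 + q *\<^sub>R e \<in> K" "e \<bullet> y1 = (p - q) / 2" using y(2) unfolding steiner_def by blast
  obtain p' q' where 2: "y2 + p' *\<^sub>R e \<in> K" "y2 + q' *\<^sub>R e \<in> K" "e \<bullet> y2 = (p' - q') / 2" using y(3) unfolding steiner_def by blast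
  have "y + ((p - p') / 2) *\<^sub>R e = (1/2) *\<^sub>R ((y1 + p *\<^sub>R e) - (y2 + p' *\<^sub>R e))"
    "y + ((q - q') / 2) *\<^sub>R e = (1/2) *\<^sub>R ((y1 + q *\<^sub>R e) - (y2 + q' *\<^sub>R e))"
    by (simp_all add: y(1) vec_eq_iff field_simps)
  then have "y + ((p - p') / 2) *\<^sub>R e \<in> half_diff K" "y + ((q - q') / 2) *\<^sub>R e \<in> half_diff K"
    using 1 2 unfolding half_diff_def by blast+
  moreover have "e \<bullet> y = ((p - p') / 2 - (q - q') / 2) / 2"
    using 1(3) 2(3) by (simp add: y(1) inner_diff_right field_simps)
  ultimately show "y \<in> steiner e (half_diff K)" unfolding steiner_def by blast
qed

lemma open_half_diff: assumes "open K" shows "open (half_diff K)"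
proof -
  have "half_diff K = (\<Union>y\<in>K. (\<lambda>z. 2 *\<^sub>R z + y) -` K)"
  proof
    show "half_diff K \<subseteq> (\<Union>y\<in>K. (\<lambda>z. 2 *\<^sub>R z + y) -` K)" unfolding half_diff_def by auto
    show "(\<Union>y\<in>K. (\<lambda>z. 2 *\<^sub>R z + y) -` K) \<subseteq> half_diff K"
    proof
      fix z assume "z \<in> (\<Union>y\<in>K. (\<lambda>z. 2 *\<^sub>R z + y) -` K)"
      then obtain y where "y \<in> K" "2 *\<^sub>R z + y \<in> K" by auto
      moreover have "z = (1/2) *\<^sub>R ((2 *\<^sub>R z + y) - y)" by simp
      ultimately show "z \<in> half_diff K" unfolding half_diff_def by blast
    qed
  qed
  moreover have "open ((\<lambda>z. 2 *\<^sub>R z + y) -` K)" for y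
    by (rule continuous_open_vimage) (auto intro!: assms continuous_intros)
  ultimately show ?thesis by (simp add: open_UN)
qed

lemma convex_half_diff: assumes "convex K" shows "convex (half_diff K)"
proof (rule convexI)
  fix x y and u v :: real assume *: "x \<in> half_diff K" "y \<in> half_diff K" "0 \<le> u" "0 \<le> v" "u + v = 1"
  obtain a b where x: "x = (1/2) *\<^sub>R (a - b)" "a \<in> K" "b \<in> K" using *(1) unfolding half_diff_def by blast
  obtain c d where y: "y = (1/2) *\<^sub>R (c - d)" "c \<in> K" "d \<in> K" using *(2) unfolding half_diff_def by blast
  have "u *\<^sub>R a + v *\<^sub>R c \<in> K" "u *\<^sub>R b + v *\<^sub>R d \<in> K" using convexD[OF assms] x y * by auto
  moreover have "u *\<^sub>R x + v *\<^sub>R y = (1/2) *\<^sub>R ((u *\<^sub>R a + v *\<^sub>R c) - (u *\<^sub>R b + v *\<^sub>R d))"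
    by (simp add: x y vec_eq_iff field_simps)
  ultimately show "u *\<^sub>R x + v *\<^sub>R y \<in> half_diff K" unfolding half_diff_def by blast
qed

lemma bounded_half_diff: assumes "bounded K" shows "bounded (half_diff K)"
proof -
  obtain C where C: "\<And>z. z \<in> K \<Longrightarrow> norm z \<le> C" using assms(1) bounded_iff by metis
  have "norm y \<le> C" if yH: "y \<in> half_diff K" for y
  proof -
    obtain a b where x: "y = (1/2) *\<^sub>R (a - b)" "a \<in> K" "b \<in> K" using yH unfolding half_diff_def by blast
    have "norm (a - b) \<le> 2 * C" using norm_triangle_ineq4[of a b] C[OF x(2)] C[OF x(3)] by linarith
    then show ?thesis by (simp add: x(1))
  qed
  then show ?thesis unfolding bounded_iff by blast
qed

text \<open>
  If \<open>B\<close> were larger, it would meet the complement of the closure of \<open>A\<close> in a nonempty open set.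
\<close>

lemma open_convex_subset_eq:
  fixes A B :: "(real^3) set"
  assumes "open A" "convex A" "open B" "A \<subseteq> B" and le: "emeasure lborel B \<le> emeasure lborel A"
    and fin: "emeasure lborel B < \<infinity>"
  shows "A = B"
proof (rule ccontr)
  assume "A \<noteq> B"
  have "B - closure A \<noteq> {}"
  proof
    assume "B - closure A = {}"
    then have "B \<subseteq> interior (closure A)" using assms(3) interior_maximal by blast
    then show False using convex_interior_closure[OF assms(2)] assms(1,4) \<open>A \<noteq> B\<close> by (simp add: interior_open)
  qed
  moreover have op: "open (B - closure A)" using assms(3) by auto
  ultimately have "\<not> negligible (B - closure A)" using open_not_negligible by blast
  then have pos: "emeasure lborel (B - closure A) \<noteq> 0"
    using op by (auto simp: negligible_iff_null_sets null_sets_completionI null_sets_def)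
  have "emeasure lborel A + emeasure lborel (B - closure A) = emeasure lborel (A \<union> (B - closure A))"
    using assms(1) op closure_subset[of A] by (intro plus_emeasure) auto
  also have "\<dots> \<le> emeasure lborel B" using assms(3,4) by (intro emeasure_mono) auto
  also have "\<dots> \<le> emeasure lborel A" by (rule le)
  finally have "emeasure lborel A + emeasure lborel (B - closure A) \<le> emeasure lborel A + 0" by simp
  moreover have "emeasure lborel A \<noteq> \<infinity>" using fin assms(3,4) emeasure_mono[of A B lborel] by (auto simp: top_unique)
  ultimately show False using pos by (simp add: ennreal_add_left_cancel_le)
qed

text \<open>
  Summed over a subdivision into \<open>2n\<close> pieces, the second differences on the right telescope to
  \<open>(a h - a 0) - (a 1 - a (1 - h))\<close> with \<open>h = 1 / 2n\<close>, which tends to zero.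
\<close>

lemma second_difference_telescope:
  fixes a m :: "real \<Rightarrow> real"
  assumes cont: "continuous_on {0..1} a"
    and le: "\<And>s t. s \<in> {0..1} \<Longrightarrow> t \<in> {0..1} \<Longrightarrow> \<bar>m s - m t\<bar> \<le> 2 * a ((s + t) / 2) - a s - a t"
  shows "m 1 = m 0"
proof -
  have bound: "\<bar>m 1 - m 0\<bar> \<le> (a (1 / (2 * real n)) - a 0) - (a 1 - a (1 - 1 / (2 * real n)))" if n: "n > 0" for n :: nat
  proof -
    define x where "x = (\<lambda>j::nat. real j / (2 * real n))"
    have x01: "x j \<in> {0..1}" if "j \<le> 2 * n" for j
      using that n by (simp add: x_def divide_simps)
    have mid: "x (Suc j) = (x j + x (Suc (Suc j))) / 2" for j using n by (simp add: x_def field_simps)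
    have step: "\<bar>m (x j) - m (x (Suc (Suc j)))\<bar> \<le> (a (x (Suc j)) - a (x j)) - (a (x (Suc (Suc j))) - a (x (Suc j)))"
      if "Suc (Suc j) \<le> 2 * n" for j
      using le[OF x01[of j] x01[of "Suc (Suc j)"]] that unfolding mid[of j, symmetric] by simp
    have "\<bar>m (x (2 * k)) - m (x 0)\<bar> \<le> (a (x 1) - a (x 0)) - (a (x (2 * k)) - a (x (2 * k - 1)))"
      if "0 < k" "k \<le> n" for k
      using that
    proof (induction k rule: nat_induct_non_zero)
      case 1
      then show ?case using step[of 0] by (simp add: numeral_2_eq_2 abs_minus_commute)
    next
      case (Suc k)
      obtain j where j: "2 * k = Suc j" using Suc.hyps by (cases "2 * k") auto
      have j1: "2 * k - 1 = j" and k2: "2 * Suc k = Suc (Suc (Suc j))" "2 * Suc k - 1 = Suc (Suc j)"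
        using j by simp_all
      have "Suc (Suc (Suc j)) \<le> 2 * n" "k \<le> n" using Suc.prems j by simp_all
      have "\<bar>m (x (Suc j)) - m (x 0)\<bar> \<le> (a (x 1) - a (x 0)) - (a (x (Suc j)) - a (x j))"
        using Suc.IH[OF \<open>k \<le> n\<close>] unfolding j1 unfolding j .
      moreover have "\<bar>m (x (Suc j)) - m (x (Suc (Suc (Suc j))))\<bar>
          \<le> (a (x (Suc (Suc j))) - a (x (Suc j))) - (a (x (Suc (Suc (Suc j)))) - a (x (Suc (Suc j))))"
        by (rule step) fact
      moreover have "\<bar>m (x j) - m (x (Suc (Suc j)))\<bar> \<le> (a (x (Suc j)) - a (x j)) - (a (x (Suc (Suc j))) - a (x (Suc j)))"
        using step[of j] \<open>Suc (Suc (Suc j)) \<le> 2 * n\<close> by simp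
      ultimately show ?case unfolding k2 diff_Suc_1 by linarith
    qed
    from this[of n] n have "\<bar>m (x (2 * n)) - m (x 0)\<bar> \<le> (a (x 1) - a (x 0)) - (a (x (2 * n)) - a (x (2 * n - 1)))" by simp
    moreover have "x (2 * n) = 1" "x 0 = 0" "x 1 = 1 / (2 * real n)" "x (2 * n - 1) = 1 - 1 / (2 * real n)"
      using n by (simp_all add: x_def field_simps of_nat_diff)
    ultimately show ?thesis by simp
  qed
  let ?h = "\<lambda>n::nat. 1 / (2 * real n)"
  have "(\<lambda>n. (1 / 2) * (1 / real n)) \<longlonglongrightarrow> (1 / 2) * 0" by (intro tendsto_intros lim_1_over_n)
  then have h: "?h \<longlonglongrightarrow> 0" by simp
  have h01: "\<forall>\<^sub>F n in sequentially. ?h n \<in> {0..1}" "\<forall>\<^sub>F n in sequentially. 1 - ?h n \<in> {0..1}"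
    by (auto intro!: eventually_sequentiallyI[of 1] simp: divide_simps)
  have "(\<lambda>n. a (?h n)) \<longlonglongrightarrow> a 0"
    by (rule continuous_on_tendsto_compose[OF cont h]) (use h01 in auto)
  moreover have "(\<lambda>n. 1 - ?h n) \<longlonglongrightarrow> 1" using tendsto_diff[OF tendsto_const h, of 1] by simp
  then have "(\<lambda>n. a (1 - ?h n)) \<longlonglongrightarrow> a 1"
    by (rule continuous_on_tendsto_compose[OF cont]) (use h01 in auto)
  ultimately have "(\<lambda>n. (a (?h n) - a 0) - (a 1 - a (1 - ?h n))) \<longlonglongrightarrow> (a 0 - a 0) - (a 1 - a 1)"
    by (intro tendsto_intros)
  then have "\<bar>m 1 - m 0\<bar> \<le> (a 0 - a 0) - (a 1 - a 1)"
    by (rule tendsto_lowerbound) (auto intro!: eventually_sequentiallyI[of 1] bound)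
  then show ?thesis by simp
qed

text \<open>
  Follow the sections of \<open>Q\<close> parallel to \<open>g\<close> along the ray from the axis to the line through \<open>y\<close>. The
  half-turn turns a pair of points of two sections into a point of the difference body over the midpoint, hence
  of the Steiner symmetrisation, whose section there is as long as that of \<open>Q\<close>. In terms of the half-length \<open>a\<close> and
  the midpoint \<open>m\<close> of the sections this is exactly the hypothesis of \<open>second_difference_telescope\<close>, so all
  sections have their midpoint at the height \<open>\<mu>\<close> of the midpoint on the axis.
\<close>

lemma half_turn_symmetric_reflection:
  fixes Q :: "(real^3) set"
  assumes Q: "open Q" "convex Q" "bounded Q" and g: "norm g = 1"
    and turn: "\<And>y. y \<in> Q \<Longrightarrow> (2 * (g \<bullet> y)) *\<^sub>R g - y \<in> Q"
    and diff: "half_diff Q \<subseteq> steiner g Q"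
    and mid: "\<mu> = (Inf {t. t *\<^sub>R g \<in> Q} + Sup {t. t *\<^sub>R g \<in> Q}) / 2"
    and y: "y \<in> Q"
  shows "y + (2 * (\<mu> - g \<bullet> y)) *\<^sub>R g \<in> Q"
proof -
  have gg: "g \<bullet> g = 1" using g by (simp add: dot_square_norm)
  define b where "b = y - (g \<bullet> y) *\<^sub>R g"
  have gb: "g \<bullet> b = 0" using gg by (simp add: b_def inner_diff_right)
  define J where "J = (\<lambda>s. {t. s *\<^sub>R b + t *\<^sub>R g \<in> Q})"
  have J: "open (J s)" "convex (J s)" "bounded (J s)" for s
    unfolding J_def using line_section[OF Q g] by auto
  define U where "U = {s. J s \<noteq> {}}"
  define up where "up = (\<lambda>s. Sup (J s))"
  define lo where "lo = (\<lambda>s. Inf (J s))"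
  have Jeq: "J s = {lo s <..< up s}" if "s \<in> U" for s
    unfolding lo_def up_def by (rule open_convex_bounded_real[OF J]) (use that in \<open>simp add: U_def\<close>)
  have lt: "lo s < up s" if "s \<in> U" for s
    using Jeq[OF that] that by (metis (mono_tags) U_def greaterThanLessThan_empty_iff mem_Collect_eq not_less)
  have "open U"
  proof -
    have "U = (\<Union>t. (\<lambda>s. s *\<^sub>R b + t *\<^sub>R g) -` Q)" by (auto simp: U_def J_def)
    moreover have "open ((\<lambda>s. s *\<^sub>R b + t *\<^sub>R g) -` Q)" for t
      by (rule continuous_open_vimage) (auto intro!: Q continuous_intros)
    ultimately show ?thesis by auto
  qed
  have comb: "u * t + v * t' \<in> J (u * s + v * s')" if "t \<in> J s" "t' \<in> J s'" "0 \<le> u" "0 \<le> v" "u + v = 1" for u v t t' s s'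
  proof -
    have "u *\<^sub>R (s *\<^sub>R b + t *\<^sub>R g) + v *\<^sub>R (s' *\<^sub>R b + t' *\<^sub>R g) \<in> Q"
      using convexD[OF Q(2)] that unfolding J_def by blast
    moreover have "u *\<^sub>R (s *\<^sub>R b + t *\<^sub>R g) + v *\<^sub>R (s' *\<^sub>R b + t' *\<^sub>R g) = (u * s + v * s') *\<^sub>R b + (u * t + v * t') *\<^sub>R g"
      by (simp add: algebra_simps)
    ultimately show ?thesis by (simp add: J_def)
  qed
  have "convex U"
  proof (rule convexI)
    fix s s' u v :: real assume *: "s \<in> U" "s' \<in> U" "0 \<le> u" "0 \<le> v" "u + v = 1"
    obtain t t' where "t \<in> J s" "t' \<in> J s'" using * by (auto simp: U_def)
    from comb[OF this *(3-5)] show "u *\<^sub>R s + v *\<^sub>R s' \<in> U" by (auto simp: U_def)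
  qed
  have up_conc: "convex_on U (\<lambda>s. - up s)"
  proof (rule convex_onI[OF _ \<open>convex U\<close>])
    fix t s s' :: real assume t: "0 < t" "t < 1" and s: "s \<in> U" "s' \<in> U"
    have cU: "(1 - t) * s + t * s' \<in> U" using convexD[OF \<open>convex U\<close> s, of "1 - t" t] t by simp
    have "(1 - t) * up s + t * up s' \<le> up ((1 - t) * s + t * s')"
    proof (rule field_le_epsilon)
      fix \<epsilon> :: real assume e: "\<epsilon> > 0"
      define d where "d = min \<epsilon> (min (up s - lo s) (up s' - lo s')) / 2"
      have d: "0 < d" "d < \<epsilon>" "d < up s - lo s" "d < up s' - lo s'"
        using e lt[OF s(1)] lt[OF s(2)] by (auto simp: d_def min_def)
      have "up s - d \<in> J s" "up s' - d \<in> J s'" using Jeq[OF s(1)] Jeq[OF s(2)] d by auto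
      from comb[OF this, of "1 - t" t] t have "(1 - t) * (up s - d) + t * (up s' - d) \<in> J ((1 - t) * s + t * s')" by simp
      then have "(1 - t) * (up s - d) + t * (up s' - d) < up ((1 - t) * s + t * s')" using Jeq[OF cU] by simp
      moreover have "(1 - t) * (up s - d) + t * (up s' - d) = (1 - t) * up s + t * up s' - d" by (simp add: algebra_simps)
      ultimately show "(1 - t) * up s + t * up s' \<le> up ((1 - t) * s + t * s') + \<epsilon>" using d by linarith
    qed
    then show "- up ((1 - t) *\<^sub>R s + t *\<^sub>R s') \<le> (1 - t) * - up s + t * - up s'" by simp
  qed
  have lo_conv: "convex_on U lo"
  proof (rule convex_onI[OF _ \<open>convex U\<close>])
    fix t s s' :: real assume t: "0 < t" "t < 1" and s: "s \<in> U" "s' \<in> U"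
    have cU: "(1 - t) * s + t * s' \<in> U" using convexD[OF \<open>convex U\<close> s, of "1 - t" t] t by simp
    have "lo ((1 - t) * s + t * s') \<le> (1 - t) * lo s + t * lo s'"
    proof (rule field_le_epsilon)
      fix \<epsilon> :: real assume e: "\<epsilon> > 0"
      define d where "d = min \<epsilon> (min (up s - lo s) (up s' - lo s')) / 2"
      have d: "0 < d" "d < \<epsilon>" "d < up s - lo s" "d < up s' - lo s'"
        using e lt[OF s(1)] lt[OF s(2)] by (auto simp: d_def min_def)
      have "lo s + d \<in> J s" "lo s' + d \<in> J s'" using Jeq[OF s(1)] Jeq[OF s(2)] d by auto
      from comb[OF this, of "1 - t" t] t have "(1 - t) * (lo s + d) + t * (lo s' + d) \<in> J ((1 - t) * s + t * s')" by simp
      then have "lo ((1 - t) * s + t * s') < (1 - t) * (lo s + d) + t * (lo s' + d)" using Jeq[OF cU] by simp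
      moreover have "(1 - t) * (lo s + d) + t * (lo s' + d) = (1 - t) * lo s + t * lo s' + d" by (simp add: algebra_simps)
      ultimately show "lo ((1 - t) * s + t * s') \<le> (1 - t) * lo s + t * lo s' + \<epsilon>" using d by linarith
    qed
    then show "lo ((1 - t) *\<^sub>R s + t *\<^sub>R s') \<le> (1 - t) * lo s + t * lo s'" by simp
  qed
  have y1: "g \<bullet> y \<in> J 1" using y by (simp add: J_def b_def)
  have "(1/2) *\<^sub>R y + (1/2) *\<^sub>R ((2 * (g \<bullet> y)) *\<^sub>R g - y) \<in> Q" using convexD[OF Q(2) y turn[OF y], of "1/2" "1/2"] by simp
  moreover have "(1/2) *\<^sub>R y + (1/2) *\<^sub>R ((2 * (g \<bullet> y)) *\<^sub>R g - y) = (g \<bullet> y) *\<^sub>R g" by (simp add: vec_eq_iff field_simps)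
  ultimately have y0: "g \<bullet> y \<in> J 0" by (simp add: J_def)
  have "{0..1} \<subseteq> U"
  proof
    fix s :: real assume s: "s \<in> {0..1}"
    have "0 \<in> U" "1 \<in> U" using y0 y1 by (auto simp: U_def)
    from convexD[OF \<open>convex U\<close> this, of "1 - s" s] s show "s \<in> U" by simp
  qed
  define a where "a = (\<lambda>s. (up s - lo s) / 2)"
  define m where "m = (\<lambda>s. (up s + lo s) / 2)"
  have "continuous_on U (\<lambda>s. - up s)" "continuous_on U lo"
    using convex_on_continuous[OF \<open>open U\<close>] up_conc lo_conv by blast+
  then have c: "continuous_on {0..1} (\<lambda>s. - up s)" "continuous_on {0..1} lo"
    using continuous_on_subset \<open>{0..1} \<subseteq> U\<close> by blast+
  have "continuous_on {0..1} up" using continuous_on_minus[OF c(1)] by simp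
  with c(2) have "continuous_on {0..1} (\<lambda>s. (up s - lo s) / 2)" by (intro continuous_intros) auto
  then have conta: "continuous_on {0..1} a" by (simp add: a_def)
  \<comment> \<open>Points near the top of one section and near the bottom of another, the latter turned by the
    half-turn, have their half difference in the symmetrised section over the midpoint.\<close>
  have main: "up s - lo s' \<le> 2 * a ((s + s') / 2)" if s: "s \<in> U" "s' \<in> U" for s s'
  proof (rule field_le_epsilon)
    fix \<epsilon> :: real assume e: "\<epsilon> > 0"
    define d where "d = min \<epsilon> (min (up s - lo s) (up s' - lo s')) / 2"
    have d: "0 < d" "2 * d \<le> \<epsilon>" "d < up s - lo s" "d < up s' - lo s'"
      using e lt[OF s(1)] lt[OF s(2)] by (auto simp: d_def min_def)
    define r where "r = up s - d"
    define t where "t = lo s' + d"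
    have "r \<in> J s" "t \<in> J s'" using Jeq[OF s(1)] Jeq[OF s(2)] d by (auto simp: r_def t_def)
    then have A: "s *\<^sub>R b + r *\<^sub>R g \<in> Q" and B: "s' *\<^sub>R b + t *\<^sub>R g \<in> Q" by (auto simp: J_def)
    have "g \<bullet> (s' *\<^sub>R b + t *\<^sub>R g) = t" using gb gg by (simp add: inner_add_right)
    with turn[OF B] have B': "(2 * t) *\<^sub>R g - (s' *\<^sub>R b + t *\<^sub>R g) \<in> Q" by simp
    have "(1/2) *\<^sub>R ((s *\<^sub>R b + r *\<^sub>R g) - ((2 * t) *\<^sub>R g - (s' *\<^sub>R b + t *\<^sub>R g))) \<in> half_diff Q"
      using A B' unfolding half_diff_def by blast
    moreover have "(1/2) *\<^sub>R ((s *\<^sub>R b + r *\<^sub>R g) - ((2 * t) *\<^sub>R g - (s' *\<^sub>R b + t *\<^sub>R g)))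
        = ((s + s') / 2) *\<^sub>R b + ((r - t) / 2) *\<^sub>R g" by (simp add: vec_eq_iff field_simps)
    ultimately have "((s + s') / 2) *\<^sub>R b + ((r - t) / 2) *\<^sub>R g \<in> steiner g Q" using diff by auto
    then obtain p q where pq: "((s + s') / 2) *\<^sub>R b + ((r - t) / 2) *\<^sub>R g + p *\<^sub>R g \<in> Q"
        "((s + s') / 2) *\<^sub>R b + ((r - t) / 2) *\<^sub>R g + q *\<^sub>R g \<in> Q"
        "g \<bullet> (((s + s') / 2) *\<^sub>R b + ((r - t) / 2) *\<^sub>R g) = (p - q) / 2" unfolding steiner_def by blast
    have "(r - t) / 2 + p \<in> J ((s + s') / 2)" "(r - t) / 2 + q \<in> J ((s + s') / 2)"
      using pq(1,2) by (simp_all only: J_def mem_Collect_eq scaleR_add_left add.assoc)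
    moreover have "r - t = p - q" using pq(3) gb gg by (simp add: inner_add_right)
    moreover have "(s + s') / 2 \<in> U" using convexD[OF \<open>convex U\<close> s, of "1/2" "1/2"] by (simp add: add_divide_distrib)
    ultimately have "r - t \<le> up ((s + s') / 2) - lo ((s + s') / 2)" using Jeq[of "(s + s') / 2"] by auto
    then show "up s - lo s' \<le> 2 * a ((s + s') / 2) + \<epsilon>" using d by (simp add: a_def r_def t_def field_simps)
  qed
  have "m 1 = m 0"
  proof (rule second_difference_telescope[OF conta])
    fix s t :: real assume "s \<in> {0..1}" "t \<in> {0..1}"
    then have st: "s \<in> U" "t \<in> U" using \<open>{0..1} \<subseteq> U\<close> by auto
    have "up s - lo t = a s + a t + (m s - m t)" "up t - lo s = a s + a t - (m s - m t)"
      by (simp_all add: a_def m_def field_simps)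
    then show "\<bar>m s - m t\<bar> \<le> 2 * a ((s + t) / 2) - a s - a t"
      using main[OF st] main[OF st(2,1)] by (simp add: add.commute)
  qed
  moreover have "m 0 = \<mu>" using mid by (simp add: m_def up_def lo_def J_def)
  ultimately have sum1: "up 1 + lo 1 = 2 * \<mu>" by (simp add: m_def)
  have "1 \<in> U" using y1 by (auto simp: U_def)
  then have "2 * \<mu> - g \<bullet> y \<in> J 1" using Jeq[of 1] y1 sum1 by auto
  then have "b + (2 * \<mu> - g \<bullet> y) *\<^sub>R g \<in> Q" by (simp add: J_def)
  moreover have "b + (2 * \<mu> - g \<bullet> y) *\<^sub>R g = y + (2 * (\<mu> - g \<bullet> y)) *\<^sub>R g"
    by (simp add: b_def vec_eq_iff algebra_simps)
  ultimately show ?thesis by simp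
qed

text \<open>
  Reflecting in two orthogonal directions is the half-turn about the third.
\<close>

lemma orthonormal_complement:
  fixes g :: "real^3"
  assumes g: "norm g = 1"
  obtains e f where "norm e = 1" "norm f = 1" "g \<bullet> e = 0" "g \<bullet> f = 0" "e \<bullet> f = 0"
    "\<And>y. y - (2 * (e \<bullet> y)) *\<^sub>R e - (2 * (f \<bullet> y)) *\<^sub>R f = (2 * (g \<bullet> y)) *\<^sub>R g - y"
proof -
  obtain e0 where e0: "e0 \<noteq> 0" "orthogonal g e0" using orthogonal_to_vector_exists[of g] by auto
  define e where "e = (1 / norm e0) *\<^sub>R e0"
  have e: "norm e = 1" "g \<bullet> e = 0" using e0 by (auto simp: e_def orthogonal_def)
  define f where "f = cross3 g e"
  have gg: "g \<bullet> g = 1" and ee: "e \<bullet> e = 1" using g e by (simp_all add: dot_square_norm)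
  have "(norm f)\<^sup>2 = 1" using norm_cross[of g e] g e by (simp add: f_def)
  then have f: "norm f = 1" by (simp add: power2_eq_1_iff) (metis norm_ge_zero neg_0_le_iff_le not_one_le_zero)
  have gf: "g \<bullet> f = 0" "e \<bullet> f = 0" by (simp_all add: f_def dot_cross_self)
  have ff: "f \<bullet> f = 1" using f by (simp add: dot_square_norm)
  show thesis
  proof (rule that[OF e(1) f e(2) gf])
    fix y
    define h where "h = y - (e \<bullet> y) *\<^sub>R e - (g \<bullet> y) *\<^sub>R g"
    have "h \<bullet> e = 0" "h \<bullet> g = 0"
      unfolding h_def inner_diff_left inner_scaleR_left
      using e(2) gg ee inner_commute[of y e] inner_commute[of y g] inner_commute[of e g] by simp_all
    then have "cross3 f h = 0" by (simp add: f_def Lagrange cross_skew[of "cross3 g e"])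
    then have "collinear {0, f, h}" by (simp add: cross_eq_0)
    moreover have "f \<noteq> 0" using f by auto
    ultimately obtain c where c: "h = c *\<^sub>R f" by (auto simp: collinear_lemma)
    have "f \<bullet> h = f \<bullet> y" using gf by (simp add: h_def inner_diff_right inner_commute)
    then have "h = (f \<bullet> y) *\<^sub>R f" using c ff by simp
    then have "y - (e \<bullet> y) *\<^sub>R e - (g \<bullet> y) *\<^sub>R g = (f \<bullet> y) *\<^sub>R f" by (simp add: h_def)
    then have y: "y = (f \<bullet> y) *\<^sub>R f + (g \<bullet> y) *\<^sub>R g + (e \<bullet> y) *\<^sub>R e" by (simp add: algebra_simps)
    have "2 *\<^sub>R y = 2 *\<^sub>R ((f \<bullet> y) *\<^sub>R f + (g \<bullet> y) *\<^sub>R g + (e \<bullet> y) *\<^sub>R e)" using y by (rule arg_cong)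
    then have "y + y = (2 * (f \<bullet> y)) *\<^sub>R f + (2 * (g \<bullet> y)) *\<^sub>R g + (2 * (e \<bullet> y)) *\<^sub>R e"
      by (simp add: scaleR_right_distrib scaleR_2)
    then show "y - (2 * (e \<bullet> y)) *\<^sub>R e - (2 * (f \<bullet> y)) *\<^sub>R f = (2 * (g \<bullet> y)) *\<^sub>R g - y"
      by (simp add: algebra_simps)
  qed
qed

lemma steiner_reflection:
  assumes "norm e = 1" "y \<in> steiner e K" shows "y - (2 * (e \<bullet> y)) *\<^sub>R e \<in> steiner e K"
proof -
  have ee: "e \<bullet> e = 1" using assms(1) by (simp add: dot_square_norm)
  obtain p q where pq: "y + p *\<^sub>R e \<in> K" "y + q *\<^sub>R e \<in> K" "e \<bullet> y = (p - q) / 2"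
    using assms(2) unfolding steiner_def by blast
  let ?z = "y - (2 * (e \<bullet> y)) *\<^sub>R e"
  have "?z + (q + 2 * (e \<bullet> y)) *\<^sub>R e \<in> K" "?z + (p + 2 * (e \<bullet> y)) *\<^sub>R e \<in> K"
    using pq(1,2) by (simp_all add: algebra_simps)
  moreover have "e \<bullet> ?z = ((q + 2 * (e \<bullet> y)) - (p + 2 * (e \<bullet> y))) / 2"
    using ee pq(3) by (simp add: inner_diff_right field_simps)
  ultimately show ?thesis unfolding steiner_def by blast
qed

lemma steiner_keeps_reflection:
  assumes ef: "e \<bullet> f = 0" and K: "\<And>y. y \<in> K \<Longrightarrow> y - (2 * (e \<bullet> y)) *\<^sub>R e \<in> K" and y: "y \<in> steiner f K"
  shows "y - (2 * (e \<bullet> y)) *\<^sub>R e \<in> steiner f K"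
proof -
  obtain p q where pq: "y + p *\<^sub>R f \<in> K" "y + q *\<^sub>R f \<in> K" "f \<bullet> y = (p - q) / 2"
    using y unfolding steiner_def by blast
  let ?z = "y - (2 * (e \<bullet> y)) *\<^sub>R e"
  have "?z + p *\<^sub>R f \<in> K" "?z + q *\<^sub>R f \<in> K"
    using K[OF pq(1)] K[OF pq(2)] ef by (simp_all add: inner_add_right algebra_simps)
  moreover have "f \<bullet> ?z = (p - q) / 2" using ef pq(3) by (simp add: inner_diff_right inner_commute)
  ultimately show ?thesis unfolding steiner_def by blast
qed

lemma steiner_heights:
  assumes e: "norm e = 1" "g \<bullet> e = 0"
  shows "(\<lambda>y. g \<bullet> y) ` steiner e K = (\<lambda>y. g \<bullet> y) ` K"
proof
  have ee: "e \<bullet> e = 1" using e(1) by (simp add: dot_square_norm)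
  show "(\<lambda>y. g \<bullet> y) ` steiner e K \<subseteq> (\<lambda>y. g \<bullet> y) ` K"
  proof
    fix t assume "t \<in> (\<lambda>y. g \<bullet> y) ` steiner e K"
    then obtain y p where "t = g \<bullet> y" "y + p *\<^sub>R e \<in> K" unfolding steiner_def by blast
    moreover have "g \<bullet> (y + p *\<^sub>R e) = g \<bullet> y" using e(2) by (simp add: inner_add_right)
    ultimately show "t \<in> (\<lambda>y. g \<bullet> y) ` K" by (metis imageI)
  qed
  show "(\<lambda>y. g \<bullet> y) ` K \<subseteq> (\<lambda>y. g \<bullet> y) ` steiner e K"
  proof
    fix t assume "t \<in> (\<lambda>y. g \<bullet> y) ` K"
    then obtain x where x: "t = g \<bullet> x" "x \<in> K" by blast
    let ?y = "x - (e \<bullet> x) *\<^sub>R e"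
    have "?y + (e \<bullet> x) *\<^sub>R e \<in> K" using x by simp
    moreover have "e \<bullet> ?y = ((e \<bullet> x) - (e \<bullet> x)) / 2" using ee by (simp add: inner_diff_right)
    ultimately have "?y \<in> steiner e K" unfolding steiner_def by blast
    moreover have "g \<bullet> ?y = t" using e(2) x(1) by (simp add: inner_diff_right)
    ultimately show "t \<in> (\<lambda>y. g \<bullet> y) ` steiner e K" by (metis imageI)
  qed
qed

text \<open>
  Symmetrise \<open>K\<close> in two directions orthogonal to \<open>g\<close>. The result \<open>Q\<close> has the same distribution of heights
  over \<open>g\<close>, is invariant under the half-turn about \<open>g\<close>, and satisfies the same volume
  inequality, because symmetrisation only shrinks the difference body (\<open>half_diff_steiner\<close>). The half-turn
  gives the converse inclusion for the direction \<open>g\<close> itself, so equality of volumes makes the two sets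
  equal and \<open>half_turn_symmetric_reflection\<close> applies.
\<close>

lemma heights_symmetric:
  fixes K :: "(real^3) set"
  assumes K: "open K" "convex K" "bounded K" "K \<noteq> {}" and vol: "emeasure lborel (half_diff K) \<le> emeasure lborel K"
    and g: "norm g = 1"
    and mid: "\<mu> = (Inf ((\<lambda>y. g \<bullet> y) ` K) + Sup ((\<lambda>y. g \<bullet> y) ` K)) / 2"
    and F: "F \<in> borel_measurable (borel :: real measure)"
  shows "(\<integral>\<^sup>+x. indicator K x * F (g \<bullet> x) \<partial>lborel) = (\<integral>\<^sup>+x. indicator K x * F (2 * \<mu> - g \<bullet> x) \<partial>lborel)"
    and "(\<lambda>y. g \<bullet> y) ` K = {Inf ((\<lambda>y. g \<bullet> y) ` K) <..< Sup ((\<lambda>y. g \<bullet> y) ` K)}"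
proof -
  obtain e f where e: "norm e = 1" and f: "norm f = 1" and ge: "g \<bullet> e = 0" and gf: "g \<bullet> f = 0" and ef: "e \<bullet> f = 0"
    and dec: "\<And>y. y - (2 * (e \<bullet> y)) *\<^sub>R e - (2 * (f \<bullet> y)) *\<^sub>R f = (2 * (g \<bullet> y)) *\<^sub>R g - y"
    using orthonormal_complement[OF g] by metis
  have gg: "g \<bullet> g = 1" using g by (simp add: dot_square_norm)
  define A where "A = steiner e K"
  define Q where "Q = steiner f A"
  have A: "open A" "convex A" "bounded A" unfolding A_def using K e by (auto intro: open_steiner convex_steiner bounded_steiner)
  have Q: "open Q" "convex Q" "bounded Q" unfolding Q_def using A f by (auto intro: open_steiner convex_steiner bounded_steiner)
  have turn: "(2 * (g \<bullet> y)) *\<^sub>R g - y \<in> Q" if y: "y \<in> Q" for y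
  proof -
    have "y - (2 * (e \<bullet> y)) *\<^sub>R e \<in> Q"
      using steiner_keeps_reflection[OF ef, of A y] steiner_reflection[OF e] y unfolding A_def Q_def by blast
    then have "(y - (2 * (e \<bullet> y)) *\<^sub>R e) - (2 * (f \<bullet> (y - (2 * (e \<bullet> y)) *\<^sub>R e))) *\<^sub>R f \<in> Q"
      using steiner_reflection[OF f] unfolding Q_def by blast
    moreover have "f \<bullet> (y - (2 * (e \<bullet> y)) *\<^sub>R e) = f \<bullet> y" using ef by (simp add: inner_diff_right inner_commute)
    ultimately show ?thesis using dec[of y] by simp
  qed
  \<comment> \<open>The half-turn exchanges \<open>y + q g\<close> with \<open>p g - y\<close>, because \<open>2 (g
    \<bullet> y) = p - q\<close>.\<close>
  have sub: "steiner g Q \<subseteq> half_diff Q"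
  proof
    fix y assume "y \<in> steiner g Q"
    then obtain p q where pq: "y + p *\<^sub>R g \<in> Q" "y + q *\<^sub>R g \<in> Q" "g \<bullet> y = (p - q) / 2" unfolding steiner_def by blast
    have "(2 * (g \<bullet> (y + q *\<^sub>R g))) *\<^sub>R g - (y + q *\<^sub>R g) \<in> Q" by (rule turn[OF pq(2)])
    moreover have "(2 * (g \<bullet> (y + q *\<^sub>R g))) *\<^sub>R g - (y + q *\<^sub>R g) = p *\<^sub>R g - y"
    proof -
      have "2 * (g \<bullet> (y + q *\<^sub>R g)) = p + q" using pq(3) gg by (simp add: inner_add_right field_simps)
      then show ?thesis by (simp add: algebra_simps)
    qed
    ultimately have "p *\<^sub>R g - y \<in> Q" by simp
    moreover have "y = (1/2) *\<^sub>R ((y + p *\<^sub>R g) - (p *\<^sub>R g - y))" by (simp add: vec_eq_iff)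
    ultimately show "y \<in> half_diff Q" using pq(1) unfolding half_diff_def by blast
  qed
  \<comment> \<open>The volume inequality passes from \<open>K\<close> to \<open>A\<close> and from
    \<open>A\<close> to \<open>Q\<close>.\<close>
  have "emeasure lborel (half_diff Q) \<le> emeasure lborel (steiner f (half_diff A))"
    unfolding Q_def using open_steiner[OF open_half_diff[OF A(1)]] by (intro emeasure_mono half_diff_steiner) auto
  also have "\<dots> = emeasure lborel (half_diff A)"
    using A f by (intro emeasure_steiner open_half_diff convex_half_diff bounded_half_diff)
  also have "\<dots> \<le> emeasure lborel (steiner e (half_diff K))"
    unfolding A_def using open_steiner[OF open_half_diff[OF K(1)]] by (intro emeasure_mono half_diff_steiner) auto
  also have "\<dots> = emeasure lborel (half_diff K)"
    using K e by (intro emeasure_steiner open_half_diff convex_half_diff bounded_half_diff)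
  also note vol
  also have "emeasure lborel K = emeasure lborel A" unfolding A_def using K e by (intro emeasure_steiner[symmetric])
  also have "\<dots> = emeasure lborel Q" unfolding Q_def using A f by (intro emeasure_steiner[symmetric])
  also have "\<dots> = emeasure lborel (steiner g Q)" using Q g by (intro emeasure_steiner[symmetric])
  finally have le: "emeasure lborel (half_diff Q) \<le> emeasure lborel (steiner g Q)" .
  have "emeasure lborel (half_diff Q) < \<infinity>" using emeasure_bounded_finite[OF bounded_half_diff[OF Q(3)]] by simp
  from open_convex_subset_eq[OF open_steiner[OF Q(1)] convex_steiner[OF Q(2)] open_half_diff[OF Q(1)] sub le this]
  have diff: "half_diff Q \<subseteq> steiner g Q" by simp
  have hts: "(\<lambda>y. g \<bullet> y) ` K = {t. t *\<^sub>R g \<in> Q}"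
  proof -
    have "(\<lambda>y. g \<bullet> y) ` K = (\<lambda>y. g \<bullet> y) ` Q"
      unfolding Q_def A_def by (simp add: steiner_heights[OF f gf] steiner_heights[OF e ge])
    also have "\<dots> = {t. t *\<^sub>R g \<in> Q}"
    proof
      show "(\<lambda>y. g \<bullet> y) ` Q \<subseteq> {t. t *\<^sub>R g \<in> Q}"
      proof
        fix t assume "t \<in> (\<lambda>y. g \<bullet> y) ` Q"
        then obtain y where y: "t = g \<bullet> y" "y \<in> Q" by blast
        have "(1/2) *\<^sub>R y + (1/2) *\<^sub>R ((2 * (g \<bullet> y)) *\<^sub>R g - y) \<in> Q"
          using convexD[OF Q(2) y(2) turn[OF y(2)], of "1/2" "1/2"] by simp
        moreover have "(1/2) *\<^sub>R y + (1/2) *\<^sub>R ((2 * (g \<bullet> y)) *\<^sub>R g - y) = t *\<^sub>R g"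
          by (simp add: vec_eq_iff field_simps y)
        ultimately show "t \<in> {t. t *\<^sub>R g \<in> Q}" by simp
      qed
      show "{t. t *\<^sub>R g \<in> Q} \<subseteq> (\<lambda>y. g \<bullet> y) ` Q"
      proof
        fix t assume "t \<in> {t. t *\<^sub>R g \<in> Q}"
        moreover have "t = g \<bullet> (t *\<^sub>R g)" using gg by simp
        ultimately show "t \<in> (\<lambda>y. g \<bullet> y) ` Q" by blast
      qed
    qed
    finally show ?thesis .
  qed
  have refl: "y + (2 * (\<mu> - g \<bullet> y)) *\<^sub>R g \<in> Q" if "y \<in> Q" for y
    by (rule half_turn_symmetric_reflection[OF Q g turn diff _ that]) (use mid hts in simp_all)
  show "(\<lambda>y. g \<bullet> y) ` K = {Inf ((\<lambda>y. g \<bullet> y) ` K) <..< Sup ((\<lambda>y. g \<bullet> y) ` K)}"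
  proof -
    have ne: "{t. t *\<^sub>R g \<in> Q} \<noteq> {}" using K(4) hts by (metis image_is_empty)
    show ?thesis unfolding hts
      by (rule open_convex_bounded_real[OF _ _ _ ne]) (use line_section[OF Q g, of 0] in simp_all)
  qed
  have moveQ: "(\<integral>\<^sup>+x. indicator K x * H (g \<bullet> x) \<partial>lborel) = (\<integral>\<^sup>+x. indicator Q x * H (g \<bullet> x) \<partial>lborel)"
    if H: "H \<in> borel_measurable borel" for H :: "real \<Rightarrow> ennreal"
  proof -
    have m: "(\<lambda>x. H (g \<bullet> x)) \<in> borel_measurable borel" using H by measurable
    have "(\<integral>\<^sup>+x. indicator Q x * H (g \<bullet> x) \<partial>lborel) = (\<integral>\<^sup>+x. indicator A x * H (g \<bullet> x) \<partial>lborel)"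
      unfolding Q_def by (rule nn_integral_steiner[OF A f m]) (simp add: inner_add_right gf)
    also have "\<dots> = (\<integral>\<^sup>+x. indicator K x * H (g \<bullet> x) \<partial>lborel)"
      unfolding A_def by (rule nn_integral_steiner[OF K(1-3) e m]) (simp add: inner_add_right ge)
    finally show ?thesis by simp
  qed
  have m1: "(\<lambda>x. indicator Q x * F (g \<bullet> x)) \<in> borel_measurable borel"
    using borel_open[OF Q(1)] F by measurable
  have m2: "(\<lambda>x. indicator Q x * F (2 * \<mu> - g \<bullet> x)) \<in> borel_measurable borel"
    using borel_open[OF Q(1)] F by measurable
  have inner: "(\<integral>\<^sup>+t. indicator Q (x + t *\<^sub>R g) * F (g \<bullet> (x + t *\<^sub>R g)) \<partial>lborel)
      = (\<integral>\<^sup>+t. indicator Q (x + t *\<^sub>R g) * F (2 * \<mu> - g \<bullet> (x + t *\<^sub>R g)) \<partial>lborel)" for x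
  proof -
    define c where "c = 2 * (\<mu> - g \<bullet> x)"
    have "(\<lambda>t. x + t *\<^sub>R g) \<in> borel_measurable borel" by measurable
    from measurable_compose[OF this m1]
    have "(\<integral>\<^sup>+t. indicator Q (x + t *\<^sub>R g) * F (g \<bullet> (x + t *\<^sub>R g)) \<partial>lborel)
        = ennreal \<bar>-1\<bar> * (\<integral>\<^sup>+t. indicator Q (x + (c + (-1) * t) *\<^sub>R g) * F (g \<bullet> (x + (c + (-1) * t) *\<^sub>R g)) \<partial>lborel)"
      by (rule nn_integral_real_affine) simp
    also have "\<dots> = (\<integral>\<^sup>+t. indicator Q (x + t *\<^sub>R g) * F (2 * \<mu> - g \<bullet> (x + t *\<^sub>R g)) \<partial>lborel)"
    proof -
      have sw: "x + (c + (-1) * t) *\<^sub>R g = (x + t *\<^sub>R g) + (2 * (\<mu> - g \<bullet> (x + t *\<^sub>R g))) *\<^sub>R g" for t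
        using gg by (simp add: c_def inner_add_right vec_eq_iff algebra_simps)
      have twice: "c + - 1 * (c + - 1 * t) = t" for t by simp
      have "x + (c + (-1) * t) *\<^sub>R g \<in> Q \<longleftrightarrow> x + t *\<^sub>R g \<in> Q" for t
        using refl[of "x + t *\<^sub>R g"] refl[of "x + (c + (-1) * t) *\<^sub>R g"] unfolding sw[symmetric] twice by blast
      then have i: "indicator Q (x + (c + (-1) * t) *\<^sub>R g) = (indicator Q (x + t *\<^sub>R g) :: ennreal)" for t
        by (simp add: indicator_def)
      have j: "g \<bullet> (x + (c + (-1) * t) *\<^sub>R g) = 2 * \<mu> - g \<bullet> (x + t *\<^sub>R g)" for t
        using gg by (simp add: c_def inner_add_right algebra_simps)
      show ?thesis unfolding i j by simp
    qed
    finally show ?thesis .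
  qed
  have "(\<integral>\<^sup>+x. indicator Q x * F (g \<bullet> x) \<partial>lborel) = (\<integral>\<^sup>+x. indicator Q x * F (2 * \<mu> - g \<bullet> x) \<partial>lborel)"
    unfolding nn_integral_along_direction[OF g m1] nn_integral_along_direction[OF g m2] inner ..
  moreover have "(\<lambda>t. F (2 * \<mu> - t)) \<in> borel_measurable borel" using F by measurable
  ultimately show "(\<integral>\<^sup>+x. indicator K x * F (g \<bullet> x) \<partial>lborel) = (\<integral>\<^sup>+x. indicator K x * F (2 * \<mu> - g \<bullet> x) \<partial>lborel)"
    using moveQ[OF F] moveQ[of "\<lambda>t. F (2 * \<mu> - t)"] by simp
qed

text \<open>
  Heights that are distributed symmetrically about a value have that value as their mean.
\<close>

lemma centroid_height:
  fixes K :: "(real^3) set"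
  assumes K: "open K" "convex K" "bounded K" "K \<noteq> {}" and vol: "emeasure lborel (half_diff K) \<le> emeasure lborel K"
    and g: "norm g = 1"
  shows "g \<bullet> (LINT x|lborel. indicator K x *\<^sub>R x)
    = measure lborel K * ((Inf ((\<lambda>y. g \<bullet> y) ` K) + Sup ((\<lambda>y. g \<bullet> y) ` K)) / 2)"
proof -
  define \<mu> where "\<mu> = (Inf ((\<lambda>y. g \<bullet> y) ` K) + Sup ((\<lambda>y. g \<bullet> y) ` K)) / 2"
  obtain C where C: "\<And>z. z \<in> K \<Longrightarrow> norm z \<le> C" using K(3) bounded_iff by metis
  have fin: "emeasure lborel K < \<infinity>" using emeasure_bounded_finite[OF K(3)] by simp
  have KS: "K \<in> sets lborel" using K(1) by simp
  have int_x: "integrable lborel (\<lambda>x. indicator K x *\<^sub>R x)"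
    by (rule integrableI_bounded_set_indicator[OF KS _ fin, where B=C]) (use C in auto)
  have int_1: "integrable lborel (\<lambda>x. indicator K x *\<^sub>R \<mu>)"
    by (rule integrableI_bounded_set_indicator[OF KS _ fin, where B="\<bar>\<mu>\<bar>"]) auto
  have int_g: "integrable lborel (\<lambda>x. g \<bullet> (indicator K x *\<^sub>R x))" using int_x by (rule integrable_inner_right)
  have int_f: "integrable lborel (\<lambda>x. indicator K x * (g \<bullet> x - \<mu>))"
    using Bochner_Integration.integrable_diff[OF int_g int_1] by (simp add: algebra_simps)
  have "(LINT x|lborel. indicator K x * (g \<bullet> x - \<mu>)) = 0"
  proof -
    have "(\<integral>\<^sup>+x. ennreal (indicator K x * (g \<bullet> x - \<mu>)) \<partial>lborel) = (\<integral>\<^sup>+x. indicator K x * ennreal (g \<bullet> x - \<mu>) \<partial>lborel)"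
      by (intro nn_integral_cong) (simp add: indicator_def)
    also have "\<dots> = (\<integral>\<^sup>+x. indicator K x * ennreal ((2 * \<mu> - g \<bullet> x) - \<mu>) \<partial>lborel)"
      by (rule heights_symmetric(1)[OF K vol g \<mu>_def]) measurable
    also have "\<dots> = (\<integral>\<^sup>+x. ennreal (- (indicator K x * (g \<bullet> x - \<mu>))) \<partial>lborel)"
      by (intro nn_integral_cong) (simp add: indicator_def)
    finally show ?thesis unfolding real_lebesgue_integral_def[OF int_f] by simp
  qed
  then have "(LINT x|lborel. g \<bullet> (indicator K x *\<^sub>R x) - indicator K x *\<^sub>R \<mu>) = 0" by (simp add: algebra_simps)
  then have "(LINT x|lborel. g \<bullet> (indicator K x *\<^sub>R x)) = (LINT x|lborel. indicator K x *\<^sub>R \<mu>)"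
    using int_g int_1 by (simp add: Bochner_Integration.integral_diff)
  also have "\<dots> = measure lborel K * \<mu>" using KS fin by simp
  finally have "(LINT x|lborel. g \<bullet> (indicator K x *\<^sub>R x)) = measure lborel K * \<mu>" .
  moreover have "(LINT x|lborel. g \<bullet> (indicator K x *\<^sub>R x)) = g \<bullet> (LINT x|lborel. indicator K x *\<^sub>R x)"
    by (rule integral_inner_right) (rule int_x)
  ultimately show ?thesis unfolding \<mu>_def by metis
qed

text \<open>
  In every direction the centroid lies halfway between the two supporting planes, so reflection in
  the centroid preserves the support function.
\<close>

theorem centrally_symmetric_if_volume:
  fixes K :: "(real^3) set"
  assumes K: "open K" "convex K" "bounded K" "K \<noteq> {}" and vol: "emeasure lborel (half_diff K) \<le> emeasure lborel K"
  shows "\<exists>c. \<forall>x\<in>K. 2 *\<^sub>R c - x \<in> K"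
proof -
  define c where "c = (1 / measure lborel K) *\<^sub>R (LINT x|lborel. indicator K x *\<^sub>R x)"
  have fin: "emeasure lborel K < \<infinity>" using emeasure_bounded_finite[OF K(3)] by simp
  have "emeasure lborel K \<noteq> 0"
  proof
    assume "emeasure lborel K = 0"
    then have "negligible K" using K(1) by (simp add: negligible_iff_null_sets null_sets_completionI null_sets_def)
    then show False using open_not_negligible K by blast
  qed
  then have pos: "measure lborel K > 0" using fin by (simp add: measure_def enn2real_positive_iff zero_less_iff_neq_zero top.not_eq_extremum)
  have "2 *\<^sub>R c - x \<in> K" if x: "x \<in> K" for x
  proof (rule ccontr)
    assume "2 *\<^sub>R c - x \<notin> K"
    then obtain a b where ab: "a \<noteq> 0" "\<forall>y\<in>K. a \<bullet> y \<le> b" "\<forall>y\<in>{2 *\<^sub>R c - x}. a \<bullet> y \<ge> b"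
      using separating_hyperplane_sets[OF K(2) _ K(4), of "{2 *\<^sub>R c - x}"] by auto
    define g where "g = (1 / norm a) *\<^sub>R a"
    have g: "norm g = 1" using ab(1) by (simp add: g_def)
    define I where "I = (\<lambda>y. g \<bullet> y) ` K"
    have le: "g \<bullet> y \<le> g \<bullet> (2 *\<^sub>R c - x)" if "y \<in> K" for y
    proof -
      have "a \<bullet> y \<le> a \<bullet> (2 *\<^sub>R c - x)" using ab(2,3) that by force
      then show ?thesis unfolding g_def inner_scaleR_left by (intro mult_left_mono) auto
    qed
    have "Sup I \<le> g \<bullet> (2 *\<^sub>R c - x)" unfolding I_def using K(4) le by (intro cSup_least) auto
    moreover have "g \<bullet> c = (Inf I + Sup I) / 2"
      using centroid_height[OF K vol g] pos unfolding c_def I_def by (simp add: inner_scaleR_right)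
    ultimately have "g \<bullet> x \<le> Inf I" by (simp add: inner_diff_right field_simps)
    moreover have "g \<bullet> x \<in> I" using x by (simp add: I_def)
    then have "Inf I < g \<bullet> x" using heights_symmetric(2)[OF K vol g refl, of "\<lambda>_. 0"] unfolding I_def[symmetric] by auto
    ultimately show False by simp
  qed
  then show ?thesis by blast
qed

text \<open>
  Cut \<open>D\<close> into countably many pieces, each moved into \<open>C\<close> by a lattice vector. The moved pieces are
  disjoint because distinct translates of \<open>D\<close> are.
\<close>

lemma volume_packing_covering:
  fixes D C :: "(real^3) set" and L :: "(real^3) set"
  assumes L: "countable L" "0 \<in> L" "\<And>a b. a \<in> L \<Longrightarrow> b \<in> L \<Longrightarrow> a - b \<in> L"
    and D: "D \<in> sets borel" and C: "C \<in> sets borel"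
    and cover: "\<And>x. x \<in> D \<Longrightarrow> \<exists>a\<in>L. x - a \<in> C"
    and pack: "\<And>a x. a \<in> L \<Longrightarrow> x \<in> D \<Longrightarrow> x - a \<in> D \<Longrightarrow> a = 0"
  shows "emeasure lborel D \<le> emeasure lborel C"
proof -
  define a where "a = from_nat_into L"
  have aL: "a n \<in> L" for n unfolding a_def using L(2) by (intro from_nat_into) auto
  have ran: "\<exists>n. a n = b" if "b \<in> L" for b
    using that from_nat_into_surj[OF L(1)] unfolding a_def by blast
  define B where "B = (\<lambda>n. D \<inter> (\<lambda>x. x - a n) -` C)"
  have meas: "(\<lambda>x. x - v) \<in> borel_measurable borel" "(\<lambda>x. x + v) \<in> borel_measurable borel" for v :: "real^3" by measurable
  have Bm: "B n \<in> sets borel" for n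
    using measurable_sets[OF meas(1) C, of "a n"] D by (auto simp: B_def)
  define E where "E = disjointed B"
  have Em: "E n \<in> sets borel" for n unfolding E_def using sets.range_disjointed_sets[of B borel] Bm by auto
  have EB: "E n \<subseteq> B n" for n unfolding E_def by (rule disjointed_subset)
  have UE: "D = (\<Union>n. E n)"
  proof -
    have "D = (\<Union>n. B n)"
    proof
      show "D \<subseteq> (\<Union>n. B n)"
      proof
        fix x assume x: "x \<in> D"
        then obtain b where "b \<in> L" "x - b \<in> C" using cover by blast
        then show "x \<in> (\<Union>n. B n)" using ran[of b] x by (auto simp: B_def)
      qed
    qed (auto simp: B_def)
    then show ?thesis unfolding E_def UN_disjointed_eq .
  qed
  define S where "S = (\<lambda>n. (\<lambda>x. x + a n) -` E n)"
  have Sm: "S n \<in> sets borel" for n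
    using measurable_sets[OF meas(2) Em[of n], of "a n"] by (simp add: S_def)
  have eq: "emeasure lborel (S n) = emeasure lborel (E n)" for n
  proof -
    have "emeasure lborel (E n) = emeasure (distr lborel borel ((+) (a n))) (E n)" by (simp add: lborel_distr_plus)
    also have "\<dots> = emeasure lborel ((+) (a n) -` E n)" using Em by (subst emeasure_distr) auto
    also have "(+) (a n) -` E n = S n" by (auto simp: S_def add.commute)
    finally show ?thesis by simp
  qed
  have disj: "disjoint_family S"
    unfolding disjoint_family_on_def
  proof (intro ballI impI, rule ccontr)
    fix m n :: nat assume mn: "m \<noteq> n" and "S m \<inter> S n \<noteq> {}"
    then obtain x where x: "x + a m \<in> E m" "x + a n \<in> E n" by (auto simp: S_def)
    then have "x + a m \<in> D" "x + a n \<in> D" using EB by (auto simp: B_def)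
    then have "a m - a n = 0" using pack[OF L(3)[OF aL aL], of "x + a m" m n] by simp
    then have "x + a m \<in> E m \<inter> E n" using x by simp
    then show False using disjoint_family_disjointed[of B] mn unfolding E_def disjoint_family_on_def by blast
  qed
  have "emeasure lborel D = (\<Sum>n. emeasure lborel (E n))"
    unfolding UE using Em disjoint_family_disjointed[of B] by (intro suminf_emeasure[symmetric]) (auto simp: E_def)
  also have "\<dots> = (\<Sum>n. emeasure lborel (S n))" by (simp add: eq)
  also have "\<dots> = emeasure lborel (\<Union>n. S n)" using Sm disj by (intro suminf_emeasure) auto
  also have "\<dots> \<le> emeasure lborel C"
  proof (rule emeasure_mono)
    show "(\<Union>n. S n) \<subseteq> C"
    proof
      fix x assume "x \<in> (\<Union>n. S n)"
      then obtain n where "x + a n \<in> E n" by (auto simp: S_def)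
      then have "x + a n \<in> B n" using EB by blast
      then show "x \<in> C" by (simp add: B_def)
    qed
  qed (use C in simp)
  finally show ?thesis .
qed

text \<open>
  Minkowski's observation: if \<open>(p - q) / 2\<close> and \<open>(r - s) / 2\<close> differ by a lattice vector, then so do the
  interior points \<open>(p + s) / 2\<close> and \<open>(q + r) / 2\<close> of \<open>P\<close>.
\<close>

theorem lattice_tile_centrally_symmetric:
  fixes P L :: "(real^3) set"
  assumes P: "compact P" "convex P" "interior P \<noteq> {}"
    and L: "countable L" "0 \<in> L" "\<And>a b. a \<in> L \<Longrightarrow> b \<in> L \<Longrightarrow> a - b \<in> L"
    and cover: "\<And>x. \<exists>a\<in>L. x - a \<in> P"
    and pack: "\<And>a x. a \<in> L \<Longrightarrow> x \<in> interior P \<Longrightarrow> x - a \<in> interior P \<Longrightarrow> a = 0"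
  shows "\<exists>c. \<forall>x\<in>P. 2 *\<^sub>R c - x \<in> P"
proof -
  let ?K = "interior P"
  have K: "open ?K" "convex ?K" "bounded ?K" "?K \<noteq> {}"
    using P by (auto intro: convex_interior bounded_interior compact_imp_bounded)
  have "emeasure lborel (half_diff ?K) \<le> emeasure lborel P"
  proof (rule volume_packing_covering[OF L])
    fix a x assume a: "a \<in> L" and x: "x \<in> half_diff ?K" "x - a \<in> half_diff ?K"
    obtain p q where pq: "x = (1/2) *\<^sub>R (p - q)" "p \<in> ?K" "q \<in> ?K" using x(1) unfolding half_diff_def by blast
    obtain r s where rs: "x - a = (1/2) *\<^sub>R (r - s)" "r \<in> ?K" "s \<in> ?K" using x(2) unfolding half_diff_def by blast
    have "(1/2) *\<^sub>R p + (1/2) *\<^sub>R s \<in> ?K" "(1/2) *\<^sub>R q + (1/2) *\<^sub>R r \<in> ?K" using convexD[OF K(2), of _ _ "1/2" "1/2"] pq rs by auto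
    moreover have "(1/2) *\<^sub>R q + (1/2) *\<^sub>R r = ((1/2) *\<^sub>R p + (1/2) *\<^sub>R s) - a"
    proof -
      have "a = (1/2) *\<^sub>R (p - q) - (1/2) *\<^sub>R (r - s)" using pq(1) rs(1) by (metis diff_diff_eq2 add_diff_cancel_left')
      then show ?thesis by (simp add: vec_eq_iff field_simps)
    qed
    ultimately show "a = 0" using pack[OF a] by metis
  qed (use cover P K open_half_diff[OF K(1)] in \<open>auto intro: borel_compact\<close>)
  also have "emeasure lborel P = emeasure lborel ?K"
  proof -
    have "negligible (frontier P)" by (rule negligible_convex_frontier[OF P(2)])
    then have "frontier P \<in> null_sets lborel"
      by (simp add: negligible_iff_null_sets null_sets_completion_iff)
    moreover have "P = ?K \<union> frontier P" using P(1)
      by (auto simp: frontier_def compact_imp_closed closure_closed dest: subsetD[OF interior_subset])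
    ultimately show ?thesis using emeasure_Un_null_set[of ?K lborel "frontier P"] by simp
  qed
  finally obtain c where c: "\<forall>x\<in>?K. 2 *\<^sub>R c - x \<in> ?K" using centrally_symmetric_if_volume[OF K] by blast
  have cl: "closure ?K = P" using convex_closure_interior[OF P(2,3)] P(1) by (simp add: compact_imp_closed closure_closed)
  have "closed ((\<lambda>x. 2 *\<^sub>R c - x) -` P)"
    by (rule continuous_closed_vimage) (auto intro!: compact_imp_closed P continuous_intros)
  moreover have "?K \<subseteq> (\<lambda>x. 2 *\<^sub>R c - x) -` P" using c interior_subset by auto
  ultimately have "closure ?K \<subseteq> (\<lambda>x. 2 *\<^sub>R c - x) -` P" by (rule closure_minimal[rotated])
  then show ?thesis unfolding cl by auto
qed

section \<open>Three-dimensional determinants and centrally symmetric hexagons\<close>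

definition det3 :: "real^3 \<Rightarrow> real^3 \<Rightarrow> real^3 \<Rightarrow> real" where
  "det3 x y z = x \<bullet> cross3 y z"

lemma det3_expand:
  "det3 x y z = x$1 * (y$2 * z$3 - y$3 * z$2) + x$2 * (y$3 * z$1 - y$1 * z$3) + x$3 * (y$1 * z$2 - y$2 * z$1)"
  by (simp add: det3_def inner_vec_def sum_3 cross3_def)

text \<open>
  Cramer's rule, without dividing by the determinant.
\<close>

lemma cramer3:
  "det3 x y z *\<^sub>R r = det3 r y z *\<^sub>R x + det3 x r z *\<^sub>R y + det3 x y r *\<^sub>R z"
  unfolding vec_eq_iff forall_3 det3_expand by (auto simp: algebra_simps)

lemma cramer3_solve:
  assumes "det3 x y z \<noteq> 0" obtains a b c where "r = a *\<^sub>R x + b *\<^sub>R y + c *\<^sub>R z"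
proof -
  have "r = (1 / det3 x y z) *\<^sub>R (det3 x y z *\<^sub>R r)" using assms by simp
  also have "\<dots> = (det3 r y z / det3 x y z) *\<^sub>R x + (det3 x r z / det3 x y z) *\<^sub>R y + (det3 x y r / det3 x y z) *\<^sub>R z"
    unfolding cramer3[of x y z r] by (simp add: scaleR_right_distrib)
  finally show thesis using that by blast
qed

text \<open>
  Modulo the direction \<open>w\<close>, the union of the triangles \<open>0, A, - B\<close> and \<open>0, - A, B\<close>. The parameters \<open>p\<close>
  and \<open>q\<close> of equal sign describe both triangles at once.
\<close>

definition in_triangles :: "real^3 \<Rightarrow> real^3 \<Rightarrow> real^3 \<Rightarrow> real^3 \<Rightarrow> bool" where
  "in_triangles w A B r \<longleftrightarrow> (\<exists>p q t. p * q \<ge> 0 \<and> \<bar>p + q\<bar> \<le> 1 \<and> r = p *\<^sub>R A - q *\<^sub>R B + t *\<^sub>R w)"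

lemma in_trianglesI:
  assumes "p * q \<le> 0" "\<bar>p - q\<bar> \<le> 1" "r = p *\<^sub>R A + q *\<^sub>R B + t *\<^sub>R w"
  shows "in_triangles w A B r"
  unfolding in_triangles_def using assms by (intro exI[of _ p] exI[of _ "-q"] exI[of _ t]) auto

text \<open>
  If \<open>a > 0\<close>, the first equation gives \<open>\<bar>b\<bar> \<ge> 1 + a\<close>. A negative \<open>b\<close> then contradicts \<open>\<bar>a - b\<bar> \<le> 1\<close>, and a
  positive one the second equation.
\<close>

lemma hexagon_arith:
  fixes a b s t :: real
  assumes "\<bar>s\<bar> \<le> 1" "\<bar>t\<bar> \<le> 1" "a + b * t = -1" "a * s + b = -1" "\<bar>a - b\<bar> \<le> 1"
  shows "a \<le> 0"
proof (rule ccontr)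
  assume "\<not> a \<le> 0"
  then have a: "a > 0" by simp
  have "\<bar>b * t\<bar> \<le> \<bar>b\<bar>" "\<bar>a * s\<bar> \<le> \<bar>a\<bar>"
    using assms(1,2) by (auto simp: abs_mult intro: mult_left_le)
  then show False using assms(3-5) a by linarith
qed

text \<open>
  In the coordinates of \<open>Y1\<close> and \<open>Y2\<close> the third point has nonpositive coordinates \<open>a\<close> and \<open>b\<close>. So the
  vectors \<open>Y1, - Y3, Y2, - Y1, Y3, - Y2\<close> go once around the origin, and \<open>r\<close> lies in the cone between two
  neighbours \<open>Yi\<close>, \<open>- Yj\<close>. The strip of \<open>gij\<close> bounds it there by the segment from \<open>Yi\<close> to \<open>- Yj\<close>.
\<close>

lemma hexagon_independent:
  assumes g12: "g12 \<bullet> w = 0" "\<And>y. y \<in> P \<Longrightarrow> \<bar>g12 \<bullet> y\<bar> \<le> 1" "g12 \<bullet> Y1 = 1" "g12 \<bullet> Y2 = -1"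
    and g13: "g13 \<bullet> w = 0" "\<And>y. y \<in> P \<Longrightarrow> \<bar>g13 \<bullet> y\<bar> \<le> 1" "g13 \<bullet> Y1 = 1" "g13 \<bullet> Y3 = -1"
    and g23: "g23 \<bullet> w = 0" "\<And>y. y \<in> P \<Longrightarrow> \<bar>g23 \<bullet> y\<bar> \<le> 1" "g23 \<bullet> Y2 = 1" "g23 \<bullet> Y3 = -1"
    and Y: "Y1 \<in> P" "Y2 \<in> P" "Y3 \<in> P" and r: "r \<in> P"
    and indep: "det3 w Y1 Y2 \<noteq> 0"
  shows "in_triangles w Y1 Y2 r \<or> in_triangles w Y1 Y3 r \<or> in_triangles w Y2 Y3 r"
proof -
  obtain c a b where Y3: "Y3 = c *\<^sub>R w + a *\<^sub>R Y1 + b *\<^sub>R Y2" using cramer3_solve[OF indep] by metis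
  obtain t p q where req: "r = t *\<^sub>R w + p *\<^sub>R Y1 + q *\<^sub>R Y2" using cramer3_solve[OF indep] by metis
  define s3 where "s3 = g23 \<bullet> Y1"
  define t3 where "t3 = g13 \<bullet> Y2"
  have st: "\<bar>s3\<bar> \<le> 1" "\<bar>t3\<bar> \<le> 1" using g23(2)[OF Y(1)] g13(2)[OF Y(2)] by (auto simp: s3_def t3_def)
  have ab: "a + b * t3 = -1" "a * s3 + b = -1"
    using g13(4) g23(4) by (simp_all add: Y3 inner_add_right g13 g23 s3_def t3_def)
  have amb: "\<bar>a - b\<bar> \<le> 1" using g12(2)[OF Y(3)] by (simp add: Y3 inner_add_right g12)
  have a0: "a \<le> 0" using hexagon_arith[OF st ab amb] .
  have b0: "b \<le> 0" using hexagon_arith[OF st(2,1), of b a] ab amb by (simp add: algebra_simps abs_minus_commute)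
  show ?thesis
  proof (cases "p * q \<le> 0")
    case True
    moreover have "\<bar>p - q\<bar> \<le> 1" using g12(2)[OF r] by (simp add: req inner_add_right g12)
    ultimately have "in_triangles w Y1 Y2 r"
      by (rule in_trianglesI[where t=t]) (simp add: req)
    then show ?thesis by simp
  next
    case False
    then have pq: "p \<noteq> 0" "q \<noteq> 0" "p * q > 0" by auto
    \<comment> \<open>The line through \<open>Y3\<close> separates the cones next to it; the sign of a determinant
      tells in which of them \<open>r\<close> lies.\<close>
    show ?thesis
    proof (cases "q * a * p \<le> b * p * p")
      case True
      have an: "a \<noteq> 0"
      proof
        assume "a = 0"
        then have "b * (p * p) \<ge> 0" using True by (simp add: mult.assoc)
        moreover have "p * p > 0" using pq(1) not_real_square_gt_zero by blast
        ultimately have "b \<ge> 0" by (simp add: zero_le_mult_iff)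
        then show False using b0 ab \<open>a = 0\<close> by simp
      qed
      have "a *\<^sub>R Y1 = Y3 - c *\<^sub>R w - b *\<^sub>R Y2" by (simp add: Y3)
      then have "(p / a) *\<^sub>R (a *\<^sub>R Y1) = (p / a) *\<^sub>R (Y3 - c *\<^sub>R w - b *\<^sub>R Y2)" by (rule arg_cong)
      then have "p *\<^sub>R Y1 = (p / a) *\<^sub>R (Y3 - c *\<^sub>R w - b *\<^sub>R Y2)" using an by simp
      then have req2: "r = (q - b * (p / a)) *\<^sub>R Y2 + (p / a) *\<^sub>R Y3 + (t - c * (p / a)) *\<^sub>R w"
        by (simp add: req algebra_simps)
      have "(q - b * (p / a)) * (p / a) = (q * a * p - b * p * p) / (a * a)"
        using an by (simp add: field_simps)
      also have "\<dots> \<le> 0" using True by (intro divide_nonpos_nonneg) auto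
      finally have "(q - b * (p / a)) * (p / a) \<le> 0" .
      moreover have "\<bar>(q - b * (p / a)) - p / a\<bar> \<le> 1"
        using g23(2)[OF r] unfolding req2 by (simp add: inner_add_right g23)
      ultimately have "in_triangles w Y2 Y3 r" using req2 by (rule in_trianglesI)
      then show ?thesis by simp
    next
      case False
      have "p * (p * b - q * a) < 0" using False by (simp add: algebra_simps)
      then have "q * (p * b - q * a) < 0"
        using pq(3) by (metis mult_less_0_iff zero_less_mult_iff less_asym)
      then have le: "p * b * q - a * q * q < 0" by (simp add: algebra_simps)
      have bn: "b \<noteq> 0"
      proof
        assume "b = 0"
        then have "a * (q * q) > 0" using le by (simp add: mult.assoc)
        then show False using a0 by (simp add: zero_less_mult_iff)
      qed
      have "b *\<^sub>R Y2 = Y3 - c *\<^sub>R w - a *\<^sub>R Y1" by (simp add: Y3)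
      then have "(q / b) *\<^sub>R (b *\<^sub>R Y2) = (q / b) *\<^sub>R (Y3 - c *\<^sub>R w - a *\<^sub>R Y1)" by (rule arg_cong)
      then have "q *\<^sub>R Y2 = (q / b) *\<^sub>R (Y3 - c *\<^sub>R w - a *\<^sub>R Y1)" using bn by simp
      then have req2: "r = (p - a * (q / b)) *\<^sub>R Y1 + (q / b) *\<^sub>R Y3 + (t - c * (q / b)) *\<^sub>R w"
        by (simp add: req algebra_simps)
      have "(p - a * (q / b)) * (q / b) = (p * b * q - a * q * q) / (b * b)"
        using bn by (simp add: field_simps)
      also have "\<dots> \<le> 0" using le by (intro divide_nonpos_nonneg) auto
      finally have "(p - a * (q / b)) * (q / b) \<le> 0" .
      moreover have "\<bar>(p - a * (q / b)) - q / b\<bar> \<le> 1"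
        using g13(2)[OF r] unfolding req2 by (simp add: inner_add_right g13)
      ultimately have "in_triangles w Y1 Y3 r" using req2 by (rule in_trianglesI)
      then show ?thesis by simp
    qed
  qed
qed

lemma antipodal_if_dependent:
  assumes g: "g \<bullet> w = 0" "g \<bullet> Y1 = 1" "g \<bullet> Y2 = -1" and dep: "det3 w Y1 Y2 = 0" and w: "w \<noteq> 0"
  obtains t where "Y2 = - Y1 + t *\<^sub>R w"
proof -
  have "cross3 w Y1 \<noteq> 0"
  proof
    assume "cross3 w Y1 = 0"
    then have "collinear {0, w, Y1}" by (simp add: cross_eq_0)
    then obtain c where "Y1 = c *\<^sub>R w" using w by (auto simp: collinear_lemma)
    then show False using g by simp
  qed
  define r where "r = cross3 w Y1"
  define k where "k = det3 w Y1 r"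
  have k: "k \<noteq> 0"
  proof -
    have "k = r \<bullet> r" by (simp add: k_def det3_expand r_def inner_vec_def sum_3 cross3_def algebra_simps)
    then show ?thesis using \<open>cross3 w Y1 \<noteq> 0\<close> by (simp add: r_def)
  qed
  have eq: "0 = det3 r Y1 Y2 *\<^sub>R w + det3 w r Y2 *\<^sub>R Y1 + k *\<^sub>R Y2"
    using cramer3[of w Y1 Y2 r] dep by (simp add: k_def)
  have "0 = g \<bullet> (det3 r Y1 Y2 *\<^sub>R w + det3 w r Y2 *\<^sub>R Y1 + k *\<^sub>R Y2)" using eq by simp
  then have "det3 w r Y2 = k" using g by (simp add: inner_add_right)
  then have "k *\<^sub>R Y2 = - (k *\<^sub>R Y1) - det3 r Y1 Y2 *\<^sub>R w"
    using eq by (simp add: algebra_simps eq_neg_iff_add_eq_0)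
  then have "(1/k) *\<^sub>R (k *\<^sub>R Y2) = (1/k) *\<^sub>R (- (k *\<^sub>R Y1) - det3 r Y1 Y2 *\<^sub>R w)" by (rule arg_cong)
  then have "Y2 = - Y1 + (- det3 r Y1 Y2 / k) *\<^sub>R w" using k by (simp add: scaleR_right_diff_distrib)
  then show thesis by (rule that)
qed

text \<open>
  Three points of \<open>P\<close>, pairwise on opposite supporting planes parallel to \<open>w\<close>, determine \<open>P\<close> modulo \<open>w\<close> up
  to six triangles. If two of them are antipodal modulo \<open>w\<close>, the hexagon degenerates to a parallelogram
  and the third point serves as the second coordinate direction.
\<close>

lemma hexagon:
  assumes g12: "g12 \<bullet> w = 0" "\<And>y. y \<in> P \<Longrightarrow> \<bar>g12 \<bullet> y\<bar> \<le> 1" "g12 \<bullet> Y1 = 1" "g12 \<bullet> Y2 = -1"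
    and g13: "g13 \<bullet> w = 0" "\<And>y. y \<in> P \<Longrightarrow> \<bar>g13 \<bullet> y\<bar> \<le> 1" "g13 \<bullet> Y1 = 1" "g13 \<bullet> Y3 = -1"
    and g23: "g23 \<bullet> w = 0" "\<And>y. y \<in> P \<Longrightarrow> \<bar>g23 \<bullet> y\<bar> \<le> 1" "g23 \<bullet> Y2 = 1" "g23 \<bullet> Y3 = -1"
    and Y: "Y1 \<in> P" "Y2 \<in> P" "Y3 \<in> P" and r: "r \<in> P" and w: "w \<noteq> 0"
  shows "in_triangles w Y1 Y2 r \<or> in_triangles w Y1 Y3 r \<or> in_triangles w Y2 Y3 r"
proof (cases "det3 w Y1 Y2 = 0")
  case False
  then show ?thesis using hexagon_independent[OF g12 g13 g23 Y r] by blast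
next
  case True
  obtain s where s: "Y2 = - Y1 + s *\<^sub>R w" using antipodal_if_dependent[OF g12(1,3,4) True w] .
  have "det3 w Y1 Y3 \<noteq> 0"
  proof
    assume "det3 w Y1 Y3 = 0"
    then obtain s' where s': "Y3 = - Y1 + s' *\<^sub>R w" using antipodal_if_dependent[OF g13(1,3,4) _ w] by blast
    then show False using s g23 by (simp add: inner_diff_right)
  qed
  then obtain t p q where req: "r = t *\<^sub>R w + p *\<^sub>R Y1 + q *\<^sub>R Y3" by (rule cramer3_solve)
  show ?thesis
  proof (cases "p * q \<le> 0")
    case True
    moreover have "\<bar>p - q\<bar> \<le> 1" using g13(2)[OF r] by (simp add: req inner_add_right g13)
    ultimately have "in_triangles w Y1 Y3 r"
      by (rule in_trianglesI[where t=t]) (simp add: req)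
    then show ?thesis by simp
  next
    case False
    have Y1: "Y1 = - Y2 + s *\<^sub>R w" using s by simp
    have req2: "r = (- p) *\<^sub>R Y2 + q *\<^sub>R Y3 + (t + p * s) *\<^sub>R w"
      unfolding req Y1 by (simp add: algebra_simps)
    have "(- p) * q \<le> 0" using False by simp
    moreover have "\<bar>- p - q\<bar> \<le> 1"
      using g23(2)[OF r] unfolding req2 by (simp add: inner_add_right inner_diff_right g23)
    ultimately have "in_triangles w Y2 Y3 r" using req2 by (rule in_trianglesI)
    then show ?thesis by simp
  qed
qed

section \<open>Tiles around a generic point of an edge\<close>

definition support_face :: "(real^3) set \<Rightarrow> real^3 \<Rightarrow> (real^3) set" where
  "support_face P u = {x\<in>P. \<forall>y\<in>P. u \<bullet> y \<le> u \<bullet> x}"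

text \<open>
  For a face with normal orthogonal to \<open>w\<close>, this means that the face is a fibre of the projection along \<open>w\<close> over an
  exposed point of the projected body. Single points are included, as edges of length zero.
\<close>

definition on_line :: "real^3 \<Rightarrow> (real^3) set \<Rightarrow> bool" where
  "on_line w S \<longleftrightarrow> (\<forall>x\<in>S. \<forall>y\<in>S. \<exists>t. y = x + t *\<^sub>R w)"

text \<open>
  Covering and packing are stated through differences \<open>x - a\<close>, the position of \<open>x\<close> in the tile with
  centre \<open>a\<close>; tiles may meet in parts of faces.
\<close>

locale symmetric_tile =
  fixes P L :: "(real^3) set"
  assumes compact: "compact P" and convex: "convex P" and interior_nonempty: "interior P \<noteq> {}"
    and symmetric: "x \<in> P \<Longrightarrow> - x \<in> P"
    and lattice_zero: "0 \<in> L" and lattice_diff: "a \<in> L \<Longrightarrow> b \<in> L \<Longrightarrow> a - b \<in> L"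
    and locally_finite: "finite {a\<in>L. norm a \<le> C}"
    and covering: "\<exists>a\<in>L. x - a \<in> P"
    and packing: "a \<in> L \<Longrightarrow> x \<in> interior P \<Longrightarrow> x - a \<in> interior P \<Longrightarrow> a = 0"
begin

definition tiles_at :: "real^3 \<Rightarrow> (real^3) set" where
  "tiles_at x = {a\<in>L. x - a \<in> P}"

text \<open>
  No tile at \<open>x\<close> ends there along \<open>w\<close>, so every plane separating two of them at \<open>x\<close> is parallel to \<open>w\<close>.
\<close>

definition generic :: "real^3 \<Rightarrow> real^3 \<Rightarrow> bool" where
  "generic w x \<longleftrightarrow> (\<forall>a\<in>tiles_at x. \<exists>d>0. x - a + d *\<^sub>R w \<in> P \<and> x - a - d *\<^sub>R w \<in> P)"

lemma lattice_uminus: "a \<in> L \<Longrightarrow> - a \<in> L"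
  using lattice_diff[OF lattice_zero, of a] by simp

lemma lattice_add: "a \<in> L \<Longrightarrow> b \<in> L \<Longrightarrow> a + b \<in> L"
  using lattice_diff[of a "- b"] lattice_uminus[of b] by simp

lemma symmetric_iff: "- x \<in> P \<longleftrightarrow> x \<in> P"
  using symmetric[of x] symmetric[of "- x"] by auto

lemma zero_in_P: "0 \<in> P"
proof -
  obtain x where "x \<in> P" using interior_nonempty interior_subset by blast
  then have "(1/2) *\<^sub>R x + (1/2) *\<^sub>R (- x) \<in> P"
    using convex symmetric by (intro convexD) auto
  then show ?thesis by simp
qed

lemma no_functional_vanishes:
  assumes "\<And>y. y \<in> P \<Longrightarrow> g \<bullet> y = 0" shows "g = 0"
proof (rule ccontr)
  assume g: "g \<noteq> 0"
  obtain x e where e: "e > 0" "cball x e \<subseteq> P"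
    using interior_nonempty mem_interior_cball by blast
  have "x + (e / norm g) *\<^sub>R g \<in> cball x e" using e g by (simp add: dist_norm)
  moreover have "x \<in> cball x e" using e by simp
  ultimately have "g \<bullet> (x + (e / norm g) *\<^sub>R g) = 0" "g \<bullet> x = 0"
    using assms e(2) by blast+
  then show False using e g by (simp add: inner_add_right)
qed

lemma support_face_nonempty: "support_face P u \<noteq> {}"
proof -
  have "continuous_on P (\<lambda>x. u \<bullet> x)" by (intro continuous_intros)
  with compact zero_in_P obtain x where "x \<in> P" "\<forall>y\<in>P. u \<bullet> y \<le> u \<bullet> x"
    using continuous_attains_sup[of P "\<lambda>x. u \<bullet> x"] by blast
  then show ?thesis unfolding support_face_def by auto
qed

lemma support_face_uminus: "x \<in> support_face P (- u) \<longleftrightarrow> - x \<in> support_face P u"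
proof -
  have "(\<forall>y\<in>P. - u \<bullet> y \<le> - u \<bullet> x) \<longleftrightarrow> (\<forall>y\<in>P. u \<bullet> y \<le> u \<bullet> (- x))"
  proof (intro iffI ballI)
    fix y assume "\<forall>y\<in>P. - u \<bullet> y \<le> - u \<bullet> x" "y \<in> P"
    then have "- u \<bullet> (- y) \<le> - u \<bullet> x" using symmetric by blast
    then show "u \<bullet> y \<le> u \<bullet> (- x)" by simp
  next
    fix y assume "\<forall>y\<in>P. u \<bullet> y \<le> u \<bullet> (- x)" "y \<in> P"
    then have "u \<bullet> (- y) \<le> u \<bullet> (- x)" using symmetric by blast
    then show "- u \<bullet> y \<le> - u \<bullet> x" by simp
  qed
  then show ?thesis unfolding support_face_def by (simp add: symmetric_iff)
qed

lemma finite_tiles_near: "finite {a\<in>L. \<exists>y. norm (y - x) \<le> 1 \<and> y - a \<in> P}"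
proof -
  obtain C where C: "\<And>y. y \<in> P \<Longrightarrow> norm y \<le> C"
    using compact compact_imp_bounded bounded_iff by metis
  have "norm a \<le> norm x + 1 + C" if "norm (y - x) \<le> 1" "y - a \<in> P" for a y
  proof -
    have "a = x + (y - x) - (y - a)" by simp
    then have "norm a \<le> norm (x + (y - x)) + norm (y - a)" by (metis norm_triangle_ineq4)
    also have "norm (x + (y - x)) \<le> norm x + norm (y - x)" by (rule norm_triangle_ineq)
    finally show ?thesis using C[OF that(2)] that(1) by linarith
  qed
  then have "{a\<in>L. \<exists>y. norm (y - x) \<le> 1 \<and> y - a \<in> P} \<subseteq> {a\<in>L. norm a \<le> norm x + 1 + C}"
    by auto
  then show ?thesis using locally_finite finite_subset by blast
qed

lemma closed_tile: "closed {y. y - a \<in> P}"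
proof -
  have "closed ((\<lambda>y. y - a) -` P)"
    by (rule continuous_closed_vimage) (auto intro!: compact_imp_closed compact continuous_intros)
  then show ?thesis by (simp add: vimage_def)
qed

lemma local_cover:
  obtains r where "r > 0" "\<And>y. dist x y < r \<Longrightarrow> \<exists>a\<in>tiles_at x. y - a \<in> P"
proof -
  let ?F = "{a\<in>L. \<exists>y. norm (y - x) \<le> 1 \<and> y - a \<in> P}"
  have "\<forall>\<^sub>F y in nhds x. \<forall>a\<in>?F - tiles_at x. y - a \<notin> P"
  proof (rule eventually_ball_finite)
    show "finite (?F - tiles_at x)" using finite_tiles_near by auto
    show "\<forall>a\<in>?F - tiles_at x. \<forall>\<^sub>F y in nhds x. y - a \<notin> P"
    proof
      fix a assume "a \<in> ?F - tiles_at x"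
      then have "x \<in> - {y. y - a \<in> P}" unfolding tiles_at_def by auto
      moreover have "open (- {y. y - a \<in> P})" using closed_tile by auto
      ultimately show "\<forall>\<^sub>F y in nhds x. y - a \<notin> P"
        using eventually_nhds_in_open by fastforce
    qed
  qed
  then obtain r where r: "r > 0" "\<And>y. dist y x < r \<Longrightarrow> \<forall>a\<in>?F - tiles_at x. y - a \<notin> P"
    unfolding eventually_nhds_metric by blast
  show thesis
  proof
    show "min r 1 > 0" using r by auto
    fix y assume y: "dist x y < min r 1"
    obtain a where a: "a \<in> L" "y - a \<in> P" using covering by blast
    have ny: "norm (y - x) \<le> 1" using y by (simp add: dist_norm norm_minus_commute)
    have "a \<in> ?F" using a ny by blast
    moreover have "dist y x < r" using y by (simp add: dist_commute)
    ultimately show "\<exists>a\<in>tiles_at x. y - a \<in> P" using r(2)[of y] a(2) by blast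
  qed
qed

text \<open>
  Two tiles are separated by a plane through \<open>x\<close>. Central symmetry puts their positions of \<open>x\<close> on opposite
  supporting planes of \<open>P\<close>, and genericity makes these planes parallel to \<open>w\<close>. The functional is scaled so
  that its maximum on \<open>P\<close> is one.
\<close>

lemma separation:
  assumes gen: "generic w x" and a: "a \<in> tiles_at x" and b: "b \<in> tiles_at x" and "a \<noteq> b"
  obtains g where "g \<bullet> w = 0" "\<And>y. y \<in> P \<Longrightarrow> \<bar>g \<bullet> y\<bar> \<le> 1" "g \<bullet> (x - a) = 1" "g \<bullet> (x - b) = -1"
proof -
  have aL: "a \<in> L" "x - a \<in> P" and bL: "b \<in> L" "x - b \<in> P" using a b by (auto simp: tiles_at_def)
  let ?S = "(\<lambda>y. a + y) ` interior P" and ?T = "(\<lambda>y. b + y) ` interior P"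
  have "?S \<inter> ?T = {}"
  proof (rule ccontr)
    assume "?S \<inter> ?T \<noteq> {}"
    then obtain y z where yz: "y \<in> interior P" "z \<in> interior P" "a + y = b + z" by auto
    then have "y - (b - a) = z" by (simp add: algebra_simps)
    then have "b - a = 0" using packing[OF lattice_diff[OF bL(1) aL(1)] yz(1)] yz(2) by simp
    then show False using \<open>a \<noteq> b\<close> by simp
  qed
  moreover have "convex ?S" "convex ?T" using convex by (auto intro: convex_translation convex_interior)
  ultimately obtain h c where h: "h \<noteq> 0" "\<forall>y\<in>?S. h \<bullet> y \<le> c" "\<forall>y\<in>?T. h \<bullet> y \<ge> c"
    using separating_hyperplane_sets[of ?S ?T] interior_nonempty by auto
  have cl: "closure (interior P) = P"
    using convex_closure_interior[OF convex interior_nonempty] compact compact_imp_closed closure_closed by metis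
  have ha: "h \<bullet> y \<le> c - h \<bullet> a" if "y \<in> P" for y
  proof -
    have "interior P \<subseteq> {y. h \<bullet> y \<le> c - h \<bullet> a}" using h(2) by (auto simp: inner_add_right algebra_simps)
    then have "closure (interior P) \<subseteq> {y. h \<bullet> y \<le> c - h \<bullet> a}"
      by (rule closure_minimal) (rule closed_halfspace_le)
    then show ?thesis using that cl by auto
  qed
  have hb: "h \<bullet> y \<ge> c - h \<bullet> b" if "y \<in> P" for y
  proof -
    have "interior P \<subseteq> {y. h \<bullet> y \<ge> c - h \<bullet> b}" using h(3) by (auto simp: inner_add_right algebra_simps)
    then have "closure (interior P) \<subseteq> {y. h \<bullet> y \<ge> c - h \<bullet> b}"
      by (rule closure_minimal) (rule closed_halfspace_ge)
    then show ?thesis using that cl by auto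
  qed
  have hx: "h \<bullet> x = c" using ha[OF aL(2)] hb[OF bL(2)] by (simp add: inner_diff_right)
  define m where "m = h \<bullet> (x - a)"
  have up: "h \<bullet> y \<le> m" if "y \<in> P" for y using ha[OF that] hx by (simp add: m_def inner_diff_right)
  have bound: "\<bar>h \<bullet> y\<bar> \<le> m" if "y \<in> P" for y
    using up[OF that] up[OF symmetric[OF that]] by simp
  have lo: "h \<bullet> (x - b) = - m"
    using hb[OF symmetric[OF aL(2)]] bound[OF bL(2)] hx by (simp add: m_def inner_diff_right)
  have "m \<noteq> 0"
  proof
    assume "m = 0"
    then have "h \<bullet> y = 0" if "y \<in> P" for y using bound[OF that] by simp
    then show False using no_functional_vanishes h(1) by blast
  qed
  moreover have "m \<ge> 0" using bound[OF zero_in_P] by simp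
  ultimately have m: "m > 0" by simp
  obtain d where d: "d > 0" "x - a + d *\<^sub>R w \<in> P" "x - a - d *\<^sub>R w \<in> P"
    using gen a unfolding generic_def by blast
  have "d * (h \<bullet> w) \<le> 0" "d * (h \<bullet> w) \<ge> 0"
    using up[OF d(2)] up[OF d(3)] by (simp_all add: m_def inner_add_right inner_diff_right)
  then have "h \<bullet> w = 0" using d(1) by (simp add: mult_le_0_iff zero_le_mult_iff)
  show thesis
  proof (rule that[of "(1/m) *\<^sub>R h"])
    show "((1/m) *\<^sub>R h) \<bullet> w = 0" using \<open>h \<bullet> w = 0\<close> by simp
    show "\<bar>((1/m) *\<^sub>R h) \<bullet> y\<bar> \<le> 1" if "y \<in> P" for y using bound[OF that] m by (simp add: field_simps)
    show "((1/m) *\<^sub>R h) \<bullet> (x - a) = 1" using m by (simp add: m_def)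
    show "((1/m) *\<^sub>R h) \<bullet> (x - b) = - 1" using m lo by simp
  qed
qed

text \<open>
  With only two tiles at \<open>x\<close>, the tile \<open>a\<close> would fill one side of a plane parallel to \<open>w\<close> near \<open>x\<close>. Then \<open>x\<close>
  could be moved within the face of \<open>P\<close> in a direction other than \<open>w\<close>.
\<close>

lemma third_tile:
  assumes gen: "generic w x" and w: "w \<noteq> 0" "u \<bullet> w = 0" and a: "a \<in> L" "x - a \<in> support_face P u"
    and line: "on_line w (support_face P u)"
  shows "\<exists>b\<in>tiles_at x. b \<noteq> a \<and> b \<noteq> c"
proof (rule ccontr)
  assume no: "\<not> ?thesis"
  have aT: "a \<in> tiles_at x" using a by (auto simp: tiles_at_def support_face_def)
  obtain g where g: "g \<bullet> w = 0" "g \<noteq> 0" "\<And>y. c \<in> tiles_at x \<Longrightarrow> c \<noteq> a \<Longrightarrow> y - c \<in> P \<Longrightarrow> g \<bullet> y \<ge> g \<bullet> x"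
  proof (cases "c \<in> tiles_at x \<and> c \<noteq> a")
    case True
    then obtain g where g: "g \<bullet> w = 0" "\<And>y. y \<in> P \<Longrightarrow> \<bar>g \<bullet> y\<bar> \<le> 1" "g \<bullet> (x - a) = 1" "g \<bullet> (x - c) = -1"
      using separation[OF gen aT] by metis
    have "g \<bullet> y \<ge> g \<bullet> x" if "y - c \<in> P" for y
      using g(2)[OF that] g(4) by (simp add: inner_diff_right)
    moreover have "g \<noteq> 0" using g(3) by auto
    ultimately show thesis using that g(1) by blast
  next
    case False
    obtain y where "y \<noteq> 0" "orthogonal w y" using orthogonal_to_vector_exists[of w] by auto
    then show thesis using that[of y] False by (auto simp: orthogonal_def inner_commute)
  qed
  define d0 where "d0 = cross3 g w"
  have d0: "d0 \<noteq> 0" "g \<bullet> d0 = 0" "w \<bullet> d0 = 0"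
  proof -
    have "norm (cross3 g w)^2 + (g \<bullet> w)^2 = (norm g * norm w)^2" by (rule norm_cross_dot)
    then show "d0 \<noteq> 0" using g w by (auto simp: d0_def)
  qed (simp_all add: d0_def dot_cross_self)
  \<comment> \<open>A direction in the separating plane, transversal to \<open>w\<close>, that does not decrease
    \<open>u\<close>.\<close>
  define d where "d = (if u \<bullet> d0 \<ge> 0 then d0 else - d0)"
  have d: "d \<noteq> 0" "g \<bullet> d = 0" "w \<bullet> d = 0" "u \<bullet> d \<ge> 0" using d0 by (auto simp: d_def)
  obtain r where r: "r > 0" "\<And>y. dist x y < r \<Longrightarrow> \<exists>a\<in>tiles_at x. y - a \<in> P" using local_cover by blast
  have inP: "y - a \<in> P" if y: "dist x y < r" "g \<bullet> y < g \<bullet> x" for y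
  proof -
    obtain b where b: "b \<in> tiles_at x" "y - b \<in> P" using r(2)[OF y(1)] by blast
    then consider "b = a" | "b = c" "c \<noteq> a" using no by blast
    then show ?thesis
    proof cases
      case 2 then show ?thesis using g(3)[of y] b y(2) by simp
    qed (use b in simp)
  qed
  define e where "e = r / (2 * norm d)"
  have e: "e > 0" "norm (e *\<^sub>R d) < r" using r d by (auto simp: e_def)
  \<comment> \<open>Approach the point from the side of the separating plane on which only the tile
    \<open>a\<close> is left.\<close>
  have "x + e *\<^sub>R d - a \<in> P"
  proof -
    have "((\<lambda>t. x + e *\<^sub>R d - t *\<^sub>R g) \<longlongrightarrow> x + e *\<^sub>R d - 0 *\<^sub>R g) (at_right 0)"
      by (intro tendsto_intros)
    moreover have "\<forall>\<^sub>F t in at_right (0::real). x + e *\<^sub>R d - t *\<^sub>R g \<in> {y. y - a \<in> P}"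
    proof -
      have "((\<lambda>t. norm (e *\<^sub>R d - t *\<^sub>R g)) \<longlongrightarrow> norm (e *\<^sub>R d - 0 *\<^sub>R g)) (at_right 0)"
        by (intro tendsto_intros)
      then have "\<forall>\<^sub>F t in at_right (0::real). norm (e *\<^sub>R d - t *\<^sub>R g) < r"
        using e by (intro order_tendstoD) auto
      moreover have "\<forall>\<^sub>F t in at_right (0::real). t > 0" by (simp add: eventually_at_right_less)
      ultimately show ?thesis
      proof eventually_elim
        case (elim t)
        have "g \<bullet> (x + e *\<^sub>R d - t *\<^sub>R g) < g \<bullet> x"
          using elim g d by (simp add: inner_add_right inner_diff_right)
        moreover have "dist x (x + e *\<^sub>R d - t *\<^sub>R g) < r"
          using elim by (simp add: dist_norm norm_minus_commute algebra_simps)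
        ultimately show ?case using inP by simp
      qed
    qed
    ultimately have "x + e *\<^sub>R d - 0 *\<^sub>R g \<in> {y. y - a \<in> P}"
      by (intro Lim_in_closed_set[OF closed_tile _ trivial_limit_at_right_real])
    then show ?thesis by simp
  qed
  moreover have "u \<bullet> (x - a) \<le> u \<bullet> (x + e *\<^sub>R d - a)"
    using d e by (simp add: inner_add_right inner_diff_right)
  ultimately have "x + e *\<^sub>R d - a \<in> support_face P u"
    using a(2) unfolding support_face_def by (auto intro: order_trans)
  then obtain t where "x + e *\<^sub>R d - a = x - a + t *\<^sub>R w" using line a(2) unfolding on_line_def by blast
  then have "e *\<^sub>R d = t *\<^sub>R w" by (simp add: algebra_simps)
  then have "e * (d \<bullet> d) = t * (w \<bullet> d)" by (metis inner_scaleR_left)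
  then show False using d e by simp
qed

definition three_tiles :: "real^3 \<Rightarrow> real^3 \<Rightarrow> real^3 \<Rightarrow> real^3 \<Rightarrow> real^3 \<Rightarrow> bool" where
  "three_tiles w x a b c \<longleftrightarrow> generic w x \<and> {a, b, c} \<subseteq> tiles_at x \<and> a \<noteq> b \<and> a \<noteq> c \<and> b \<noteq> c"

lemma three_tiles_hexagon:
  assumes "three_tiles w x a b c" "r \<in> P" "w \<noteq> 0"
  shows "in_triangles w (x - a) (x - b) r \<or> in_triangles w (x - a) (x - c) r \<or> in_triangles w (x - b) (x - c) r"
proof -
  have g: "generic w x" and t: "a \<in> tiles_at x" "b \<in> tiles_at x" "c \<in> tiles_at x"
    and ne: "a \<noteq> b" "a \<noteq> c" "b \<noteq> c" using assms(1) by (auto simp: three_tiles_def)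
  obtain g12 where g12: "g12 \<bullet> w = 0" "\<And>y. y \<in> P \<Longrightarrow> \<bar>g12 \<bullet> y\<bar> \<le> 1" "g12 \<bullet> (x - a) = 1" "g12 \<bullet> (x - b) = -1"
    using separation[OF g t(1) t(2) ne(1)] by metis
  obtain g13 where g13: "g13 \<bullet> w = 0" "\<And>y. y \<in> P \<Longrightarrow> \<bar>g13 \<bullet> y\<bar> \<le> 1" "g13 \<bullet> (x - a) = 1" "g13 \<bullet> (x - c) = -1"
    using separation[OF g t(1) t(3) ne(2)] by metis
  obtain g23 where g23: "g23 \<bullet> w = 0" "\<And>y. y \<in> P \<Longrightarrow> \<bar>g23 \<bullet> y\<bar> \<le> 1" "g23 \<bullet> (x - b) = 1" "g23 \<bullet> (x - c) = -1"
    using separation[OF g t(2) t(3) ne(3)] by metis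
  have "x - a \<in> P" "x - b \<in> P" "x - c \<in> P" using t by (auto simp: tiles_at_def)
  from hexagon[of g12 w P, OF g12 g13 g23 this assms(2,3)] show ?thesis .
qed

lemma support_value_pos:
  assumes "u \<noteq> 0" "v \<in> support_face P u" shows "u \<bullet> v > 0"
proof (rule ccontr)
  assume "\<not> u \<bullet> v > 0"
  have "u \<bullet> y = 0" if "y \<in> P" for y
  proof -
    have "u \<bullet> y \<le> u \<bullet> v" "u \<bullet> (- y) \<le> u \<bullet> v"
      using assms(2) that symmetric[OF that] unfolding support_face_def by blast+
    then show ?thesis using \<open>\<not> u \<bullet> v > 0\<close> by simp
  qed
  then show False using no_functional_vanishes assms(1) by blast
qed

text \<open>
  A linear functional that is bounded by the same value at \<open>\<plusminus>A\<close> and \<open>\<plusminus>B\<close> can reach it on the triangles only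
  if it does so at one of these four points.
\<close>

lemma in_triangles_support:
  assumes tri: "in_triangles w A B v" and v: "v \<in> support_face P u" and u: "u \<noteq> 0" "u \<bullet> w = 0"
    and A: "A \<in> P" and B: "B \<in> P"
  shows "A \<in> support_face P u \<or> - A \<in> support_face P u \<or> B \<in> support_face P u \<or> - B \<in> support_face P u"
proof -
  define h where "h = u \<bullet> v"
  have h: "h > 0" unfolding h_def by (rule support_value_pos[OF u(1) v])
  have le: "u \<bullet> y \<le> h" if "y \<in> P" for y using v that unfolding support_face_def h_def by blast
  have face: "y \<in> support_face P u" if "y \<in> P" "u \<bullet> y \<ge> h" for y
    using that le unfolding support_face_def by (auto intro: order_trans)
  obtain p q t where pq: "p * q \<ge> 0" "\<bar>p + q\<bar> \<le> 1" "v = p *\<^sub>R A - q *\<^sub>R B + t *\<^sub>R w"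
    using tri unfolding in_triangles_def by blast
  have hv: "h = p * (u \<bullet> A) - q * (u \<bullet> B)" unfolding h_def pq(3) using u by (simp add: inner_add_right inner_diff_right)
  have bA: "\<bar>u \<bullet> A\<bar> \<le> h" using le[OF A] le[OF symmetric[OF A]] by simp
  have bB: "\<bar>u \<bullet> B\<bar> \<le> h" using le[OF B] le[OF symmetric[OF B]] by simp
  \<comment> \<open>If both values were smaller than \<open>h\<close>, so would be their combination
    \<open>h\<close> itself, as \<open>\<bar>p\<bar> + \<bar>q\<bar> \<le> 1\<close>.\<close>
  have "\<bar>u \<bullet> A\<bar> = h \<or> \<bar>u \<bullet> B\<bar> = h"
  proof (rule ccontr)
    assume "\<not> ?thesis"
    then have lt: "\<bar>u \<bullet> A\<bar> < h" "\<bar>u \<bullet> B\<bar> < h" using bA bB by auto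
    have sum1: "\<bar>p\<bar> + \<bar>q\<bar> \<le> 1" using pq(1,2) by (auto simp: zero_le_mult_iff)
    have "h \<le> \<bar>p\<bar> * \<bar>u \<bullet> A\<bar> + \<bar>q\<bar> * \<bar>u \<bullet> B\<bar>" using hv by (metis abs_mult abs_ge_self abs_triangle_ineq4 order_trans)
    moreover have "p \<noteq> 0 \<or> q \<noteq> 0" using hv h by auto
    moreover have "\<bar>p\<bar> * \<bar>u \<bullet> A\<bar> \<le> \<bar>p\<bar> * h" "\<bar>q\<bar> * \<bar>u \<bullet> B\<bar> \<le> \<bar>q\<bar> * h"
      using lt by (auto intro: mult_left_mono)
    moreover have "p \<noteq> 0 \<Longrightarrow> \<bar>p\<bar> * \<bar>u \<bullet> A\<bar> < \<bar>p\<bar> * h" "q \<noteq> 0 \<Longrightarrow> \<bar>q\<bar> * \<bar>u \<bullet> B\<bar> < \<bar>q\<bar> * h"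
      using lt by auto
    ultimately have "h < \<bar>p\<bar> * h + \<bar>q\<bar> * h" by (cases "p = 0") linarith+
    also have "\<dots> = (\<bar>p\<bar> + \<bar>q\<bar>) * h" by (simp add: algebra_simps)
    also have "\<dots> \<le> 1 * h" using sum1 h by (intro mult_right_mono) auto
    finally show False by simp
  qed
  then consider "u \<bullet> A \<ge> h" | "u \<bullet> (- A) \<ge> h" | "u \<bullet> B \<ge> h" | "u \<bullet> (- B) \<ge> h" by (auto simp: abs_if split: if_splits)
  then show ?thesis using face A B symmetric by cases blast+
qed

text \<open>
  Every face of \<open>P\<close> with normal orthogonal to \<open>w\<close> contains, up to sign, the position of \<open>x\<close> in one of the
  three tiles: the hexagon has no other vertices.
\<close>

lemma three_tiles_support:
  assumes "three_tiles w x a b c" "w \<noteq> 0" "u \<noteq> 0" "u \<bullet> w = 0"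
  shows "\<exists>d\<in>{a, b, c}. x - d \<in> support_face P u \<or> - (x - d) \<in> support_face P u"
proof -
  obtain v where v: "v \<in> support_face P u" using support_face_nonempty by blast
  then have "v \<in> P" by (simp add: support_face_def)
  have t: "x - a \<in> P" "x - b \<in> P" "x - c \<in> P" using assms(1) by (auto simp: three_tiles_def tiles_at_def)
  from three_tiles_hexagon[OF assms(1) \<open>v \<in> P\<close> assms(2)] consider
    "in_triangles w (x - a) (x - b) v" | "in_triangles w (x - a) (x - c) v" | "in_triangles w (x - b) (x - c) v" by blast
  then show ?thesis
  proof cases
    case 1 then show ?thesis using in_triangles_support[OF 1 v assms(3,4) t(1,2)] by blast
  next
    case 2 then show ?thesis using in_triangles_support[OF 2 v assms(3,4) t(1,3)] by blast
  next
    case 3 then show ?thesis using in_triangles_support[OF 3 v assms(3,4) t(2,3)] by blast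
  qed
qed

lemma on_line_uminus: "on_line w (support_face P u) \<Longrightarrow> on_line w (support_face P (- u))"
  unfolding on_line_def
proof (intro ballI)
  fix x y assume *: "\<forall>x\<in>support_face P u. \<forall>y\<in>support_face P u. \<exists>t. y = x + t *\<^sub>R w"
    and "x \<in> support_face P (- u)" "y \<in> support_face P (- u)"
  then obtain t where "- x = - y + t *\<^sub>R w" using support_face_uminus by blast
  then have "y = x + t *\<^sub>R w" by (simp add: algebra_simps)
  then show "\<exists>t. y = x + t *\<^sub>R w" ..
qed

lemma three_tiles_exist:
  assumes gen: "generic w x" and w: "w \<noteq> 0" "u \<bullet> w = 0" and a: "a \<in> L" "x - a \<in> support_face P u \<or> - (x - a) \<in> support_face P u"
    and line: "on_line w (support_face P u)"
    and c: "c \<in> tiles_at x" "c \<noteq> a"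
  obtains b where "three_tiles w x a c b"
proof -
  have "\<exists>b\<in>tiles_at x. b \<noteq> a \<and> b \<noteq> c"
    using a(2)
  proof
    assume "x - a \<in> support_face P u"
    then show ?thesis using third_tile[OF gen w a(1) _ line] by blast
  next
    assume "- (x - a) \<in> support_face P u"
    then have "x - a \<in> support_face P (- u)" using support_face_uminus[of "x - a" u] by blast
    then show ?thesis using third_tile[OF gen w(1) _ a(1) _ on_line_uminus[OF line]] w(2) by simp
  qed
  moreover have "a \<in> tiles_at x" using a symmetric_iff[of "x - a"] by (auto simp: tiles_at_def support_face_def)
  ultimately show thesis using that gen c unfolding three_tiles_def by auto
qed

lemma three_tiles_exist':
  assumes gen: "generic w x" and w: "w \<noteq> 0" "u \<bullet> w = 0" and a: "a \<in> L" "x - a \<in> support_face P u \<or> - (x - a) \<in> support_face P u"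
    and line: "on_line w (support_face P u)"
  obtains b c where "three_tiles w x a b c"
proof -
  have "\<exists>b\<in>tiles_at x. b \<noteq> a \<and> b \<noteq> a"
    using a(2)
  proof
    assume "x - a \<in> support_face P u"
    then show ?thesis using third_tile[OF gen w a(1) _ line] by blast
  next
    assume "- (x - a) \<in> support_face P u"
    then have "x - a \<in> support_face P (- u)" using support_face_uminus[of "x - a" u] by blast
    then show ?thesis using third_tile[OF gen w(1) _ a(1) _ on_line_uminus[OF line], of a] w(2) by simp
  qed
  then obtain b where "b \<in> tiles_at x" "b \<noteq> a" by blast
  from three_tiles_exist[OF assms this] show thesis using that by blast
qed

lemma support_face_fibre:
  assumes "u \<bullet> w = 0" "y \<in> support_face P u" "y + t *\<^sub>R w \<in> P"
  shows "y + t *\<^sub>R w \<in> support_face P u"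
  using assms unfolding support_face_def by (auto simp: inner_add_right)

text \<open>
  The translates \<open>e = 1\<close> and reflected translates \<open>e = - 1\<close> of the face that pass through \<open>x\<close>.
\<close>

definition hits :: "real^3 \<Rightarrow> real^3 \<Rightarrow> (real \<times> (real^3)) set" where
  "hits u x = {(e, a). (e = 1 \<or> e = -1) \<and> a \<in> L \<and> e *\<^sub>R (x - a) \<in> support_face P u}"

text \<open>
  Two tiles carrying translates of the same fibre through \<open>x\<close> could not be separated by a plane parallel to \<open>w\<close>.
\<close>

lemma hits_unique:
  assumes gen: "generic w x" and u: "u \<bullet> w = 0" and line: "on_line w (support_face P u)"
    and a: "(e, a) \<in> hits u x" and b: "(e, b) \<in> hits u x"
  shows "a = b"
proof (rule ccontr)
  assume "a \<noteq> b"
  have e: "e = 1 \<or> e = -1" using a by (simp add: hits_def)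
  have "e *\<^sub>R (x - a) \<in> P" "e *\<^sub>R (x - b) \<in> P" using a b by (auto simp: hits_def support_face_def)
  then have "x - a \<in> P" "x - b \<in> P" using e symmetric_iff[of "x - a"] symmetric_iff[of "x - b"] by auto
  then have t: "a \<in> tiles_at x" "b \<in> tiles_at x" using a b by (auto simp: tiles_at_def hits_def)
  obtain g where g: "g \<bullet> w = 0" "g \<bullet> (x - a) = 1" "g \<bullet> (x - b) = -1"
    using separation[OF gen t \<open>a \<noteq> b\<close>] by metis
  obtain s where "e *\<^sub>R (x - b) = e *\<^sub>R (x - a) + s *\<^sub>R w"
    using line a b unfolding on_line_def hits_def by blast
  then have "g \<bullet> (e *\<^sub>R (x - b)) = g \<bullet> (e *\<^sub>R (x - a) + s *\<^sub>R w)" by simp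
  then show False using g e by (auto simp: inner_add_right)
qed

lemma hits_other:
  assumes gen: "generic w x" and w: "w \<noteq> 0" and u: "u \<bullet> w = 0" and line: "on_line w (support_face P u)"
    and u': "u' \<noteq> 0" "u' \<bullet> w = 0"
    and ne: "hits u x \<noteq> {}"
  shows "hits u' x \<noteq> {}"
proof -
  obtain e a where ea: "(e, a) \<in> hits u x" using ne by auto
  then have "a \<in> L" "x - a \<in> support_face P u \<or> - (x - a) \<in> support_face P u" by (auto simp: hits_def)
  then obtain b c where tt: "three_tiles w x a b c" using three_tiles_exist'[OF gen w u _ _ line] by blast
  obtain d where d: "d \<in> {a, b, c}" "x - d \<in> support_face P u' \<or> - (x - d) \<in> support_face P u'"
    using three_tiles_support[OF tt w u'] by blast
  have "d \<in> L" using d(1) tt by (auto simp: three_tiles_def tiles_at_def)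
  then have "(1, d) \<in> hits u' x \<or> (-1, d) \<in> hits u' x" using d(2) by (auto simp: hits_def)
  then show ?thesis by blast
qed

lemma support_faces_equal:
  assumes "u \<bullet> w = 0" "u' \<bullet> w = 0" "on_line w (support_face P u)" "on_line w (support_face P u')"
    and "y \<in> support_face P u" "y + t *\<^sub>R w \<in> support_face P u'"
  shows "support_face P u \<subseteq> support_face P u'"
proof
  fix z assume z: "z \<in> support_face P u"
  then obtain s where "z = y + s *\<^sub>R w" using assms(3,5) unfolding on_line_def by blast
  then have "z = (y + t *\<^sub>R w) + (s - t) *\<^sub>R w" by (simp add: algebra_simps)
  then show "z \<in> support_face P u'"
    using support_face_fibre[OF assms(2,6), of "s - t"] z by (simp add: support_face_def)
qed

text \<open>
  Suppose the sign \<open>e\<close> does not occur for \<open>u'\<close>. Then every tile at \<open>x\<close> other than \<open>a\<close> and \<open>b\<close> carries the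
  face of \<open>u'\<close> with sign \<open>- e\<close>, so by uniqueness there is exactly one such tile \<open>c\<close>. Since \<open>x\<close> has opposite
  positions in \<open>a\<close> and \<open>b\<close>, moving away from the centre of \<open>c\<close> leaves all three tiles.
\<close>

lemma hits_both:
  assumes gen: "generic w x" and w: "w \<noteq> 0" and u: "u \<noteq> 0" "u \<bullet> w = 0" and line: "on_line w (support_face P u)"
    and u': "u' \<noteq> 0" "u' \<bullet> w = 0" and line': "on_line w (support_face P u')"
    and ne: "support_face P u \<inter> support_face P u' = {}" "support_face P (-u) \<inter> support_face P u' = {}"
    and a: "(1, a) \<in> hits u x" and b: "(-1, b) \<in> hits u x"
    and e: "e = 1 \<or> e = -1"
  shows "\<exists>c. (e, c) \<in> hits u' x"
proof (rule ccontr)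
  assume no: "\<not> ?thesis"
  have aL: "a \<in> L" "x - a \<in> support_face P u" and bL: "b \<in> L" "- (x - b) \<in> support_face P u"
    using a b by (auto simp: hits_def)
  have fP: "y \<in> P" if "y \<in> support_face P v" for y v using that by (simp add: support_face_def)
  have aP: "x - a \<in> P" and bP: "x - b \<in> P" using aL bL fP symmetric_iff by blast+
  have aT: "a \<in> tiles_at x" and bT: "b \<in> tiles_at x"
    using aL bL aP bP by (auto simp: tiles_at_def)
  have uv: "u \<bullet> (x - a) > 0" "u \<bullet> (- (x - b)) > 0" using support_value_pos[OF u(1)] aL bL by blast+
  have ab: "a \<noteq> b" using uv by (auto simp: inner_diff_right)
  \<comment> \<open>By uniqueness of hits, there is at most one further tile at \<open>x\<close>.\<close>
  have other: "c' = c" if c: "c \<in> tiles_at x" "c \<noteq> a" "c \<noteq> b" and c': "c' \<in> tiles_at x" "c' \<noteq> a" "c' \<noteq> b" for c c'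
  proof -
    have *: "(- e, d) \<in> hits u' x" if d: "d \<in> tiles_at x" "d \<noteq> a" "d \<noteq> b" for d
    proof -
      have tt: "three_tiles w x a b d" using gen aT bT d ab by (auto simp: three_tiles_def)
      obtain k where k: "k \<in> {a, b, d}" "x - k \<in> support_face P u' \<or> - (x - k) \<in> support_face P u'"
        using three_tiles_support[OF tt w u'] by blast
      have m: "- (x - a) \<in> support_face P (- u)" "x - b \<in> support_face P (- u)"
        using aL(2) bL(2) support_face_uminus[of "- (x - a)" u] support_face_uminus[of "x - b" u] by simp_all
      have "k \<noteq> a" "k \<noteq> b" using k(2) ne m aL bL by blast+
      then have "k = d" using k by simp
      moreover have "d \<in> L" using d by (simp add: tiles_at_def)
      ultimately show ?thesis using k(2) no e by (auto simp: hits_def)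
    qed
    show ?thesis using hits_unique[OF gen u'(2) line' *[OF c'] *[OF c]] .
  qed
  obtain c where tt: "three_tiles w x a b c"
    using three_tiles_exist[OF gen w u(2) aL(1) _ line bT] aL(2) ab by metis
  then have c: "c \<in> tiles_at x" "c \<noteq> a" "c \<noteq> b" by (auto simp: three_tiles_def)
  have T: "tiles_at x \<subseteq> {a, b, c}" using other[OF c] by blast
  obtain g13 where g13: "g13 \<bullet> w = 0" "\<And>y. y \<in> P \<Longrightarrow> \<bar>g13 \<bullet> y\<bar> \<le> 1" "g13 \<bullet> (x - a) = 1" "g13 \<bullet> (x - c) = -1"
    using separation[OF gen aT c(1)] c(2) by metis
  obtain g23 where g23: "g23 \<bullet> w = 0" "\<And>y. y \<in> P \<Longrightarrow> \<bar>g23 \<bullet> y\<bar> \<le> 1" "g23 \<bullet> (x - b) = 1" "g23 \<bullet> (x - c) = -1"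
    using separation[OF gen bT c(1)] c(3) by metis
  obtain s where s: "x - b = - (x - a) + s *\<^sub>R w"
  proof -
    obtain s where "- (x - b) = (x - a) + s *\<^sub>R w" using line aL bL unfolding on_line_def by blast
    then have "x - b = - (x - a) + (- s) *\<^sub>R w" by (simp add: algebra_simps)
    then show thesis by (rule that)
  qed
  obtain k where k: "k \<in> {a, b, c}" "x - k \<in> support_face P u' \<or> - (x - k) \<in> support_face P u'"
    using three_tiles_support[OF tt w u'] by blast
  have m: "- (x - a) \<in> support_face P (- u)" "x - b \<in> support_face P (- u)"
    using aL(2) bL(2) support_face_uminus[of "- (x - a)" u] support_face_uminus[of "x - b" u] by simp_all
  have "k \<noteq> a" "k \<noteq> b" using k(2) ne m aL bL by blast+
  then have kc: "x - c \<in> support_face P u' \<or> - (x - c) \<in> support_face P u'" using k by simp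
  obtain r where r: "r > 0" "\<And>y. dist x y < r \<Longrightarrow> \<exists>a\<in>tiles_at x. y - a \<in> P" using local_cover by blast
  \<comment> \<open>The point \<open>x + d (x - c)\<close> is close to \<open>x\<close> and hence in a tile at
    \<open>x\<close>, but each of the three is excluded.\<close>
  define m where "m = norm (x - c) + 1"
  have m: "m > 0" "norm (x - c) \<le> m" using norm_ge_zero[of "x - c"] unfolding m_def by linarith+
  define d where "d = r / (2 * m)"
  have d: "d > 0" unfolding d_def using r(1) m(1) by simp
  have "norm (d *\<^sub>R (x - c)) < r"
  proof -
    have "norm (d *\<^sub>R (x - c)) = d * norm (x - c)" using d by simp
    also have "\<dots> \<le> d * m" using d m by (intro mult_left_mono) auto
    also have "\<dots> = r / 2" unfolding d_def using m(1) by simp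
    finally show ?thesis using r by simp
  qed
  then have "dist x (x + d *\<^sub>R (x - c)) < r" by (simp add: dist_norm)
  then obtain k where k: "k \<in> {a, b, c}" "x + d *\<^sub>R (x - c) - k \<in> P" using r(2) T by blast
  have eqk: "x + d *\<^sub>R (x - c) - k = (x - k) + d *\<^sub>R (x - c)" by simp
  have g23a: "g23 \<bullet> (x - a) = -1"
    using g23(1,3) arg_cong[OF s, of "inner g23"] by (simp add: inner_add_right inner_diff_right)
  have g13b: "g13 \<bullet> (x - b) = -1"
    using g13(1,3) arg_cong[OF s, of "inner g13"] by (simp add: inner_add_right inner_diff_right)
  have "k \<noteq> a"
  proof
    assume "k = a"
    have "\<bar>g23 \<bullet> ((x - a) + d *\<^sub>R (x - c))\<bar> \<le> 1" using g23(2)[OF k(2)] unfolding eqk unfolding \<open>k = a\<close> .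
    then show False using g23a g23(4) d by (simp add: inner_add_right)
  qed
  moreover have "k \<noteq> b"
  proof
    assume "k = b"
    have "\<bar>g13 \<bullet> ((x - b) + d *\<^sub>R (x - c))\<bar> \<le> 1" using g13(2)[OF k(2)] unfolding eqk unfolding \<open>k = b\<close> .
    then show False using g13b g13(4) d by (simp add: inner_add_right)
  qed
  moreover have "k \<noteq> c"
  proof
    assume "k = c"
    have yP: "(x - c) + d *\<^sub>R (x - c) \<in> P" using k(2) unfolding eqk unfolding \<open>k = c\<close> .
    from kc show False
    proof
      assume f: "x - c \<in> support_face P u'"
      then have "u' \<bullet> ((x - c) + d *\<^sub>R (x - c)) \<le> u' \<bullet> (x - c)" using yP unfolding support_face_def by blast
      then show False using support_value_pos[OF u'(1) f] d by (simp add: inner_add_right mult_le_0_iff)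
    next
      assume f: "- (x - c) \<in> support_face P u'"
      then have "u' \<bullet> (- ((x - c) + d *\<^sub>R (x - c))) \<le> u' \<bullet> (- (x - c))"
        using symmetric[OF yP] unfolding support_face_def by blast
      then show False using support_value_pos[OF u'(1) f] d by (simp add: inner_add_right zero_le_mult_iff inner_diff_right)
    qed
  qed
  ultimately show False using k by blast
qed

section \<open>Equal length of parallel edges\<close>

lemma chord_interval:
  assumes w: "w \<noteq> 0" shows "\<exists>p q. {s. y + s *\<^sub>R w \<in> P} = {p..q}"
proof -
  let ?S = "{s. y + s *\<^sub>R w \<in> P}"
  obtain K where K: "\<And>z. z \<in> P \<Longrightarrow> norm z \<le> K" using compact compact_imp_bounded bounded_iff by metis
  have "?S = (\<lambda>s. y + s *\<^sub>R w) -` P" by auto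
  moreover have "closed ((\<lambda>s. y + s *\<^sub>R w) -` P)"
    by (rule continuous_closed_vimage) (auto intro!: compact_imp_closed compact continuous_intros)
  ultimately have "closed ?S" by simp
  moreover have "bounded ?S"
    unfolding bounded_iff
  proof (intro exI ballI)
    fix s assume "s \<in> ?S"
    then have "norm (y + s *\<^sub>R w) \<le> K" using K by simp
    then have "norm (s *\<^sub>R w) \<le> K + norm y" using norm_triangle_ineq4[of "y + s *\<^sub>R w" y] by simp
    then show "norm s \<le> (K + norm y) / norm w" using w by (simp add: field_simps)
  qed
  moreover have "convex ?S"
  proof (rule convexI)
    fix a b u v :: real assume *: "a \<in> ?S" "b \<in> ?S" "0 \<le> u" "0 \<le> v" "u + v = 1"
    have "u *\<^sub>R (y + a *\<^sub>R w) + v *\<^sub>R (y + b *\<^sub>R w) \<in> P" using convexD[OF convex] * by auto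
    moreover have "u *\<^sub>R (y + a *\<^sub>R w) + v *\<^sub>R (y + b *\<^sub>R w) = (u + v) *\<^sub>R y + (u * a + v * b) *\<^sub>R w"
      by (simp add: algebra_simps)
    ultimately show "u *\<^sub>R a + v *\<^sub>R b \<in> ?S" using *(5) by simp
  qed
  ultimately show ?thesis
    using connected_compact_interval_1[of ?S] by (simp add: compact_eq_bounded_closed convex_connected)
qed

text \<open>
  The case \<open>l = 0\<close> is a face consisting of one point.
\<close>

lemma edge_param:
  assumes w: "w \<noteq> 0" "u \<bullet> w = 0" and line: "on_line w (support_face P u)"
  obtains c l where "l \<ge> 0" "\<And>s. c + s *\<^sub>R w \<in> support_face P u \<longleftrightarrow> 0 \<le> s \<and> s \<le> l"
    "\<And>y. y \<in> support_face P u \<Longrightarrow> \<exists>s. y = c + s *\<^sub>R w"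
proof -
  obtain y where y: "y \<in> support_face P u" using support_face_nonempty by blast
  obtain p q where pq: "{s. y + s *\<^sub>R w \<in> P} = {p..q}" using chord_interval[OF w(1)] by blast
  have *: "y + s *\<^sub>R w \<in> support_face P u \<longleftrightarrow> p \<le> s \<and> s \<le> q" for s
  proof -
    have "y + s *\<^sub>R w \<in> P \<longleftrightarrow> p \<le> s \<and> s \<le> q" using pq by auto
    moreover have "y + s *\<^sub>R w \<in> support_face P u \<Longrightarrow> y + s *\<^sub>R w \<in> P" by (simp add: support_face_def)
    ultimately show ?thesis using support_face_fibre[OF w(2) y, of s] by blast
  qed
  have "p \<le> 0" "0 \<le> q" using *[of 0] y by auto
  show thesis
  proof (rule that[of "q - p" "y + p *\<^sub>R w"])
    show "q - p \<ge> 0" using \<open>p \<le> 0\<close> \<open>0 \<le> q\<close> by simp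
    show "y + p *\<^sub>R w + s *\<^sub>R w \<in> support_face P u \<longleftrightarrow> 0 \<le> s \<and> s \<le> q - p" for s
      using *[of "p + s"] by (auto simp: algebra_simps)
    fix z assume "z \<in> support_face P u"
    then obtain t where "z = y + t *\<^sub>R w" using line y unfolding on_line_def by blast
    then have "z = y + p *\<^sub>R w + (t - p) *\<^sub>R w" by (simp add: algebra_simps)
    then show "\<exists>s. z = y + p *\<^sub>R w + s *\<^sub>R w" by blast
  qed
qed

text \<open>
  Only finitely many tiles meet the segment, each in an interval, and only the ends of these intervals are
  not generic.
\<close>

lemma finite_nongeneric:
  assumes w: "w \<noteq> 0" and P: "\<And>s. 0 \<le> s \<Longrightarrow> s \<le> l \<Longrightarrow> c + s *\<^sub>R w \<in> P"
  shows "finite {s. 0 \<le> s \<and> s \<le> l \<and> \<not> generic w (c + s *\<^sub>R w)}"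
proof -
  obtain K where K: "\<And>z. z \<in> P \<Longrightarrow> norm z \<le> K" using compact compact_imp_bounded bounded_iff by metis
  let ?F = "{a\<in>L. norm a \<le> 2 * K}"
  have "\<forall>a. \<exists>p q. {s. (c - a) + s *\<^sub>R w \<in> P} = {p..q}" using chord_interval[OF w] by blast
  then obtain p q where pq: "\<And>a. {s. (c - a) + s *\<^sub>R w \<in> P} = {p a..q a}" by metis
  have "{s. 0 \<le> s \<and> s \<le> l \<and> \<not> generic w (c + s *\<^sub>R w)} \<subseteq> p ` ?F \<union> q ` ?F"
  proof
    fix s assume s: "s \<in> {s. 0 \<le> s \<and> s \<le> l \<and> \<not> generic w (c + s *\<^sub>R w)}"
    let ?x = "c + s *\<^sub>R w"
    obtain a where a: "a \<in> L" "?x - a \<in> P" and bad: "\<And>d. d > 0 \<Longrightarrow> \<not> (?x - a + d *\<^sub>R w \<in> P \<and> ?x - a - d *\<^sub>R w \<in> P)"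
      using s unfolding generic_def tiles_at_def by auto
    have "a = ?x - (?x - a)" by simp
    then have "norm a \<le> norm ?x + norm (?x - a)" by (metis norm_triangle_ineq4)
    then have aF: "a \<in> ?F" using a K[OF a(2)] K[OF P[of s]] s by auto
    have mem: "(c - a) + r *\<^sub>R w \<in> P \<longleftrightarrow> p a \<le> r \<and> r \<le> q a" for r using pq[of a] by auto
    have "s = p a \<or> s = q a"
    proof (rule ccontr)
      assume "\<not> ?thesis"
      moreover have "p a \<le> s" "s \<le> q a" using mem[of s] a(2) by (auto simp: algebra_simps)
      ultimately have lt: "p a < s" "s < q a" by auto
      define d where "d = min (s - p a) (q a - s)"
      have d: "d > 0" using lt by (simp add: d_def)
      have "d \<le> s - p a" "d \<le> q a - s" by (simp_all add: d_def)
      then have "(c - a) + (s + d) *\<^sub>R w \<in> P" "(c - a) + (s - d) *\<^sub>R w \<in> P"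
        unfolding mem using d by linarith+
      then have "?x - a + d *\<^sub>R w \<in> P \<and> ?x - a - d *\<^sub>R w \<in> P" by (simp add: algebra_simps)
      then show False using bad[OF d] by blast
    qed
    then show "s \<in> p ` ?F \<union> q ` ?F" using aF by blast
  qed
  then show ?thesis using locally_finite by (auto intro: finite_subset)
qed

text \<open>
  The points lying on a translate as well as on a reflected translate of the face. Membership decides
  between one and two hits, and it is invariant under the maps that carry one edge to another.
\<close>

definition both_signs :: "real^3 \<Rightarrow> (real^3) set" where
  "both_signs u = {x. (\<exists>a\<in>L. x - a \<in> support_face P u) \<and> (\<exists>a\<in>L. - (x - a) \<in> support_face P u)}"

lemma card_hits:
  assumes gen: "generic w x" and u: "u \<bullet> w = 0" and line: "on_line w (support_face P u)"
    and ne: "hits u x \<noteq> {}"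
  shows "card (hits u x) = (if x \<in> both_signs u then 2 else 1)"
proof -
  have iff: "x \<in> both_signs u \<longleftrightarrow> (\<exists>a. (1, a) \<in> hits u x) \<and> (\<exists>a. (-1, a) \<in> hits u x)"
    by (auto simp: both_signs_def hits_def)
  have sg: "e = 1 \<or> e = -1" if "(e, a) \<in> hits u x" for e a using that by (simp add: hits_def)
  note un = hits_unique[OF gen u line]
  show ?thesis
  proof (cases "x \<in> both_signs u")
    case True
    then obtain a b where ab: "(1, a) \<in> hits u x" "(-1, b) \<in> hits u x" using iff by blast
    have "hits u x = {(1, a), (-1, b)}"
    proof
      show "hits u x \<subseteq> {(1, a), (-1, b)}"
      proof
        fix z assume z: "z \<in> hits u x"
        obtain e d where ed: "z = (e, d)" by (cases z)
        then show "z \<in> {(1, a), (-1, b)}" using sg[of e d] z un[OF _ ab(1), of d] un[OF _ ab(2), of d] by auto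
      qed
    qed (use ab in auto)
    then show ?thesis using True by simp
  next
    case False
    obtain e a where ea: "(e, a) \<in> hits u x" using ne by auto
    have "hits u x = {(e, a)}"
    proof
      show "hits u x \<subseteq> {(e, a)}"
      proof
        fix z assume z: "z \<in> hits u x"
        obtain e' d where ed: "z = (e', d)" by (cases z)
        have "e' = e" using False iff sg[OF ea] sg[of e' d] ea z ed by auto
        then show "z \<in> {(e, a)}" using un[OF _ ea, of d] z ed by auto
      qed
    qed (use ea in auto)
    then show ?thesis using False by simp
  qed
qed

lemma card_hits_eq:
  assumes gen: "generic w x" and w: "w \<noteq> 0" and u: "u \<noteq> 0" "u \<bullet> w = 0" and line: "on_line w (support_face P u)"
    and u': "u' \<noteq> 0" "u' \<bullet> w = 0" and line': "on_line w (support_face P u')"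
    and ne: "support_face P u \<inter> support_face P u' = {}" "support_face P (-u) \<inter> support_face P u' = {}"
    and hit: "hits u x \<noteq> {}"
  shows "card (hits u' x) = card (hits u x)"
proof -
  have hit': "hits u' x \<noteq> {}" using hits_other[OF gen w u(2) line u' hit] .
  have ne': "support_face P u' \<inter> support_face P u = {}" "support_face P (-u') \<inter> support_face P u = {}"
  proof -
    show "support_face P u' \<inter> support_face P u = {}" using ne by blast
    show "support_face P (-u') \<inter> support_face P u = {}"
    proof (rule ccontr)
      assume "\<not> ?thesis"
      then obtain z where "z \<in> support_face P (-u')" "z \<in> support_face P u" by blast
      then have "- z \<in> support_face P u'" "- z \<in> support_face P (- u)"
        using support_face_uminus[of z u'] support_face_uminus[of "- z" u] by auto
      then show False using ne by blast
    qed
  qed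
  have "x \<in> both_signs u' \<longleftrightarrow> x \<in> both_signs u"
  proof
    assume "x \<in> both_signs u"
    then obtain a b where ab: "(1, a) \<in> hits u x" "(-1, b) \<in> hits u x" by (auto simp: both_signs_def hits_def)
    have "\<exists>c. (1, c) \<in> hits u' x" "\<exists>c. (-1, c) \<in> hits u' x"
      using hits_both[OF gen w u line u' line' ne ab] by auto
    then show "x \<in> both_signs u'" by (auto simp: both_signs_def hits_def)
  next
    assume "x \<in> both_signs u'"
    then obtain a b where ab: "(1, a) \<in> hits u' x" "(-1, b) \<in> hits u' x" by (auto simp: both_signs_def hits_def)
    have "\<exists>c. (1, c) \<in> hits u x" "\<exists>c. (-1, c) \<in> hits u x"
      using hits_both[OF gen w u' line' u line ne' ab] by auto
    then show "x \<in> both_signs u" by (auto simp: both_signs_def hits_def)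
  qed
  then show ?thesis using card_hits[OF gen u(2) line hit] card_hits[OF gen u'(2) line' hit'] by simp
qed

lemma countable_lattice: "countable L"
proof -
  have "L = (\<Union>n::nat. {a\<in>L. norm a \<le> real n})" using real_arch_simple by auto
  moreover have "countable (\<Union>n::nat. {a\<in>L. norm a \<le> real n})"
    using locally_finite by (auto intro: countable_finite)
  ultimately show ?thesis by simp
qed

lemma closed_support_face: "closed (support_face P u)"
proof -
  have "support_face P u = P \<inter> (\<Inter>y\<in>P. {x. u \<bullet> y \<le> u \<bullet> x})" unfolding support_face_def by auto
  moreover have "closed (P \<inter> (\<Inter>y\<in>P. {x. u \<bullet> y \<le> u \<bullet> x}))"
    using compact compact_imp_closed by (auto intro!: closed_Int closed_INT closed_halfspace_ge)
  ultimately show ?thesis by simp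
qed

lemma both_signs_borel: "both_signs u \<in> sets borel"
proof -
  have "both_signs u = (\<Union>a\<in>L. (\<lambda>x. x - a) -` support_face P u) \<inter> (\<Union>a\<in>L. (\<lambda>x. - (x - a)) -` support_face P u)"
    by (auto simp: both_signs_def)
  moreover have "closed ((\<lambda>x. x - a) -` support_face P u)" "closed ((\<lambda>x. - (x - a)) -` support_face P u)" for a
    by (rule continuous_closed_vimage; auto intro!: closed_support_face continuous_intros)+
  ultimately show ?thesis
    using sets.countable_UN''[OF countable_lattice, of "\<lambda>a. (\<lambda>x. x - a) -` support_face P u" borel]
      sets.countable_UN''[OF countable_lattice, of "\<lambda>a. (\<lambda>x. - (x - a)) -` support_face P u" borel]
    by (metis borel_closed sets.Int)
qed

lemma both_signs_invariant:
  assumes a: "a \<in> L" and e: "e = 1 \<or> e = (-1::real)"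
  shows "e *\<^sub>R (x - a) \<in> both_signs u \<longleftrightarrow> x \<in> both_signs u"
proof -
  have shift: "(\<exists>b\<in>L. f (x - a - b)) \<longleftrightarrow> (\<exists>b\<in>L. f (x - b))" for f
  proof
    assume "\<exists>b\<in>L. f (x - a - b)"
    then obtain b where "b \<in> L" "f (x - (a + b))" by (auto simp: algebra_simps)
    then show "\<exists>b\<in>L. f (x - b)" using lattice_add[OF a] by blast
  next
    assume "\<exists>b\<in>L. f (x - b)"
    then obtain b where b: "b \<in> L" "f (x - b)" by blast
    then have "f (x - a - (b - a))" by simp
    then show "\<exists>b\<in>L. f (x - a - b)" using lattice_diff[OF b(1) a] by blast
  qed
  have neg: "(\<exists>b\<in>L. f (- (x - a) - b)) \<longleftrightarrow> (\<exists>b\<in>L. f (- (x - b)))" for f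
  proof
    assume "\<exists>b\<in>L. f (- (x - a) - b)"
    then obtain b where b: "b \<in> L" "f (- (x - a) - b)" by blast
    then have "f (- (x - (a - b)))" by (simp add: algebra_simps)
    then show "\<exists>b\<in>L. f (- (x - b))" using lattice_diff[OF a b(1)] by blast
  next
    assume "\<exists>b\<in>L. f (- (x - b))"
    then obtain b where b: "b \<in> L" "f (- (x - b))" by blast
    then have "f (- (x - a) - (a - b))" by (simp add: algebra_simps)
    then show "\<exists>b\<in>L. f (- (x - a) - b)" using lattice_diff[OF a b(1)] by blast
  qed
  show ?thesis
  proof (cases "e = 1")
    case True
    then show ?thesis using shift[of "\<lambda>z. z \<in> support_face P u"] shift[of "\<lambda>z. - z \<in> support_face P u"]
      by (simp add: both_signs_def)
  next
    case False
    then have "e = -1" using e by simp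
    then show ?thesis using neg[of "\<lambda>z. z \<in> support_face P u"] neg[of "\<lambda>z. - z \<in> support_face P u"]
      by (auto simp: both_signs_def)
  qed
qed

text \<open>
  The isometry \<open>x \<mapsto> e (x - a)\<close> maps the part of the first edge that it sends into the second one onto
  the part of the second edge that its inverse sends into the first.
\<close>

lemma edge_transport:
  fixes c c' w :: "real^3"
  assumes w: "w \<noteq> 0" and a: "a \<in> L" and e: "e = 1 \<or> e = (-1::real)"
    and E: "\<And>s. c + s *\<^sub>R w \<in> support_face P u \<longleftrightarrow> 0 \<le> s \<and> s \<le> l"
      "\<And>y. y \<in> support_face P u \<Longrightarrow> \<exists>s. y = c + s *\<^sub>R w"
    and E': "\<And>s. c' + s *\<^sub>R w \<in> support_face P u' \<longleftrightarrow> 0 \<le> s \<and> s \<le> l'"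
      "\<And>y. y \<in> support_face P u' \<Longrightarrow> \<exists>s. y = c' + s *\<^sub>R w"
    and phi: "phi \<in> borel_measurable borel" "\<And>x. phi (e *\<^sub>R (x - a)) = phi x"
  shows "(\<integral>\<^sup>+s. indicator {0..l} s * indicator (support_face P u') (e *\<^sub>R (c + s *\<^sub>R w - a)) * phi (c + s *\<^sub>R w) \<partial>lborel)
    = (\<integral>\<^sup>+s. indicator {0..l'} s * indicator (support_face P u) (e *\<^sub>R (c' + s *\<^sub>R w + e *\<^sub>R a)) * phi (c' + s *\<^sub>R w) \<partial>lborel)"
    (is "(\<integral>\<^sup>+s. ?f s \<partial>lborel) = (\<integral>\<^sup>+s. ?g s \<partial>lborel)")
proof (cases "\<exists>t. e *\<^sub>R (c - a) = c' + t *\<^sub>R w")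
  case True
  then obtain t where t: "e *\<^sub>R (c - a) = c' + t *\<^sub>R w" by blast
  have ee: "e * e = 1" "\<bar>e\<bar> = 1" "e \<noteq> 0" using e by auto
  have pos: "e *\<^sub>R (c + s *\<^sub>R w - a) = c' + (t + e * s) *\<^sub>R w" for s
  proof -
    have "e *\<^sub>R (c + s *\<^sub>R w - a) = e *\<^sub>R (c - a) + (e * s) *\<^sub>R w" by (simp add: algebra_simps)
    then show ?thesis using t by (simp add: algebra_simps)
  qed
  have neg: "e *\<^sub>R (c' + (t + e * s) *\<^sub>R w + e *\<^sub>R a) = c + s *\<^sub>R w" for s
    unfolding pos[symmetric] using ee(1) by (simp add: scaleR_right_distrib)
  have fg: "?f s = ?g (t + e * s)" for s
  proof -
    have "indicator {0..l} s = (indicator (support_face P u) (c + s *\<^sub>R w) :: ennreal)"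
      using E(1)[of s] by (simp add: indicator_def)
    moreover have "indicator {0..l'} (t + e * s) = (indicator (support_face P u') (c' + (t + e * s) *\<^sub>R w) :: ennreal)"
      using E'(1)[of "t + e * s"] by (simp add: indicator_def)
    moreover have "phi (c' + (t + e * s) *\<^sub>R w) = phi (c + s *\<^sub>R w)"
      using phi(2)[of "c + s *\<^sub>R w"] pos by simp
    ultimately show ?thesis unfolding pos neg by (simp add: mult.commute)
  qed
  have "?g \<in> borel_measurable borel"
  proof -
    have line: "(\<lambda>s::real. c' + s *\<^sub>R w) \<in> borel_measurable borel" by measurable
    have m1: "(\<lambda>s::real. e *\<^sub>R (c' + s *\<^sub>R w + e *\<^sub>R a)) \<in> borel_measurable borel" by measurable
    have "(indicator (support_face P u) :: real^3 \<Rightarrow> ennreal) \<in> borel_measurable borel"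
      by (intro borel_measurable_indicator borel_closed closed_support_face)
    from measurable_compose[OF m1 this] measurable_compose[OF line phi(1)]
    show ?thesis by measurable
  qed
  then have "(\<integral>\<^sup>+s. ?g s \<partial>lborel) = \<bar>e\<bar> * (\<integral>\<^sup>+s. ?g (t + e * s) \<partial>lborel)"
    by (rule nn_integral_real_affine[OF _ ee(3)])
  then show ?thesis unfolding fg using ee by simp
next
  case False
  have ee: "e * e = 1" using e by auto
  have f0: "?f s = 0" for s
  proof -
    have "e *\<^sub>R (c + s *\<^sub>R w - a) \<notin> support_face P u'"
    proof
      assume "e *\<^sub>R (c + s *\<^sub>R w - a) \<in> support_face P u'"
      then obtain r where "e *\<^sub>R (c + s *\<^sub>R w - a) = c' + r *\<^sub>R w" using E'(2) by blast
      then have "e *\<^sub>R (c - a) = c' + (r - e * s) *\<^sub>R w" by (simp add: algebra_simps)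
      then show False using False by blast
    qed
    then show ?thesis by simp
  qed
  have g0: "?g s = 0" for s
  proof -
    have "e *\<^sub>R (c' + s *\<^sub>R w + e *\<^sub>R a) \<notin> support_face P u"
    proof
      assume "e *\<^sub>R (c' + s *\<^sub>R w + e *\<^sub>R a) \<in> support_face P u"
      then obtain r where "e *\<^sub>R (c' + s *\<^sub>R w + e *\<^sub>R a) = c + r *\<^sub>R w" using E(2) by blast
      then have "(e * e) *\<^sub>R (c' + s *\<^sub>R w + e *\<^sub>R a) = e *\<^sub>R (c + r *\<^sub>R w)"
        by (metis scaleR_scaleR)
      then have "c' + s *\<^sub>R w + e *\<^sub>R a = e *\<^sub>R c + (e * r) *\<^sub>R w"
        unfolding ee by (simp add: scaleR_right_distrib)
      then have "e *\<^sub>R (c - a) = c' + (s - e * r) *\<^sub>R w" by (simp add: algebra_simps)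
      then show False using False by blast
    qed
    then show ?thesis by simp
  qed
  show ?thesis unfolding f0 g0 by simp
qed

text \<open>
  At almost every point of the edge the weights of the translates of the other face through it add up to one.
\<close>

lemma edge_length_as_sum:
  assumes w: "w \<noteq> 0"
    and E: "\<And>s. 0 \<le> s \<Longrightarrow> s \<le> l \<Longrightarrow> c + s *\<^sub>R w \<in> P" "l \<ge> 0"
    and I: "finite I" "\<And>s. 0 \<le> s \<Longrightarrow> s \<le> l \<Longrightarrow> hits u' (c + s *\<^sub>R w) \<subseteq> I"
      "\<And>e a. (e, a) \<in> I \<Longrightarrow> (e = 1 \<or> e = -1) \<and> a \<in> L"
    and phi: "phi \<in> borel_measurable borel"
      "\<And>s. 0 \<le> s \<Longrightarrow> s \<le> l \<Longrightarrow> generic w (c + s *\<^sub>R w) \<Longrightarrow>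
        of_nat (card (hits u' (c + s *\<^sub>R w))) * phi (c + s *\<^sub>R w) = (1::ennreal)"
  shows "(\<Sum>(e, a)\<in>I. \<integral>\<^sup>+s. indicator {0..l} s * indicator (support_face P u') (e *\<^sub>R (c + s *\<^sub>R w - a)) * phi (c + s *\<^sub>R w) \<partial>lborel)
    = ennreal l"
proof -
  let ?f = "\<lambda>e a s. indicator {0..l} s * indicator (support_face P u') (e *\<^sub>R (c + s *\<^sub>R w - a)) * phi (c + s *\<^sub>R w)"
  have meas: "?f e a \<in> borel_measurable borel" for e a
  proof -
    have line: "(\<lambda>s::real. c + s *\<^sub>R w) \<in> borel_measurable borel" by measurable
    have m1: "(\<lambda>s::real. e *\<^sub>R (c + s *\<^sub>R w - a)) \<in> borel_measurable borel" by measurable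
    have "(indicator (support_face P u') :: real^3 \<Rightarrow> ennreal) \<in> borel_measurable borel"
      by (intro borel_measurable_indicator borel_closed closed_support_face)
    from measurable_compose[OF m1 this] measurable_compose[OF line phi(1)]
    show ?thesis by measurable
  qed
  have sum_eq: "(\<Sum>(e, a)\<in>I. ?f e a s) = indicator {0..l} s"
    if s: "\<not> (0 \<le> s \<and> s \<le> l \<and> \<not> generic w (c + s *\<^sub>R w))" for s
  proof (cases "0 \<le> s \<and> s \<le> l")
    case True
    let ?x = "c + s *\<^sub>R w"
    have "(\<Sum>(e, a)\<in>I. ?f e a s) = (\<Sum>z\<in>I. indicator (hits u' ?x) z * phi ?x)"
      using True I(3) by (intro sum.cong refl) (auto simp: hits_def indicator_def)
    also have "\<dots> = (\<Sum>z\<in>I. indicator (hits u' ?x) z) * phi ?x" by (simp add: sum_distrib_right)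
    also have "(\<Sum>z\<in>I. indicator (hits u' ?x) z) = (of_nat (card (hits u' ?x)) :: ennreal)"
    proof -
      have "I \<inter> hits u' ?x = hits u' ?x" using I(2)[of s] True by auto
      then show ?thesis using I(1) by (simp add: indicator_def sum.If_cases Collect_mem_eq Int_def)
    qed
    also have "\<dots> * phi ?x = 1" using phi(2) True s by blast
    finally show ?thesis using True by simp
  next
    case False
    then have "indicator {0..l} s = (0::ennreal)" by (simp add: indicator_def)
    then show ?thesis by (simp add: case_prod_unfold)
  qed
  have "(\<Sum>(e, a)\<in>I. \<integral>\<^sup>+s. ?f e a s \<partial>lborel) = (\<integral>\<^sup>+s. (\<Sum>(e, a)\<in>I. ?f e a s) \<partial>lborel)"
    using meas by (subst nn_integral_sum) (auto simp: case_prod_unfold)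
  also have "\<dots> = (\<integral>\<^sup>+s. indicator {0..l} s \<partial>lborel)"
  proof (rule nn_integral_cong_AE)
    have "{s. 0 \<le> s \<and> s \<le> l \<and> \<not> generic w (c + s *\<^sub>R w)} \<in> null_sets lborel"
      using finite_nongeneric[OF w E(1)] by (intro finite_imp_null_set_lborel) auto
    then show "AE s in lborel. (\<Sum>(e, a)\<in>I. ?f e a s) = indicator {0..l} s"
      by (rule AE_I') (use sum_eq in blast)
  qed
  also have "\<dots> = ennreal l" using E(2) by simp
  finally show ?thesis .
qed

text \<open>
  Intersecting faces, or faces with intersecting reflections, are fibres of the projection along \<open>w\<close> over the
  same point and hence equal. Otherwise consider all pairs of a point \<open>x\<close> on the first edge and a hit of the second face
  at \<open>x\<close>, weighted by the reciprocal of the number of hits at \<open>x\<close>. Their total weight is the length of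
  the first edge. By \<open>edge_transport\<close> it is also the total over the second edge, since the
  number of hits is the same for both faces (\<open>card_hits_eq\<close>).
\<close>

lemma edges_equal_length:
  assumes w: "w \<noteq> 0" and u: "u \<bullet> w = 0" and u': "u' \<bullet> w = 0"
    and line: "on_line w (support_face P u)" and line': "on_line w (support_face P u')"
    and y: "y \<in> support_face P u" "y + t *\<^sub>R w \<in> support_face P u"
  shows "\<exists>y'. y' \<in> support_face P u' \<and> y' + t *\<^sub>R w \<in> support_face P u'"
proof -
  have nz: "v \<noteq> 0" if "on_line w (support_face P v)" for v
  proof
    assume "v = 0"
    then have F: "support_face P v = P" by (auto simp: support_face_def)
    obtain g where g: "g \<noteq> 0" "orthogonal w g" using orthogonal_to_vector_exists[of w] by auto
    have "g \<bullet> z = 0" if z: "z \<in> P" for z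
    proof -
      obtain s where "z = 0 + s *\<^sub>R w" using \<open>on_line w (support_face P v)\<close> zero_in_P z unfolding F on_line_def by blast
      then show ?thesis using g(2) by (simp add: orthogonal_def inner_commute)
    qed
    then show False using no_functional_vanishes g(1) by blast
  qed
  consider "support_face P u \<inter> support_face P u' \<noteq> {}" | "support_face P (-u) \<inter> support_face P u' \<noteq> {}"
    | "support_face P u \<inter> support_face P u' = {}" "support_face P (-u) \<inter> support_face P u' = {}" by blast
  then show ?thesis
  proof cases
    case 1
    then obtain z where "z \<in> support_face P u" "z + 0 *\<^sub>R w \<in> support_face P u'" by auto
    from support_faces_equal[OF u u' line line' this] show ?thesis using y by blast
  next
    case 2
    then obtain z where "z \<in> support_face P (-u)" "z + 0 *\<^sub>R w \<in> support_face P u'" by auto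
    from support_faces_equal[OF _ u' on_line_uminus[OF line] line' this] u
    have S: "support_face P (-u) \<subseteq> support_face P u'" by simp
    have m: "- y \<in> support_face P (-u)" "- (y + t *\<^sub>R w) \<in> support_face P (-u)"
      by (rule iffD2[OF support_face_uminus], unfold minus_minus, rule y)+
    show ?thesis
    proof (intro exI conjI)
      show "- (y + t *\<^sub>R w) \<in> support_face P u'" by (rule subsetD[OF S m(2)])
      show "- (y + t *\<^sub>R w) + t *\<^sub>R w \<in> support_face P u'" using subsetD[OF S m(1)] by simp
    qed
  next
    case 3
    obtain c l where E: "l \<ge> 0" "\<And>s. c + s *\<^sub>R w \<in> support_face P u \<longleftrightarrow> 0 \<le> s \<and> s \<le> l"
      "\<And>y. y \<in> support_face P u \<Longrightarrow> \<exists>s. y = c + s *\<^sub>R w" by (rule edge_param[OF w u line]) (rule that)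
    obtain c' l' where E': "l' \<ge> 0" "\<And>s. c' + s *\<^sub>R w \<in> support_face P u' \<longleftrightarrow> 0 \<le> s \<and> s \<le> l'"
      "\<And>y. y \<in> support_face P u' \<Longrightarrow> \<exists>s. y = c' + s *\<^sub>R w" by (rule edge_param[OF w u' line']) (rule that)
    obtain K where K: "\<And>z. z \<in> P \<Longrightarrow> norm z \<le> K" using compact compact_imp_bounded bounded_iff by metis
    \<comment> \<open>A finite set that contains the hits at all points of \<open>P\<close>.\<close>
    define I where "I = {1, -1 :: real} \<times> {a\<in>L. norm a \<le> 2 * K}"
    have finI: "finite I" unfolding I_def using locally_finite by simp
    have sub: "hits v x \<subseteq> I" if "x \<in> P" for v x
    proof
      fix z assume "z \<in> hits v x"
      then obtain e a where z: "z = (e, a)" "e = 1 \<or> e = -1" "a \<in> L" "e *\<^sub>R (x - a) \<in> P"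
        unfolding hits_def support_face_def by auto
      have "x - a \<in> P" using z(2,4) symmetric_iff[of "x - a"] by auto
      moreover have "a = x - (x - a)" by simp
      then have "norm a \<le> norm x + norm (x - a)" by (metis norm_triangle_ineq4)
      ultimately have "norm a \<le> 2 * K" using K[OF that] K[of "x - a"] by linarith
      then show "z \<in> I" using z by (auto simp: I_def)
    qed
    \<comment> \<open>The weight is defined through \<open>both_signs\<close> rather than through the number of
      hits, which makes its measurability and invariance evident.\<close>
    define phi where "phi = (\<lambda>x. if x \<in> both_signs u then ennreal (1/2) else 1)"
    have phi_meas: "phi \<in> borel_measurable borel"
      unfolding phi_def by (rule measurable_If_set) (auto simp: both_signs_borel)
    have phi_inv: "phi (e *\<^sub>R (x - a)) = phi x" if "a \<in> L" "e = 1 \<or> e = -1" for e x a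
      using both_signs_invariant[OF that] by (simp add: phi_def)
    have half: "2 * ennreal (1/2) = 1"
    proof -
      have "2 * ennreal (1/2) = ennreal 2 * ennreal (1/2)" by simp
      also have "\<dots> = 1" by (subst ennreal_mult[symmetric]) auto
      finally show ?thesis .
    qed
    have card1: "of_nat (card (hits u x)) * phi x = 1" if "generic w x" "hits u x \<noteq> {}" for x
      using card_hits[OF that(1) u line that(2)] half by (simp add: phi_def)
    note ceq = card_hits_eq[OF _ w nz[OF line] u line nz[OF line'] u' line' 3]
    have hit_E: "hits u (c + s *\<^sub>R w) \<noteq> {}" if "0 \<le> s" "s \<le> l" for s
    proof -
      have "(1, 0) \<in> hits u (c + s *\<^sub>R w)" using E(2)[of s] that lattice_zero by (simp add: hits_def)
      then show ?thesis by blast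
    qed
    have hit_E': "hits u' (c' + s *\<^sub>R w) \<noteq> {}" if "0 \<le> s" "s \<le> l'" for s
    proof -
      have "(1, 0) \<in> hits u' (c' + s *\<^sub>R w)" using E'(2)[of s] that lattice_zero by (simp add: hits_def)
      then show ?thesis by blast
    qed
    have EP: "c + s *\<^sub>R w \<in> P" if "0 \<le> s" "s \<le> l" for s using E(2)[of s] that by (simp add: support_face_def)
    have EP': "c' + s *\<^sub>R w \<in> P" if "0 \<le> s" "s \<le> l'" for s using E'(2)[of s] that by (simp add: support_face_def)
    have Iprop: "(e = 1 \<or> e = -1) \<and> a \<in> L" if "(e, a) \<in> I" for e a using that by (auto simp: I_def)
    \<comment> \<open>The total weight, first over one edge and then over the other.\<close>
    have "ennreal l = (\<Sum>(e, a)\<in>I. \<integral>\<^sup>+s. indicator {0..l} s * indicator (support_face P u') (e *\<^sub>R (c + s *\<^sub>R w - a)) * phi (c + s *\<^sub>R w) \<partial>lborel)"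
    proof (rule edge_length_as_sum[symmetric, OF w _ E(1) finI _ _ phi_meas])
      show "of_nat (card (hits u' (c + s *\<^sub>R w))) * phi (c + s *\<^sub>R w) = 1"
        if "0 \<le> s" "s \<le> l" "generic w (c + s *\<^sub>R w)" for s
        using ceq[OF that(3) hit_E[OF that(1,2)]] card1[OF that(3) hit_E[OF that(1,2)]] by simp
    qed (use EP sub Iprop in blast)+
    also have "\<dots> = (\<Sum>(e, a)\<in>I. \<integral>\<^sup>+s. indicator {0..l'} s * indicator (support_face P u) (e *\<^sub>R (c' + s *\<^sub>R w + e *\<^sub>R a)) * phi (c' + s *\<^sub>R w) \<partial>lborel)"
      using edge_transport[OF w _ _ E(2,3) E'(2,3) phi_meas] Iprop phi_inv by (intro sum.cong refl) auto
    also have "\<dots> = (\<Sum>(e, a)\<in>I. \<integral>\<^sup>+s. indicator {0..l'} s * indicator (support_face P u) (e *\<^sub>R (c' + s *\<^sub>R w - a)) * phi (c' + s *\<^sub>R w) \<partial>lborel)"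
    \<comment> \<open>The inverse of the map \<open>x \<mapsto> e (x - a)\<close> is \<open>x \<mapsto> e (x - (- e
      a))\<close>.\<close>
    proof (rule sum.reindex_bij_witness[of _ "\<lambda>(e, a). (e, - e *\<^sub>R a)" "\<lambda>(e, a). (e, - e *\<^sub>R a)"])
      fix z assume "z \<in> I"
      then show "(\<lambda>(e, a). (e, - e *\<^sub>R a)) ((\<lambda>(e, a). (e, - e *\<^sub>R a)) z) = z" by (auto simp: I_def)
      show "(\<lambda>(e, a). (e, - e *\<^sub>R a)) z \<in> I" using \<open>z \<in> I\<close> lattice_uminus by (auto simp: I_def)
    qed (auto simp: I_def lattice_uminus)
    also have "\<dots> = ennreal l'"
    proof (rule edge_length_as_sum[OF w _ E'(1) finI _ _ phi_meas])
      show "of_nat (card (hits u (c' + s *\<^sub>R w))) * phi (c' + s *\<^sub>R w) = 1"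
        if "0 \<le> s" "s \<le> l'" "generic w (c' + s *\<^sub>R w)" for s
        using card1[OF that(3)] hits_other[OF that(3) w u' line' nz[OF line] u hit_E'[OF that(1,2)]] by blast
    qed (use EP' sub Iprop in blast)+
    finally have "l = l'" using E(1) E'(1) by simp
    obtain s0 where s0: "y = c + s0 *\<^sub>R w" using E(3) y(1) by blast
    have "0 \<le> s0" "s0 \<le> l" using E(2) y(1) s0 by auto
    moreover have "c + (s0 + t) *\<^sub>R w \<in> support_face P u" using y(2) s0 by (simp add: algebra_simps)
    then have "0 \<le> s0 + t" "s0 + t \<le> l" using E(2) by auto
    ultimately have "c' + s0 *\<^sub>R w \<in> support_face P u'" "c' + (s0 + t) *\<^sub>R w \<in> support_face P u'"
      using E'(2) \<open>l = l'\<close> by auto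
    then show ?thesis by (intro exI[of _ "c' + s0 *\<^sub>R w"]) (simp add: algebra_simps)
  qed
qed

section \<open>Planes through an edge direction\<close>

text \<open>
  A point of the triangles at which a functional attains its maximum over \<open>P\<close> lies, modulo \<open>w\<close>, on a side
  opposite to the origin.
\<close>

lemma in_triangles_on_boundary:
  assumes tri: "in_triangles w A B x" and x: "x \<in> support_face P g" and g: "g \<noteq> 0" "g \<bullet> w = 0"
    and A: "A \<in> P" and B: "B \<in> P"
  shows "\<exists>e p t. (e = 1 \<or> e = -1) \<and> x = p *\<^sub>R A - (e - p) *\<^sub>R B + t *\<^sub>R w"
proof -
  define h where "h = g \<bullet> x"
  have h: "h > 0" unfolding h_def by (rule support_value_pos[OF g(1) x])
  have le: "g \<bullet> y \<le> h" if "y \<in> P" for y using x that unfolding support_face_def h_def by blast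
  have A': "\<bar>g \<bullet> A\<bar> \<le> h" using le[OF A] le[OF symmetric[OF A]] by simp
  have B': "\<bar>g \<bullet> B\<bar> \<le> h" using le[OF B] le[OF symmetric[OF B]] by simp
  obtain p q t where pq: "p * q \<ge> 0" "\<bar>p + q\<bar> \<le> 1" "x = p *\<^sub>R A - q *\<^sub>R B + t *\<^sub>R w"
    using tri unfolding in_triangles_def by blast
  have "h = p * (g \<bullet> A) - q * (g \<bullet> B)" unfolding h_def pq(3) using g by (simp add: inner_add_right inner_diff_right)
  also have "\<dots> \<le> \<bar>p\<bar> * \<bar>g \<bullet> A\<bar> + \<bar>q\<bar> * \<bar>g \<bullet> B\<bar>"
    using abs_ge_self[of "p * (g \<bullet> A)"] abs_ge_minus_self[of "q * (g \<bullet> B)"] by (simp add: abs_mult)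
  also have "\<dots> \<le> \<bar>p\<bar> * h + \<bar>q\<bar> * h" using A' B' by (intro add_mono mult_left_mono) auto
  also have "\<dots> = (\<bar>p\<bar> + \<bar>q\<bar>) * h" by (simp add: algebra_simps)
  also have "\<bar>p\<bar> + \<bar>q\<bar> = \<bar>p + q\<bar>" using pq(1) by (auto simp: zero_le_mult_iff)
  finally have "1 * h \<le> \<bar>p + q\<bar> * h" by simp
  then have "1 \<le> \<bar>p + q\<bar>" using h by (subst (asm) mult_le_cancel_right) auto
  then have e: "p + q = 1 \<or> p + q = -1" using pq(2) by linarith
  have "x = p *\<^sub>R A - ((p + q) - p) *\<^sub>R B + t *\<^sub>R w" using pq(3) by simp
  then show ?thesis using e by blast
qed

text \<open>
  Modulo \<open>w\<close>, a segment in a face with normal orthogonal to \<open>w\<close> is covered by the six outer sides of the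
  triangles. These are parallel to the sums of two of the positions of \<open>x\<close> in three tiles. Infinitely many of its points lie on one
  of these sides.
\<close>

lemma three_planes:
  assumes w: "w \<noteq> 0" and u: "u \<bullet> w = 0" and line: "on_line w (support_face P u)"
    and y: "y \<in> support_face P u" "y + t *\<^sub>R w \<in> support_face P u" "t \<noteq> 0"
  obtains z1 z2 z3 where
    "\<And>g r v. g \<noteq> 0 \<Longrightarrow> g \<bullet> w = 0 \<Longrightarrow> r \<in> support_face P g \<Longrightarrow> r + v \<in> support_face P g \<Longrightarrow>
       \<exists>z\<in>{z1, z2, z3}. \<exists>\<alpha> \<beta>. v = \<alpha> *\<^sub>R z + \<beta> *\<^sub>R w"
proof -
  obtain c l where E: "l \<ge> 0" "\<And>s. c + s *\<^sub>R w \<in> support_face P u \<longleftrightarrow> 0 \<le> s \<and> s \<le> l"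
    "\<And>y. y \<in> support_face P u \<Longrightarrow> \<exists>s. y = c + s *\<^sub>R w" by (rule edge_param[OF w u line]) (rule that)
  obtain s0 where s0: "y = c + s0 *\<^sub>R w" using E(3) y(1) by blast
  have "0 \<le> s0" "s0 \<le> l" using E(2) y(1) s0 by auto
  moreover have "c + (s0 + t) *\<^sub>R w \<in> support_face P u" using y(2) s0 by (simp add: algebra_simps)
  then have "0 \<le> s0 + t" "s0 + t \<le> l" using E(2) by auto
  ultimately have "l > 0" using y(3) by linarith
  have "infinite {0..l}" using \<open>l > 0\<close> by (simp add: infinite_Icc)
  moreover have "finite {s. 0 \<le> s \<and> s \<le> l \<and> \<not> generic w (c + s *\<^sub>R w)}"
  proof (rule finite_nongeneric[OF w])
    show "c + s *\<^sub>R w \<in> P" if "0 \<le> s" "s \<le> l" for s using E(2)[of s] that by (simp add: support_face_def)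
  qed
  ultimately have "infinite ({0..l} - {s. 0 \<le> s \<and> s \<le> l \<and> \<not> generic w (c + s *\<^sub>R w)})"
    by (metis Diff_infinite_finite)
  then have "{0..l} - {s. 0 \<le> s \<and> s \<le> l \<and> \<not> generic w (c + s *\<^sub>R w)} \<noteq> {}"
    by (rule infinite_imp_nonempty)
  then obtain s where s: "0 \<le> s" "s \<le> l" "generic w (c + s *\<^sub>R w)" by auto
  define x where "x = c + s *\<^sub>R w"
  have gen: "generic w x" and xf: "x - 0 \<in> support_face P u" using s E(2)[of s] by (simp_all add: x_def)
  obtain a b where tt: "three_tiles w x 0 a b"
    using three_tiles_exist'[OF gen w u lattice_zero _ line] xf by blast
  have YP: "x - 0 \<in> P" "x - a \<in> P" "x - b \<in> P" using tt by (auto simp: three_tiles_def tiles_at_def)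
  show thesis
  proof (rule that[of "(x - 0) + (x - a)" "(x - 0) + (x - b)" "(x - a) + (x - b)"])
    fix g r v assume g: "g \<noteq> 0" "g \<bullet> w = 0" and r: "r \<in> support_face P g" "r + v \<in> support_face P g"
    define Q where "Q = (\<lambda>A B e. {k::real. \<exists>p t. r + k *\<^sub>R v = p *\<^sub>R A - (e - p) *\<^sub>R B + t *\<^sub>R w})"
    have rk: "r + k *\<^sub>R v \<in> support_face P g" if k: "k \<in> {0..1}" for k
    proof -
      have rv: "r \<in> P" "r + v \<in> P" using r by (auto simp: support_face_def)
      have "(1 - k) *\<^sub>R r + k *\<^sub>R (r + v) \<in> P" using convexD[OF convex rv, of "1 - k" k] k by simp
      moreover have "(1 - k) *\<^sub>R r + k *\<^sub>R (r + v) = r + k *\<^sub>R v" by (simp add: algebra_simps)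
      ultimately have "r + k *\<^sub>R v \<in> P" by simp
      moreover have "g \<bullet> v = 0"
      proof -
        have "g \<bullet> (r + v) \<le> g \<bullet> r" "g \<bullet> r \<le> g \<bullet> (r + v)" using r rv unfolding support_face_def by blast+
        then show ?thesis by (simp add: inner_add_right)
      qed
      ultimately show ?thesis using r(1) by (simp add: support_face_def inner_add_right)
    qed
    have inQ: "\<exists>e\<in>{1,-1}. k \<in> Q A B e"
      if k: "k \<in> {0..1}" and tri: "in_triangles w A B (r + k *\<^sub>R v)" and AB: "A \<in> P" "B \<in> P" for k A B
    proof -
      obtain e p t where e: "e = 1 \<or> e = -1" and eq: "r + k *\<^sub>R v = p *\<^sub>R A - (e - p) *\<^sub>R B + t *\<^sub>R w"
        using in_triangles_on_boundary[OF tri rk[OF k] g AB] by (elim exE conjE) (rule that)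
      have "k \<in> Q A B e" unfolding Q_def mem_Collect_eq using eq by (intro exI)
      then show ?thesis using e by auto
    qed
    have cover: "(\<exists>e\<in>{1,-1}. k \<in> Q (x - 0) (x - a) e) \<or> (\<exists>e\<in>{1,-1}. k \<in> Q (x - 0) (x - b) e)
      \<or> (\<exists>e\<in>{1,-1}. k \<in> Q (x - a) (x - b) e)" if k: "k \<in> {0..1}" for k
    proof -
      have "r + k *\<^sub>R v \<in> P" using rk[OF k] by (simp add: support_face_def)
      from three_tiles_hexagon[OF tt this w] show ?thesis
        using inQ[OF k _ YP(1,2)] inQ[OF k _ YP(1,3)] inQ[OF k _ YP(2,3)] by meson
    qed
    have fin: "finite (Q A B e)" if d: "\<not> (\<exists>\<alpha> \<beta>. v = \<alpha> *\<^sub>R (A + B) + \<beta> *\<^sub>R w)" for A B e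
    proof -
      have "k = k'" if kk: "k \<in> Q A B e" "k' \<in> Q A B e" for k k'
      proof (rule ccontr)
        assume ne: "k \<noteq> k'"
        obtain p t p' t' where 1: "r + k *\<^sub>R v = p *\<^sub>R A - (e - p) *\<^sub>R B + t *\<^sub>R w"
          and 2: "r + k' *\<^sub>R v = p' *\<^sub>R A - (e - p') *\<^sub>R B + t' *\<^sub>R w"
          using kk unfolding Q_def by blast
        have "(k - k') *\<^sub>R v = (r + k *\<^sub>R v) - (r + k' *\<^sub>R v)" by (simp add: algebra_simps)
        also have "\<dots> = (p - p') *\<^sub>R (A + B) + (t - t') *\<^sub>R w" unfolding 1 2 by (simp add: algebra_simps)
        finally have "(1 / (k - k')) *\<^sub>R ((k - k') *\<^sub>R v) = (1 / (k - k')) *\<^sub>R ((p - p') *\<^sub>R (A + B) + (t - t') *\<^sub>R w)"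
          by (rule arg_cong)
        then have "v = ((p - p') / (k - k')) *\<^sub>R (A + B) + ((t - t') / (k - k')) *\<^sub>R w"
          using ne by (simp add: scaleR_right_distrib)
        then show False using d by blast
      qed
      then have "Q A B e \<subseteq> {SOME k. k \<in> Q A B e}" by (auto intro: someI2)
      then show ?thesis by (rule finite_subset) simp
    qed
    show "\<exists>z\<in>{(x - 0) + (x - a), (x - 0) + (x - b), (x - a) + (x - b)}. \<exists>\<alpha> \<beta>. v = \<alpha> *\<^sub>R z + \<beta> *\<^sub>R w"
    proof (rule ccontr)
      assume no: "\<not> ?thesis"
      have d: "\<not> (\<exists>\<alpha> \<beta>. v = \<alpha> *\<^sub>R ((x - 0) + (x - a)) + \<beta> *\<^sub>R w)"
        "\<not> (\<exists>\<alpha> \<beta>. v = \<alpha> *\<^sub>R ((x - 0) + (x - b)) + \<beta> *\<^sub>R w)"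
        "\<not> (\<exists>\<alpha> \<beta>. v = \<alpha> *\<^sub>R ((x - a) + (x - b)) + \<beta> *\<^sub>R w)" using no by blast+
      have "finite (\<Union>e\<in>{1,-1}. Q (x - 0) (x - a) e \<union> Q (x - 0) (x - b) e \<union> Q (x - a) (x - b) e)"
        by (intro finite_UN_I finite_UnI fin d) simp
      moreover have "{0..1} \<subseteq> (\<Union>e\<in>{1,-1}. Q (x - 0) (x - a) e \<union> Q (x - 0) (x - b) e \<union> Q (x - a) (x - b) e)"
      proof
        fix k :: real assume "k \<in> {0..1}"
        from cover[OF this] show "k \<in> (\<Union>e\<in>{1,-1}. Q (x - 0) (x - a) e \<union> Q (x - 0) (x - b) e \<union> Q (x - a) (x - b) e)"
          by (elim disjE bexE) (rule UN_I, assumption, simp)+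
      qed
      ultimately have "finite {0..1::real}" by (rule finite_subset[rotated])
      then show False using infinite_Icc[of 0 "1::real"] by simp
    qed
  qed
qed

end

section \<open>Polytopes with equal parallel edges\<close>

primrec zonotope :: "(real^3) list \<Rightarrow> (real^3) set" where
  "zonotope [] = {0}"
| "zonotope (w # ws) = {t *\<^sub>R w + z | t z. 0 \<le> t \<and> t \<le> 1 \<and> z \<in> zonotope ws}"

text \<open>
  The conclusion is also required when the second face is a single point: then every pair of points of
  the first face with difference \<open>t *\<^sub>R w\<close> must have \<open>t = 0\<close>.
\<close>

definition equal_edges :: "(real^3) set \<Rightarrow> bool" where
  "equal_edges P \<longleftrightarrow> (\<forall>w u u' y t. w \<noteq> 0 \<longrightarrow> u \<bullet> w = 0 \<longrightarrow> u' \<bullet> w = 0 \<longrightarrow>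
     on_line w (support_face P u) \<longrightarrow> on_line w (support_face P u') \<longrightarrow>
     y \<in> support_face P u \<longrightarrow> y + t *\<^sub>R w \<in> support_face P u \<longrightarrow>
     (\<exists>y'. y' \<in> support_face P u' \<and> y' + t *\<^sub>R w \<in> support_face P u'))"

text \<open>
  Differences of the endpoints of edges, each with both signs.
\<close>

definition edge_vectors :: "(real^3) set \<Rightarrow> (real^3) set" where
  "edge_vectors P = {w. w \<noteq> 0 \<and> (\<exists>u y. u \<bullet> w = 0 \<and> support_face P u = closed_segment y (y + w))}"

lemma on_line_segment: "on_line w (closed_segment y (y + w))"
  unfolding on_line_def
proof (intro ballI)
  fix a b assume "a \<in> closed_segment y (y + w)" "b \<in> closed_segment y (y + w)"
  then obtain s t where "a = (1 - s) *\<^sub>R y + s *\<^sub>R (y + w)" "b = (1 - t) *\<^sub>R y + t *\<^sub>R (y + w)"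
    by (auto simp: closed_segment_def)
  then have "b = a + (t - s) *\<^sub>R w" by (simp add: algebra_simps)
  then show "\<exists>t. b = a + t *\<^sub>R w" ..
qed

lemma support_face_eq:
  assumes "y \<in> support_face P u" shows "support_face P u = P \<inter> {x. u \<bullet> x = u \<bullet> y}"
proof
  show "support_face P u \<subseteq> P \<inter> {x. u \<bullet> x = u \<bullet> y}"
    using assms unfolding support_face_def by (auto intro: antisym)
  show "P \<inter> {x. u \<bullet> x = u \<bullet> y} \<subseteq> support_face P u"
    using assms unfolding support_face_def by auto
qed

lemma support_face_face_of:
  assumes "convex P" shows "support_face P u face_of P"
proof (cases "support_face P u = {}")
  case True then show ?thesis by (simp add: empty_face_of)
next
  case False
  then obtain y where y: "y \<in> support_face P u" by blast
  show ?thesis unfolding support_face_eq[OF y]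
    by (rule face_of_Int_supporting_hyperplane_le[OF assms]) (use y in \<open>auto simp: support_face_def\<close>)
qed

lemma support_face_exists:
  assumes "compact P" "P \<noteq> {}" shows "support_face P u \<noteq> {}"
proof -
  have "continuous_on P (\<lambda>x. u \<bullet> x)" by (intro continuous_intros)
  with assms obtain x where "x \<in> P" "\<forall>y\<in>P. u \<bullet> y \<le> u \<bullet> x"
    using continuous_attains_sup[of P "\<lambda>x. u \<bullet> x"] by blast
  then show ?thesis unfolding support_face_def by auto
qed

lemma support_face_of_polytope:
  assumes "finite V" "P = convex hull V"
  obtains s where "s \<subseteq> V" "support_face P u = convex hull s"
proof -
  have "support_face P u face_of convex hull V" using support_face_face_of[of P u] assms(2) by simp
  then show thesis using face_of_convex_hull_subset[of V] assms(1) that finite_imp_compact by metis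
qed

lemma finite_edge_vectors:
  assumes "polytope P" shows "finite (edge_vectors P)"
proof -
  obtain V where V: "finite V" "P = convex hull V" using assms unfolding polytope_def by blast
  have "edge_vectors P \<subseteq> (\<lambda>(a, b). b - a) ` (V \<times> V)"
  proof
    fix w assume "w \<in> edge_vectors P"
    then obtain u y where seg: "support_face P u = closed_segment y (y + w)" unfolding edge_vectors_def by blast
    obtain s where s: "s \<subseteq> V" "support_face P u = convex hull s" by (rule support_face_of_polytope[OF V])
    have "y extreme_point_of convex hull s" "(y + w) extreme_point_of convex hull s"
      unfolding s(2)[symmetric] seg by (simp_all add: extreme_point_of_segment)
    then have "y \<in> V" "y + w \<in> V" using extreme_point_of_convex_hull s(1) by blast+
    then show "w \<in> (\<lambda>(a, b). b - a) ` (V \<times> V)" by (intro image_eqI[of _ _ "(y, y + w)"]) auto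
  qed
  then show ?thesis using V(1) by (auto intro: finite_subset)
qed

lemma one_dimensional_face:
  fixes P :: "(real^3) set"
  assumes "polytope P" "aff_dim P \<ge> 1"
  shows "\<exists>F. F face_of P \<and> aff_dim F = 1"
  using assms
proof (induction "nat (aff_dim P)" arbitrary: P rule: less_induct)
  case less
  show ?case
  proof (cases "aff_dim P = 1")
    case True
    then show ?thesis using face_of_refl polytope_imp_convex less by blast
  next
    case False
    then have d: "aff_dim P > 1" using less by simp
    then obtain F where F: "F facet_of P" using polytope_facet_exists[of P] less by auto
    then have "aff_dim F = aff_dim P - 1" "F face_of P" by (auto simp: facet_of_def)
    moreover have "polytope F" using face_of_polytope_polytope less \<open>F face_of P\<close> by blast
    ultimately obtain G where "G face_of F" "aff_dim G = 1" using less(1)[of F] d by auto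
    then show ?thesis using face_of_trans \<open>F face_of P\<close> by blast
  qed
qed

lemma edge_vector_exists:
  fixes P :: "(real^3) set"
  assumes P: "polytope P" "P \<noteq> {}" and no: "edge_vectors P = {}"
  obtains c where "P = {c}"
proof (cases "aff_dim P \<ge> 1")
  case False
  then have "aff_dim P = 0" using P(2) aff_dim_geq[of P] aff_dim_empty[of P] by linarith
  then show thesis using that aff_dim_eq_0 by blast
next
  case True
  obtain F where F: "F face_of P" "aff_dim F = 1" using one_dimensional_face[OF P(1) True] by blast
  have "compact F" "convex F" using face_of_polytope_polytope[OF P(1) F(1)] polytope_imp_compact polytope_imp_convex by auto
  moreover have "F \<noteq> {}" using F(2) by auto
  moreover have "collinear F" using F(2) by (simp add: collinear_aff_dim)
  ultimately obtain p q where pq: "F = closed_segment p q" using compact_convex_collinear_segment by metis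
  have "p \<noteq> q" using F(2) pq by auto
  have "F exposed_face_of P" using exposed_face_of_polyhedron[OF polytope_imp_polyhedron[OF P(1)]] F(1) by blast
  then obtain a b where ab: "P \<subseteq> {x. a \<bullet> x \<le> b}" "F = P \<inter> {x. a \<bullet> x = b}" unfolding exposed_face_of_def by blast
  have pF: "p \<in> F" "q \<in> F" using pq by auto
  have "support_face P a = F"
  proof
    show "F \<subseteq> support_face P a" using ab unfolding support_face_def by auto
    show "support_face P a \<subseteq> F"
    proof
      fix x assume x: "x \<in> support_face P a"
      then have "a \<bullet> p \<le> a \<bullet> x" "x \<in> P" using pF(1) ab(2) unfolding support_face_def by auto
      then show "x \<in> F" using pF(1) ab by (auto intro: antisym)
    qed
  qed
  then have "support_face P a = closed_segment p (p + (q - p))" using pq by simp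
  moreover have "a \<bullet> (q - p) = 0" using pF ab(2) by (simp add: inner_diff_right)
  ultimately have "q - p \<in> edge_vectors P"
    unfolding edge_vectors_def using \<open>p \<noteq> q\<close> by (metis (mono_tags, lifting) mem_Collect_eq right_minus_eq)
  then show thesis using no by simp
qed

text \<open>
  Tilt \<open>u\<close> slightly by the component of \<open>w\<close> orthogonal to \<open>w'\<close>. It is constant on the face, and the finitely many vertices
  outside the face stay strictly below.
\<close>

lemma perturb_support_face:
  fixes Q :: "(real^3) set"
  assumes Q: "polytope Q" "Q \<noteq> {}" and w: "w' \<noteq> 0" "\<And>c. w \<noteq> c *\<^sub>R w'" and u: "u \<bullet> w' = 0"
    and line: "on_line w' (support_face Q u)"
  obtains u' where "u' \<bullet> w' = 0" "u' \<bullet> w \<noteq> 0" "support_face Q u' = support_face Q u"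
proof (cases "u \<bullet> w = 0")
  case False then show thesis using that u by blast
next
  case True
  define z where "z = w - ((w \<bullet> w') / (w' \<bullet> w')) *\<^sub>R w'"
  have zw': "z \<bullet> w' = 0" using w(1) by (simp add: z_def inner_diff_left)
  have "z \<noteq> 0" using w(2) by (simp add: z_def)
  have "z \<bullet> w = z \<bullet> z" using zw' by (simp add: z_def inner_diff_right)
  then have zw: "z \<bullet> w \<noteq> 0" using \<open>z \<noteq> 0\<close> by simp
  obtain V where V: "finite V" "Q = convex hull V" using Q(1) unfolding polytope_def by blast
  have "compact Q" using Q(1) by (rule polytope_imp_compact)
  obtain y where y: "y \<in> support_face Q u" using support_face_exists[OF \<open>compact Q\<close> Q(2)] by blast
  have zc: "z \<bullet> x = z \<bullet> y" if xQ: "x \<in> support_face Q u" for x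
  proof -
    obtain t where "x = y + t *\<^sub>R w'" using line y xQ unfolding on_line_def by blast
    then show ?thesis using zw' by (simp add: inner_add_right)
  qed
  have "\<forall>\<^sub>F e in at_right (0::real). \<forall>v\<in>V - support_face Q u. u \<bullet> v + e * (z \<bullet> v) < u \<bullet> y + e * (z \<bullet> y)"
  proof (rule eventually_ball_finite)
    show "finite (V - support_face Q u)" using V(1) by simp
    show "\<forall>v\<in>V - support_face Q u. \<forall>\<^sub>F e in at_right 0. u \<bullet> v + e * (z \<bullet> v) < u \<bullet> y + e * (z \<bullet> y)"
    proof
      fix v assume v: "v \<in> V - support_face Q u"
      then have "v \<in> Q" using V hull_inc by auto
      then have "u \<bullet> v \<le> u \<bullet> y" "u \<bullet> v \<noteq> u \<bullet> y"
        using y v support_face_eq[OF y] unfolding support_face_def by auto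
      then have lt: "u \<bullet> v - u \<bullet> y < 0" by simp
      have "((\<lambda>e. (u \<bullet> v - u \<bullet> y) + e * (z \<bullet> v - z \<bullet> y)) \<longlongrightarrow> (u \<bullet> v - u \<bullet> y) + 0 * (z \<bullet> v - z \<bullet> y)) (at_right 0)"
        by (intro tendsto_intros)
      then have "\<forall>\<^sub>F e in at_right 0. (u \<bullet> v - u \<bullet> y) + e * (z \<bullet> v - z \<bullet> y) < 0"
        using lt by (intro order_tendstoD) auto
      then show "\<forall>\<^sub>F e in at_right 0. u \<bullet> v + e * (z \<bullet> v) < u \<bullet> y + e * (z \<bullet> y)"
        by (rule eventually_mono) (simp add: algebra_simps)
    qed
  qed
  moreover have "\<forall>\<^sub>F e in at_right (0::real). e > 0" by (simp add: eventually_at_right_less)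
  ultimately have "\<forall>\<^sub>F e in at_right (0::real). e > 0 \<and> (\<forall>v\<in>V - support_face Q u. u \<bullet> v + e * (z \<bullet> v) < u \<bullet> y + e * (z \<bullet> y))"
    by eventually_elim auto
  then obtain e where e: "e > 0" "\<And>v. v \<in> V \<Longrightarrow> v \<notin> support_face Q u \<Longrightarrow> u \<bullet> v + e * (z \<bullet> v) < u \<bullet> y + e * (z \<bullet> y)"
    using eventually_happens'[OF trivial_limit_at_right_real] by blast
  define u' where "u' = u + e *\<^sub>R z"
  have u'x: "u' \<bullet> x = u \<bullet> x + e * (z \<bullet> x)" for x by (simp add: u'_def inner_add_left)
  have on: "u' \<bullet> x = u' \<bullet> y" if "x \<in> support_face Q u" for x
    using zc[OF that] that support_face_eq[OF y] unfolding u'x by auto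
  have leV: "u' \<bullet> v \<le> u' \<bullet> y" if "v \<in> V" for v
    using on e(2)[OF that] unfolding u'x by (cases "v \<in> support_face Q u") auto
  have "Q \<subseteq> {x. u' \<bullet> x \<le> u' \<bullet> y}"
    unfolding V(2) by (rule hull_minimal) (use leV in \<open>auto intro: convex_halfspace_le\<close>)
  then have sub: "support_face Q u \<subseteq> support_face Q u'" using on unfolding support_face_def by auto
  have "support_face Q u' \<subseteq> support_face Q u"
  proof -
    obtain s where s: "s \<subseteq> V" "support_face Q u' = convex hull s" by (rule support_face_of_polytope[OF V])
    have yu': "y \<in> support_face Q u'" using sub y by blast
    have "v \<in> support_face Q u" if v: "v \<in> s" for v
    proof (rule ccontr)
      assume n: "v \<notin> support_face Q u"
      have "v \<in> support_face Q u'" using s(2) v hull_inc by auto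
      then have "u' \<bullet> v = u' \<bullet> y" using support_face_eq[OF yu'] by auto
      then show False using e(2)[of v] n s(1) v unfolding u'x by auto
    qed
    moreover have "convex (support_face Q u)"
      using support_face_face_of face_of_imp_convex polytope_imp_convex[OF Q(1)] by blast
    ultimately show ?thesis unfolding s(2) by (intro hull_minimal) auto
  qed
  with sub have "support_face Q u' = support_face Q u" by auto
  moreover have "u' \<bullet> w' = 0" using u zw' unfolding u'x by simp
  moreover have "u' \<bullet> w \<noteq> 0" using True zw e(1) unfolding u'x by simp
  ultimately show thesis by (rule that[rotated -1])
qed

definition summand :: "real^3 \<Rightarrow> (real^3) set \<Rightarrow> (real^3) set" where
  "summand w P = {q \<in> P. q + w \<in> P}"

lemma polytope_summand: assumes "polytope P" shows "polytope (summand w P)"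
proof -
  have eq: "summand w P = P \<inter> (+) (- w) ` P"
  proof
    show "summand w P \<subseteq> P \<inter> (+) (- w) ` P"
    proof
      fix q assume "q \<in> summand w P"
      then have "q \<in> P" "q + w \<in> P" by (auto simp: summand_def)
      moreover have "q = - w + (q + w)" by simp
      ultimately show "q \<in> P \<inter> (+) (- w) ` P" by blast
    qed
    show "P \<inter> (+) (- w) ` P \<subseteq> summand w P" by (auto simp: summand_def)
  qed
  have "polytope ((+) (- w) ` P)" by (rule iffD2[OF polytope_translation_eq assms])
  then show ?thesis unfolding eq by (rule polytope_Int[OF assms])
qed

lemma support_face_minkowski_segment:
  assumes P: "P = {t *\<^sub>R w + q | t q. 0 \<le> t \<and> t \<le> 1 \<and> q \<in> Q}"
  shows "u \<bullet> w > 0 \<Longrightarrow> support_face P u = (+) w ` support_face Q u"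
    and "u \<bullet> w < 0 \<Longrightarrow> support_face P u = support_face Q u"
    and "u \<bullet> w = 0 \<Longrightarrow> support_face P u = {t *\<^sub>R w + q | t q. 0 \<le> t \<and> t \<le> 1 \<and> q \<in> support_face Q u}"
proof -
  have inP: "t *\<^sub>R w + q \<in> P" if "0 \<le> t" "t \<le> 1" "q \<in> Q" for t q using that unfolding P by blast
  have val: "u \<bullet> (t *\<^sub>R w + q) = t * (u \<bullet> w) + u \<bullet> q" for t q by (simp add: inner_add_right)
  {
    assume pos: "u \<bullet> w > 0"
    show "support_face P u = (+) w ` support_face Q u"
    proof
      show "support_face P u \<subseteq> (+) w ` support_face Q u"
      proof
        fix x assume x: "x \<in> support_face P u"
        then obtain t q where tq: "x = t *\<^sub>R w + q" "0 \<le> t" "t \<le> 1" "q \<in> Q" unfolding support_face_def P by blast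
        have ge: "t' * (u \<bullet> w) + u \<bullet> q' \<le> t * (u \<bullet> w) + u \<bullet> q" if "0 \<le> t'" "t' \<le> 1" "q' \<in> Q" for t' q'
          using x inP[OF that] unfolding support_face_def tq(1) val[symmetric] by blast
        have "1 \<le> t" using ge[of 1 q] tq pos by simp
        then have "t = 1" using tq by simp
        moreover have "q \<in> support_face Q u" using ge[OF tq(2,3)] tq(4) unfolding support_face_def by simp
        ultimately show "x \<in> (+) w ` support_face Q u" using tq(1) by simp
      qed
      show "(+) w ` support_face Q u \<subseteq> support_face P u"
      proof
        fix x assume "x \<in> (+) w ` support_face Q u"
        then obtain q where q: "x = w + q" "q \<in> support_face Q u" by blast
        have "x \<in> P" using inP[of 1 q] q by (simp add: support_face_def)
        moreover have "u \<bullet> y \<le> u \<bullet> x" if y: "y \<in> P" for y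
        proof -
          obtain t q' where tq: "y = t *\<^sub>R w + q'" "0 \<le> t" "t \<le> 1" "q' \<in> Q" using y unfolding P by blast
          have "t * (u \<bullet> w) \<le> 1 * (u \<bullet> w)" using tq pos by (intro mult_right_mono) auto
          moreover have "u \<bullet> q' \<le> u \<bullet> q" using q tq unfolding support_face_def by blast
          ultimately show ?thesis unfolding tq(1) q(1) by (simp add: inner_add_right)
        qed
        ultimately show "x \<in> support_face P u" unfolding support_face_def by blast
      qed
    qed
  }
  {
    assume neg: "u \<bullet> w < 0"
    show "support_face P u = support_face Q u"
    proof
      show "support_face P u \<subseteq> support_face Q u"
      proof
        fix x assume x: "x \<in> support_face P u"
        then obtain t q where tq: "x = t *\<^sub>R w + q" "0 \<le> t" "t \<le> 1" "q \<in> Q" unfolding support_face_def P by blast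
        have ge: "t' * (u \<bullet> w) + u \<bullet> q' \<le> t * (u \<bullet> w) + u \<bullet> q" if "0 \<le> t'" "t' \<le> 1" "q' \<in> Q" for t' q'
          using x inP[OF that] unfolding support_face_def tq(1) val[symmetric] by blast
        have "0 \<le> t * (u \<bullet> w)" using ge[of 0 q] tq by simp
        then have "t = 0" using tq(2) neg by (simp add: zero_le_mult_iff)
        moreover have "q \<in> support_face Q u" using ge[OF tq(2,3)] tq(4) unfolding support_face_def by simp
        ultimately show "x \<in> support_face Q u" using tq(1) by simp
      qed
      show "support_face Q u \<subseteq> support_face P u"
      proof
        fix x assume q: "x \<in> support_face Q u"
        have "x \<in> P" using inP[of 0 x] q by (simp add: support_face_def)
        moreover have "u \<bullet> y \<le> u \<bullet> x" if y: "y \<in> P" for y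
        proof -
          obtain t q' where tq: "y = t *\<^sub>R w + q'" "0 \<le> t" "t \<le> 1" "q' \<in> Q" using y unfolding P by blast
          have "t * (u \<bullet> w) \<le> 0" using tq neg by (simp add: mult_le_0_iff)
          moreover have "u \<bullet> q' \<le> u \<bullet> x" using q tq unfolding support_face_def by blast
          ultimately show ?thesis unfolding tq(1) by (simp add: inner_add_right)
        qed
        ultimately show "x \<in> support_face P u" unfolding support_face_def by blast
      qed
    qed
  }
  {
    assume zero: "u \<bullet> w = 0"
    have valP: "u \<bullet> (t *\<^sub>R w + q) = u \<bullet> q" for t q using zero by (simp add: inner_add_right)
    show "support_face P u = {t *\<^sub>R w + q | t q. 0 \<le> t \<and> t \<le> 1 \<and> q \<in> support_face Q u}"
    proof
      show "support_face P u \<subseteq> {t *\<^sub>R w + q | t q. 0 \<le> t \<and> t \<le> 1 \<and> q \<in> support_face Q u}"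
      proof
        fix x assume x: "x \<in> support_face P u"
        then obtain t q where tq: "x = t *\<^sub>R w + q" "0 \<le> t" "t \<le> 1" "q \<in> Q" unfolding support_face_def P by blast
        have "u \<bullet> q' \<le> u \<bullet> q" if "q' \<in> Q" for q'
          using x inP[of 0 q'] that valP[of t q] unfolding support_face_def tq(1) by auto
        then have "q \<in> support_face Q u" using tq(4) unfolding support_face_def by blast
        then show "x \<in> {t *\<^sub>R w + q | t q. 0 \<le> t \<and> t \<le> 1 \<and> q \<in> support_face Q u}" using tq by blast
      qed
      show "{t *\<^sub>R w + q | t q. 0 \<le> t \<and> t \<le> 1 \<and> q \<in> support_face Q u} \<subseteq> support_face P u"
      proof
        fix x assume "x \<in> {t *\<^sub>R w + q | t q. 0 \<le> t \<and> t \<le> 1 \<and> q \<in> support_face Q u}"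
        then obtain t q where tq: "x = t *\<^sub>R w + q" "0 \<le> t" "t \<le> 1" "q \<in> support_face Q u" by blast
        have "x \<in> P" using inP tq by (simp add: support_face_def)
        moreover have "u \<bullet> y \<le> u \<bullet> x" if y: "y \<in> P" for y
        proof -
          obtain t q' where "y = t *\<^sub>R w + q'" "q' \<in> Q" using y unfolding P by blast
          then show ?thesis using tq(1,4) valP unfolding support_face_def by simp
        qed
        ultimately show "x \<in> support_face P u" unfolding support_face_def by blast
      qed
    qed
  }
qed

text \<open>
  Project \<open>P\<close> along \<open>w\<close>. Over each vertex of the image lies a face parallel to \<open>w\<close>; by hypothesis it
  contains a segment with difference \<open>w\<close>, so the vertex is in the image of the summand. By convexity the two images agree, that is,
  every line parallel to \<open>w\<close> that meets \<open>P\<close> does so in a segment at least as long as \<open>w\<close>.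
\<close>

lemma split_off_edge:
  fixes P :: "(real^3) set"
  assumes P: "polytope P" "P \<noteq> {}" and eq: "equal_edges P" and w: "w \<in> edge_vectors P"
  shows "P = {t *\<^sub>R w + q | t q. 0 \<le> t \<and> t \<le> 1 \<and> q \<in> summand w P}" and "summand w P \<noteq> {}"
proof -
  obtain u0 y0 where w0: "w \<noteq> 0" and u0: "u0 \<bullet> w = 0" and F0: "support_face P u0 = closed_segment y0 (y0 + w)"
    using w unfolding edge_vectors_def by blast
  have conv: "convex P" using P(1) by (rule polytope_imp_convex)
  define pr where "pr = (\<lambda>x. x - ((w \<bullet> x) / (w \<bullet> w)) *\<^sub>R w)"
  have lin: "linear pr" by (rule linearI) (simp_all add: pr_def inner_add_right add_divide_distrib algebra_simps)
  have adj: "a \<bullet> pr x = pr a \<bullet> x" for a x by (simp add: pr_def inner_diff_left inner_diff_right inner_commute)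
  have prw: "pr w = 0" using w0 by (simp add: pr_def)
  have pr_eq: "\<exists>t. x = y + t *\<^sub>R w" if "pr x = pr y" for x y
  proof -
    have "x = y + ((w \<bullet> x) / (w \<bullet> w) - (w \<bullet> y) / (w \<bullet> w)) *\<^sub>R w"
      using that by (simp add: pr_def algebra_simps)
    then show ?thesis by blast
  qed
  have polyR: "polytope (pr ` P)" using lin P(1) by (rule polytope_linear_image)
  \<comment> \<open>A vertex of the image is exposed, so the points of \<open>P\<close> over it form a
    face.\<close>
  have ext: "v \<in> pr ` summand w P" if v: "v extreme_point_of (pr ` P)" for v
  proof -
    have "{v} exposed_face_of (pr ` P)"
      using v exposed_face_of_polyhedron[OF polytope_imp_polyhedron[OF polyR]] by (simp add: face_of_singleton)
    then obtain a b where ab: "pr ` P \<subseteq> {x. a \<bullet> x \<le> b}" "{v} = pr ` P \<inter> {x. a \<bullet> x = b}" unfolding exposed_face_of_def by blast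
    define u where "u = pr a"
    have uw: "u \<bullet> w = 0" unfolding u_def adj[symmetric] prw by simp
    have v': "v \<in> pr ` P" "a \<bullet> v = b" using ab(2) by blast+
    have le: "u \<bullet> x \<le> b" if "x \<in> P" for x using ab(1) that unfolding u_def adj[symmetric] by blast
    have pv: "pr x = v" if x: "x \<in> support_face P u" for x
    proof -
      obtain z where z: "z \<in> P" "pr z = v" using v'(1) by blast
      have "u \<bullet> z = b" unfolding u_def adj[symmetric] z(2) by (rule v'(2))
      then have "b \<le> u \<bullet> x" using x z(1) unfolding support_face_def by auto
      then have "u \<bullet> x = b" using le x unfolding support_face_def by (auto intro: antisym)
      then have "pr x \<in> pr ` P \<inter> {x. a \<bullet> x = b}" using x unfolding support_face_def u_def adj[symmetric] by blast
      then show ?thesis using ab(2) by blast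
    qed
    have line: "on_line w (support_face P u)" unfolding on_line_def using pv pr_eq by metis
    have "on_line w (support_face P u0)" unfolding F0 by (rule on_line_segment)
    moreover have "y0 \<in> support_face P u0" "y0 + 1 *\<^sub>R w \<in> support_face P u0" unfolding F0 by simp_all
    ultimately obtain y where y: "y \<in> support_face P u" "y + 1 *\<^sub>R w \<in> support_face P u"
      using eq w0 u0 uw line unfolding equal_edges_def by blast
    then have "y \<in> summand w P" unfolding summand_def support_face_def by simp
    then show ?thesis using pv[OF y(1)] by blast
  qed
  have "compact (pr ` P)" "convex (pr ` P)" using polyR polytope_imp_compact polytope_imp_convex by auto
  then have "pr ` P = convex hull {x. x extreme_point_of (pr ` P)}" by (rule Krein_Milman_Minkowski)
  also have "\<dots> \<subseteq> pr ` summand w P"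
  proof (rule hull_minimal)
    show "convex (pr ` summand w P)"
      using polytope_imp_convex[OF polytope_summand[OF P(1)]] lin by (rule convex_linear_image[rotated])
  qed (use ext in blast)
  finally have sub: "pr ` P \<subseteq> pr ` summand w P" .
  then show "summand w P \<noteq> {}" using P(2) by blast
  have seg: "z + r *\<^sub>R w \<in> P" if "z \<in> P" "z + s *\<^sub>R w \<in> P" "0 \<le> r" "r \<le> s" for z r s
  proof (cases "s = 0")
    case True then show ?thesis using that by simp
  next
    case False
    then have "(1 - r / s) *\<^sub>R z + (r / s) *\<^sub>R (z + s *\<^sub>R w) \<in> P"
      using convexD[OF conv that(1,2), of "1 - r / s" "r / s"] that by simp
    moreover have "(1 - r / s) *\<^sub>R z + (r / s) *\<^sub>R (z + s *\<^sub>R w) = z + r *\<^sub>R w" using False by (simp add: algebra_simps)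
    ultimately show ?thesis by simp
  qed
  show "P = {t *\<^sub>R w + q | t q. 0 \<le> t \<and> t \<le> 1 \<and> q \<in> summand w P}"
  proof
    show "{t *\<^sub>R w + q | t q. 0 \<le> t \<and> t \<le> 1 \<and> q \<in> summand w P} \<subseteq> P"
    proof
      fix x assume "x \<in> {t *\<^sub>R w + q | t q. 0 \<le> t \<and> t \<le> 1 \<and> q \<in> summand w P}"
      then obtain t q where "x = t *\<^sub>R w + q" "0 \<le> t" "t \<le> 1" "q \<in> P" "q + 1 *\<^sub>R w \<in> P" unfolding summand_def by auto
      then show "x \<in> P" using seg[of q 1 t] by (simp add: add.commute)
    qed
    show "P \<subseteq> {t *\<^sub>R w + q | t q. 0 \<le> t \<and> t \<le> 1 \<and> q \<in> summand w P}"
    proof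
      fix x assume x: "x \<in> P"
      then obtain q where q: "q \<in> summand w P" "pr x = pr q" using sub by (metis image_iff subsetD)
      obtain s where s: "x = q + s *\<^sub>R w" using pr_eq[OF q(2)] by blast
      have qP: "q \<in> P" "q + w \<in> P" using q(1) by (auto simp: summand_def)
      \<comment> \<open>Slide \<open>q\<close> along \<open>w\<close> until \<open>x\<close> lies between
        \<open>q\<close> and \<open>q + w\<close>.\<close>
      consider "0 \<le> s \<and> s \<le> 1" | "s > 1" | "s < 0" by linarith
      then show "x \<in> {t *\<^sub>R w + q | t q. 0 \<le> t \<and> t \<le> 1 \<and> q \<in> summand w P}"
      proof cases
        case 1
        have "x = s *\<^sub>R w + q" using s by (simp add: add.commute)
        then show ?thesis using 1 q(1) by blast
      next
        case 2
        have "q + (s - 1) *\<^sub>R w \<in> P" using seg[of q s "s - 1"] qP x s 2 by simp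
        moreover have "q + (s - 1) *\<^sub>R w + w = x" using s by (simp add: algebra_simps)
        ultimately have "q + (s - 1) *\<^sub>R w \<in> summand w P" using x by (simp add: summand_def)
        moreover have "x = 1 *\<^sub>R w + (q + (s - 1) *\<^sub>R w)" using s by (simp add: algebra_simps)
        ultimately show ?thesis by (intro CollectI exI[of _ "1::real"] exI[of _ "q + (s - 1) *\<^sub>R w"]) auto
      next
        case 3
        have "x + (1 - s) *\<^sub>R w = q + w" using s by (simp add: algebra_simps)
        then have "x + 1 *\<^sub>R w \<in> P" using seg[of x "1 - s" 1] x qP 3 by simp
        then have "x \<in> summand w P" using x by (simp add: summand_def)
        moreover have "x = 0 *\<^sub>R w + x" by simp
        ultimately show ?thesis by (intro CollectI exI[of _ "0::real"] exI[of _ x]) auto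
      qed
    qed
  qed
qed

text \<open>
  An edge of the summand parallel to \<open>w\<close> would give an edge of \<open>P\<close> longer than \<open>w\<close>.
\<close>

lemma summand_has_no_edge:
  assumes P: "P = {t *\<^sub>R w + q | t q. 0 \<le> t \<and> t \<le> 1 \<and> q \<in> Q}" and eq: "equal_edges P" and w: "w \<in> edge_vectors P"
    and u: "u \<bullet> w' = 0" and line: "on_line w' (support_face Q u)" and w': "w' \<noteq> 0" "w = c *\<^sub>R w'"
    and y: "y \<in> support_face Q u" "y + t *\<^sub>R w' \<in> support_face Q u"
  shows "t = 0"
proof (rule ccontr)
  assume t: "t \<noteq> 0"
  obtain u0 y0 where w0: "w \<noteq> 0" and u0: "u0 \<bullet> w = 0" and F0: "support_face P u0 = closed_segment y0 (y0 + w)"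
    using w unfolding edge_vectors_def by blast
  have c: "c \<noteq> 0" using w0 w'(2) by auto
  have uw: "u \<bullet> w = 0" using u w'(2) by simp
  note face = support_face_minkowski_segment(3)[OF P uw]
  have mem: "s *\<^sub>R w + q \<in> support_face P u" if "0 \<le> s" "s \<le> 1" "q \<in> support_face Q u" for s q
    using that unfolding face by blast
  have lineP: "on_line w (support_face P u)"
    unfolding on_line_def
  proof (intro ballI)
    fix a b assume "a \<in> support_face P u" "b \<in> support_face P u"
    then obtain s q s' q' where ab: "a = s *\<^sub>R w + q" "b = s' *\<^sub>R w + q'" "q \<in> support_face Q u" "q' \<in> support_face Q u"
      unfolding face by blast
    obtain r where "q' = q + r *\<^sub>R w'" using line ab unfolding on_line_def by blast
    then have "b = a + (s' - s + r / c) *\<^sub>R w" using ab c w'(2) by (simp add: algebra_simps)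
    then show "\<exists>t. b = a + t *\<^sub>R w" ..
  qed
  have line0: "on_line w (support_face P u0)" unfolding F0 by (rule on_line_segment)
  have tw: "t *\<^sub>R w' = (t / c) *\<^sub>R w" using c w'(2) by simp
  \<comment> \<open>The face of \<open>P\<close> is the edge of the summand prolonged by \<open>w\<close>.\<close>
  have "\<exists>z r. \<bar>r\<bar> > 1 \<and> z \<in> support_face P u \<and> z + r *\<^sub>R w \<in> support_face P u"
  proof (cases "t / c > 0")
    case True
    have "0 *\<^sub>R w + y \<in> support_face P u" "1 *\<^sub>R w + (y + t *\<^sub>R w') \<in> support_face P u"
      by (rule mem; use y in simp)+
    then have "y \<in> support_face P u" "y + (1 + t / c) *\<^sub>R w \<in> support_face P u" unfolding tw by (simp_all add: algebra_simps)
    then show ?thesis using True by (intro exI[of _ y] exI[of _ "1 + t / c"]) simp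
  next
    case False
    then have n: "t / c < 0" using t c by (simp add: less_le)
    have "1 *\<^sub>R w + y \<in> support_face P u" "0 *\<^sub>R w + (y + t *\<^sub>R w') \<in> support_face P u"
      by (rule mem; use y in simp)+
    then have "y + w \<in> support_face P u" "(y + w) + (t / c - 1) *\<^sub>R w \<in> support_face P u" unfolding tw by (simp_all add: algebra_simps)
    then show ?thesis using n by (intro exI[of _ "y + w"] exI[of _ "t / c - 1"]) simp
  qed
  then obtain z r where r: "\<bar>r\<bar> > 1" "z \<in> support_face P u" "z + r *\<^sub>R w \<in> support_face P u" by blast
  then obtain y' where y': "y' \<in> support_face P u0" "y' + r *\<^sub>R w \<in> support_face P u0"
    using eq w0 u0 uw lineP line0 unfolding equal_edges_def by blast
  obtain s s' where s: "0 \<le> s" "s \<le> 1" "y' = (1 - s) *\<^sub>R y0 + s *\<^sub>R (y0 + w)"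
    and s': "0 \<le> s'" "s' \<le> 1" "y' + r *\<^sub>R w = (1 - s') *\<^sub>R y0 + s' *\<^sub>R (y0 + w)"
    using y' unfolding F0 closed_segment_def by blast
  have "(s + r - s') *\<^sub>R w = 0" using s(3) s'(3) by (simp add: algebra_simps)
  then have "r = s' - s" using w0 by simp
  then show False using s s' r(1) by linarith
qed

text \<open>
  A face of the summand whose normal is not orthogonal to \<open>w\<close> is a translate of a face of \<open>P\<close>, and by
  \<open>perturb_support_face\<close> the normal of an edge that is not parallel to \<open>w\<close> can be chosen in this way.
\<close>

lemma edge_summand_inherits:
  fixes P :: "(real^3) set"
  assumes P: "polytope P" "P \<noteq> {}" and eq: "equal_edges P" and w: "w \<in> edge_vectors P"
  shows "equal_edges (summand w P)" and "edge_vectors (summand w P) \<subseteq> edge_vectors P - {w}"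
proof -
  let ?Q = "summand w P"
  note PQ = split_off_edge(1)[OF P eq w] and Qne = split_off_edge(2)[OF P eq w]
  have Q: "polytope ?Q" by (rule polytope_summand[OF P(1)])
  have shift: "\<exists>v. support_face P u = (+) v ` support_face ?Q u" if nz: "u \<bullet> w \<noteq> 0" for u
  proof (cases "u \<bullet> w > 0")
    case True then show ?thesis using support_face_minkowski_segment(1)[OF PQ] by blast
  next
    case False
    then have "u \<bullet> w < 0" using nz by simp
    then have "support_face P u = (+) 0 ` support_face ?Q u" using support_face_minkowski_segment(2)[OF PQ] by simp
    then show ?thesis by blast
  qed
  have reduce: "\<exists>u' v. u' \<bullet> w' = 0 \<and> support_face P u' = (+) v ` support_face ?Q u"
    if u: "u \<bullet> w' = 0" and line: "on_line w' (support_face ?Q u)" and w': "w' \<noteq> 0" "\<And>c. w \<noteq> c *\<^sub>R w'" for u w'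
  proof -
    obtain u' where u': "u' \<bullet> w' = 0" "u' \<bullet> w \<noteq> 0" "support_face ?Q u' = support_face ?Q u"
      using perturb_support_face[OF Q Qne w' u line] by blast
    then show ?thesis using shift[OF u'(2)] by metis
  qed
  have line_shift: "on_line w' ((+) v ` S)" if "on_line w' S" for w' v S
    using that unfolding on_line_def by (auto simp: add.assoc)
  show "equal_edges ?Q"
    unfolding equal_edges_def
  proof (intro allI impI)
    fix w' u u' y t
    assume w': "w' \<noteq> 0" and u: "u \<bullet> w' = 0" and u': "u' \<bullet> w' = 0"
      and line: "on_line w' (support_face ?Q u)" and line': "on_line w' (support_face ?Q u')"
      and y: "y \<in> support_face ?Q u" "y + t *\<^sub>R w' \<in> support_face ?Q u"
    show "\<exists>y'. y' \<in> support_face ?Q u' \<and> y' + t *\<^sub>R w' \<in> support_face ?Q u'"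
    proof (cases "\<exists>c. w = c *\<^sub>R w'")
      case True
      then obtain c where "w = c *\<^sub>R w'" by blast
      from summand_has_no_edge[OF PQ eq w u line w' this y] have "t = 0" .
      then show ?thesis using support_face_exists[OF polytope_imp_compact[OF Q] Qne, of u'] by auto
    next
      case False
      then have np: "\<And>c. w \<noteq> c *\<^sub>R w'" by blast
      obtain a v where a: "a \<bullet> w' = 0" "support_face P a = (+) v ` support_face ?Q u" using reduce[OF u line w' np] by blast
      obtain b v' where b: "b \<bullet> w' = 0" "support_face P b = (+) v' ` support_face ?Q u'" using reduce[OF u' line' w' np] by blast
      have "v + y \<in> support_face P a" "(v + y) + t *\<^sub>R w' \<in> support_face P a" using y unfolding a(2) by (auto simp: add.assoc)
      moreover have "on_line w' (support_face P a)" "on_line w' (support_face P b)"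
        unfolding a(2) b(2) using line line' line_shift by blast+
      ultimately obtain z where z: "z \<in> support_face P b" "z + t *\<^sub>R w' \<in> support_face P b"
        using eq w' a(1) b(1) unfolding equal_edges_def by blast
      then obtain z1 z2 where zz: "z = v' + z1" "z + t *\<^sub>R w' = v' + z2" "z1 \<in> support_face ?Q u'" "z2 \<in> support_face ?Q u'"
        unfolding b(2) by blast
      have "z2 = z1 + t *\<^sub>R w'" using zz(1,2) by (simp add: add.assoc)
      then show ?thesis using zz(3,4) by blast
    qed
  qed
  show "edge_vectors ?Q \<subseteq> edge_vectors P - {w}"
  proof
    fix w' assume "w' \<in> edge_vectors ?Q"
    then obtain u y where w': "w' \<noteq> 0" and u: "u \<bullet> w' = 0" and F: "support_face ?Q u = closed_segment y (y + w')"
      unfolding edge_vectors_def by blast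
    have line: "on_line w' (support_face ?Q u)" unfolding F by (rule on_line_segment)
    have ye: "y \<in> support_face ?Q u" "y + 1 *\<^sub>R w' \<in> support_face ?Q u" unfolding F by simp_all
    have np: "\<And>c. w \<noteq> c *\<^sub>R w'"
    proof
      fix c assume "w = c *\<^sub>R w'"
      from summand_has_no_edge[OF PQ eq w u line w' this ye] show False by simp
    qed
    obtain a v where a: "a \<bullet> w' = 0" "support_face P a = (+) v ` support_face ?Q u" using reduce[OF u line w' np] by blast
    have "support_face P a = closed_segment (v + y) ((v + y) + w')"
      unfolding a(2) F by (simp add: closed_segment_translation add.assoc)
    then have "w' \<in> edge_vectors P" using w' a(1) unfolding edge_vectors_def by blast
    moreover have "w' \<noteq> w" using np[of 1] by auto
    ultimately show "w' \<in> edge_vectors P - {w}" by simp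
  qed
qed

text \<open>
  Splitting off an edge removes its vector from the finite set of edge vectors.
\<close>

theorem zonotope_if_equal_edges:
  fixes P :: "(real^3) set"
  assumes "polytope P" "P \<noteq> {}" "equal_edges P"
  shows "\<exists>c ws. P = (+) c ` zonotope ws \<and> set ws \<subseteq> edge_vectors P"
  using assms
proof (induction "card (edge_vectors P)" arbitrary: P rule: less_induct)
  case less
  show ?case
  proof (cases "edge_vectors P = {}")
    case True
    then obtain c where "P = {c}" using edge_vector_exists less by blast
    then have "P = (+) c ` zonotope []" by simp
    then show ?thesis using True by (metis empty_subsetI list.set(1))
  next
    case False
    then obtain w where w: "w \<in> edge_vectors P" by blast
    let ?Q = "summand w P"
    note PQ = split_off_edge(1)[OF less(2-4) w] and Qne = split_off_edge(2)[OF less(2-4) w]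
    note inh = edge_summand_inherits[OF less(2-4) w]
    have "card (edge_vectors ?Q) < card (edge_vectors P)"
      using inh(2) w finite_edge_vectors[OF less(2)] by (intro psubset_card_mono) auto
    then obtain c ws where cws: "?Q = (+) c ` zonotope ws" "set ws \<subseteq> edge_vectors ?Q"
      using less(1)[of ?Q] polytope_summand[OF less(2)] Qne inh(1) by blast
    have "P = (+) c ` zonotope (w # ws)"
    proof
      show "P \<subseteq> (+) c ` zonotope (w # ws)"
      proof
        fix x assume "x \<in> P"
        then obtain t q where tq: "x = t *\<^sub>R w + q" "0 \<le> t" "t \<le> 1" "q \<in> ?Q" using PQ by blast
        then obtain z where z: "q = c + z" "z \<in> zonotope ws" using cws(1) by blast
        have "t *\<^sub>R w + z \<in> zonotope (w # ws)" using tq z by auto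
        moreover have "x = c + (t *\<^sub>R w + z)" using tq(1) z(1) by (simp add: algebra_simps)
        ultimately show "x \<in> (+) c ` zonotope (w # ws)" by blast
      qed
      show "(+) c ` zonotope (w # ws) \<subseteq> P"
      proof
        fix x assume "x \<in> (+) c ` zonotope (w # ws)"
        then obtain t z where tz: "x = c + (t *\<^sub>R w + z)" "0 \<le> t" "t \<le> 1" "z \<in> zonotope ws" by auto
        have "c + z \<in> ?Q" using cws(1) tz(4) by blast
        moreover have "x = t *\<^sub>R w + (c + z)" using tz(1) by (simp add: algebra_simps)
        ultimately show "x \<in> P" using PQ tz(2,3) by blast
      qed
    qed
    moreover have "set (w # ws) \<subseteq> edge_vectors P" using cws(2) inh(2) w by auto
    ultimately show ?thesis by blast
  qed
qed

section \<open>Directions lying in few planes\<close>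

text \<open>
  Among any four elements of \<open>S\<close>, some two lie in a plane with the given fifth: the elements of \<open>S\<close> are
  contained in at most three planes through each of its members.
\<close>

definition few_planes :: "(real^3) set \<Rightarrow> bool" where
  "few_planes S \<longleftrightarrow> (\<forall>w\<in>S. \<forall>a\<in>S. \<forall>b\<in>S. \<forall>c\<in>S. \<forall>d\<in>S.
     det3 w a b = 0 \<or> det3 w a c = 0 \<or> det3 w a d = 0 \<or> det3 w b c = 0 \<or> det3 w b d = 0 \<or> det3 w c d = 0)"

text \<open>
  The name refers to the complete graph on four vertices \<open>0, a, b, c\<close>, whose edges are the six differences.
\<close>

definition K4_directions :: "(real^3) set \<Rightarrow> bool" where
  "K4_directions S \<longleftrightarrow> (\<exists>a b c. det3 a b c \<noteq> 0 \<and>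
     (\<forall>w\<in>S. \<exists>v\<in>{a, b, c, a - b, b - c, a - c}. \<exists>k. w = k *\<^sub>R v))"

definition comb :: "real^3 \<Rightarrow> real^3 \<Rightarrow> real^3 \<Rightarrow> real \<Rightarrow> real \<Rightarrow> real \<Rightarrow> real^3" where
  "comb e1 e2 e3 x y z = x *\<^sub>R e1 + y *\<^sub>R e2 + z *\<^sub>R e3"

lemma det3_comb:
  "det3 (comb e1 e2 e3 x1 x2 x3) (comb e1 e2 e3 y1 y2 y3) (comb e1 e2 e3 z1 z2 z3)
   = det3 e1 e2 e3 * (x1 * (y2 * z3 - y3 * z2) - x2 * (y1 * z3 - y3 * z1) + x3 * (y1 * z2 - y2 * z1))"
  by (simp add: det3_expand comb_def) algebra

lemma few_planes_comb:
  assumes "few_planes S" "det3 e1 e2 e3 \<noteq> 0"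
    and "comb e1 e2 e3 w1 w2 w3 \<in> S" "comb e1 e2 e3 a1 a2 a3 \<in> S" "comb e1 e2 e3 b1 b2 b3 \<in> S"
      "comb e1 e2 e3 c1 c2 c3 \<in> S" "comb e1 e2 e3 d1 d2 d3 \<in> S"
  defines "D \<equiv> \<lambda>y1 y2 y3 z1 z2 z3. w1 * (y2 * z3 - y3 * z2) - w2 * (y1 * z3 - y3 * z1) + w3 * (y1 * z2 - y2 * z1)"
  shows "D a1 a2 a3 b1 b2 b3 = 0 \<or> D a1 a2 a3 c1 c2 c3 = 0 \<or> D a1 a2 a3 d1 d2 d3 = 0 \<or>
    D b1 b2 b3 c1 c2 c3 = 0 \<or> D b1 b2 b3 d1 d2 d3 = 0 \<or> D c1 c2 c3 d1 d2 d3 = 0"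
  using assms(1)[unfolded few_planes_def, rule_format, OF assms(3-7)] assms(2)
  unfolding det3_comb D_def by simp

text \<open>
  Closing \<open>S\<close> under scaling makes it a set of directions; coordinates can then be normalised freely.
\<close>

locale few_plane_directions =
  fixes S :: "(real^3) set"
  assumes few: "few_planes S" and scale: "w \<in> S \<Longrightarrow> k \<noteq> 0 \<Longrightarrow> k *\<^sub>R w \<in> S"
begin

text \<open>
  Through \<open>e1\<close> pass the planes spanned with \<open>e2\<close> and with \<open>e3\<close>, so all directions outside these two lie
  in one further plane.
\<close>

lemma coordinate_ratio:
  assumes D: "det3 e1 e2 e3 \<noteq> 0" and e: "e1 \<in> S" "e2 \<in> S" "e3 \<in> S"
    and x: "comb e1 e2 e3 x1 x2 x3 \<in> S" and y: "comb e1 e2 e3 y1 y2 y3 \<in> S"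
  shows "x2 = 0 \<or> x3 = 0 \<or> y2 = 0 \<or> y3 = 0 \<or> x2 * y3 = x3 * y2"
    and "x1 = 0 \<or> x3 = 0 \<or> y1 = 0 \<or> y3 = 0 \<or> x1 * y3 = x3 * y1"
    and "x1 = 0 \<or> x2 = 0 \<or> y1 = 0 \<or> y2 = 0 \<or> x1 * y2 = x2 * y1"
proof -
  have c: "comb e1 e2 e3 1 0 0 \<in> S" "comb e1 e2 e3 0 1 0 \<in> S" "comb e1 e2 e3 0 0 1 \<in> S"
    using e by (simp_all add: comb_def)
  show "x2 = 0 \<or> x3 = 0 \<or> y2 = 0 \<or> y3 = 0 \<or> x2 * y3 = x3 * y2"
    using few_planes_comb[OF few D c(1) c(2) c(3) x y] by auto
  show "x1 = 0 \<or> x3 = 0 \<or> y1 = 0 \<or> y3 = 0 \<or> x1 * y3 = x3 * y1"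
    using few_planes_comb[OF few D c(2) c(1) c(3) x y] by auto
  show "x1 = 0 \<or> x2 = 0 \<or> y1 = 0 \<or> y2 = 0 \<or> x1 * y2 = x2 * y1"
    using few_planes_comb[OF few D c(3) c(1) c(2) x y] by auto
qed

text \<open>
  The four vertices may be taken along the path \<open>0, e1, e1 + e2, e1 + e2 + e3\<close>.
\<close>

lemma K4_path:
  assumes D: "det3 e1 e2 e3 \<noteq> 0"
    and cover: "\<And>w. w \<in> S \<Longrightarrow> \<exists>v\<in>{e1, e2, e3, e1 + e2, e2 + e3, e1 + e2 + e3}. \<exists>k. w = k *\<^sub>R v"
  shows "K4_directions S"
proof -
  let ?a = "e1" and ?b = "e1 + e2" and ?c = "e1 + e2 + e3"
  have "det3 ?a ?b ?c = det3 e1 e2 e3" by (simp add: det3_expand algebra_simps)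
  then have "det3 ?a ?b ?c \<noteq> 0" using D by simp
  moreover have "\<exists>v\<in>{?a, ?b, ?c, ?a - ?b, ?b - ?c, ?a - ?c}. \<exists>k. w = k *\<^sub>R v" if wS: "w \<in> S" for w
  proof -
    obtain v k where vk: "v \<in> {e1, e2, e3, e1 + e2, e2 + e3, e1 + e2 + e3}" "w = k *\<^sub>R v" using cover[OF wS] by blast
    then consider "w = k *\<^sub>R ?a" | "w = k *\<^sub>R ?b" | "w = k *\<^sub>R ?c" | "w = (-k) *\<^sub>R (?a - ?b)" | "w = (-k) *\<^sub>R (?b - ?c)"
      | "w = (-k) *\<^sub>R (?a - ?c)" by (auto simp: algebra_simps)
    then show ?thesis by cases blast+
  qed
  ultimately show ?thesis unfolding K4_directions_def by blast
qed

lemma coords: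
  assumes "det3 e1 e2 e3 \<noteq> 0" obtains x y z where "w = comb e1 e2 e3 x y z"
  using cramer3_solve[OF assms, of w] unfolding comb_def by metis

text \<open>
  By \<open>coordinate_ratio\<close>, comparison with \<open>e1 + e2 + e3\<close> makes the nonzero coordinates of every direction equal. The three
  sums of two basis vectors cannot all occur, since four different planes would pass through \<open>e1 + e2\<close>. In
  each remaining case the directions lie along a path.
\<close>

lemma K4_full_support:
  assumes D: "det3 e1 e2 e3 \<noteq> 0" and e: "e1 \<in> S" "e2 \<in> S" "e3 \<in> S" and f: "e1 + e2 + e3 \<in> S"
  shows "K4_directions S"
proof -
  have f': "comb e1 e2 e3 1 1 1 \<in> S" using f by (simp add: comb_def)
  have c: "comb e1 e2 e3 1 0 0 \<in> S" "comb e1 e2 e3 0 0 1 \<in> S" using e by (simp_all add: comb_def)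
  have shape: "\<exists>v\<in>{e1, e2, e3, e1 + e2, e2 + e3, e1 + e3, e1 + e2 + e3}. \<exists>k. w = k *\<^sub>R v \<and> (w \<noteq> 0 \<longrightarrow> k \<noteq> 0)" if wS: "w \<in> S" for w
  proof -
    obtain x y z where w: "w = comb e1 e2 e3 x y z" using coords[OF D] by blast
    have r: "y = 0 \<or> z = 0 \<or> y = z" "x = 0 \<or> z = 0 \<or> x = z" "x = 0 \<or> y = 0 \<or> x = y"
      using coordinate_ratio[OF D e f', of x y z] wS w by auto
    then consider "w = x *\<^sub>R e1" | "w = y *\<^sub>R e2" | "w = z *\<^sub>R e3" | "w = x *\<^sub>R (e1 + e2)" | "w = y *\<^sub>R (e2 + e3)"
      | "w = x *\<^sub>R (e1 + e3)" | "w = x *\<^sub>R (e1 + e2 + e3)"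
      unfolding w comb_def by (cases "x = 0"; cases "y = 0"; cases "z = 0") (auto simp: algebra_simps)
    then show ?thesis
    proof cases
      case 1 then show ?thesis by (intro bexI[of _ e1] exI[of _ x]) auto
    next
      case 2 then show ?thesis by (intro bexI[of _ e2] exI[of _ y]) auto
    next
      case 3 then show ?thesis by (intro bexI[of _ e3] exI[of _ z]) auto
    next
      case 4 then show ?thesis by (intro bexI[of _ "e1 + e2"] exI[of _ x]) auto
    next
      case 5 then show ?thesis by (intro bexI[of _ "e2 + e3"] exI[of _ y]) auto
    next
      case 6 then show ?thesis by (intro bexI[of _ "e1 + e3"] exI[of _ x]) auto
    next
      case 7 then show ?thesis by (intro bexI[of _ "e1 + e2 + e3"] exI[of _ x]) auto
    qed
  qed
  have "\<not> (e1 + e2 \<in> S \<and> e2 + e3 \<in> S \<and> e1 + e3 \<in> S)"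
  proof
    assume "e1 + e2 \<in> S \<and> e2 + e3 \<in> S \<and> e1 + e3 \<in> S"
    then have "comb e1 e2 e3 1 1 0 \<in> S" "comb e1 e2 e3 0 1 1 \<in> S" "comb e1 e2 e3 1 0 1 \<in> S"
      by (simp_all add: comb_def)
    from few_planes_comb[OF few D this(1) c(1) c(2) this(2) this(3)] show False by simp
  qed
  then consider "e1 + e3 \<notin> S" | "e1 + e2 \<notin> S" | "e2 + e3 \<notin> S" by blast
  moreover have avoid: "\<exists>v\<in>{e1, e2, e3, e1 + e2, e2 + e3, e1 + e3, e1 + e2 + e3} - {v0}. \<exists>k. w = k *\<^sub>R v"
    if wS: "w \<in> S" and v0: "v0 \<notin> S" for w v0
  proof (cases "w = 0")
    case True
    have "e1 \<noteq> v0" using e(1) v0 by blast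
    then show ?thesis using True by (intro bexI[of _ e1] exI[of _ 0]) auto
  next
    case False
    obtain v k where vk: "v \<in> {e1, e2, e3, e1 + e2, e2 + e3, e1 + e3, e1 + e2 + e3}" "w = k *\<^sub>R v" "w \<noteq> 0 \<longrightarrow> k \<noteq> 0"
      using shape[OF wS] by blast
    then have "(1 / k) *\<^sub>R w = v" "1 / k \<noteq> 0" using False by auto
    then have "v \<in> S" using scale[OF wS] by metis
    then have "v \<noteq> v0" using v0 by blast
    then show ?thesis using vk(1,2) by blast
  qed
  ultimately show ?thesis
  proof cases
    case 1
    have "{e1, e2, e3, e1 + e2, e2 + e3, e1 + e3, e1 + e2 + e3} - {e1 + e3} \<subseteq> {e1, e2, e3, e1 + e2, e2 + e3, e1 + e2 + e3}" by blast
    then show ?thesis using avoid[OF _ 1] by (intro K4_path[OF D]) (meson subsetD)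
  next
    case 2
    have D': "det3 e1 e3 e2 \<noteq> 0" using D by (simp add: det3_expand algebra_simps)
    have "{e1, e2, e3, e1 + e2, e2 + e3, e1 + e3, e1 + e2 + e3} - {e1 + e2} \<subseteq> {e1, e3, e2, e1 + e3, e3 + e2, e1 + e3 + e2}"
      by (auto simp: add.commute add.left_commute)
    then show ?thesis using avoid[OF _ 2] by (intro K4_path[OF D']) (meson subsetD)
  next
    case 3
    have D': "det3 e2 e1 e3 \<noteq> 0" using D by (simp add: det3_expand algebra_simps)
    have "{e1, e2, e3, e1 + e2, e2 + e3, e1 + e3, e1 + e2 + e3} - {e2 + e3} \<subseteq> {e2, e1, e3, e2 + e1, e1 + e3, e2 + e1 + e3}"
      by (auto simp: add.commute)
    then show ?thesis using avoid[OF _ 3] by (intro K4_path[OF D']) (meson subsetD)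
  qed
qed

text \<open>
  The mixed directions in each of the two coordinate planes are parallel, and rescaling the basis normalises both
  to sums of two basis vectors.
\<close>

lemma K4_two_pairs:
  assumes D: "det3 e1 e2 e3 \<noteq> 0" and e: "e1 \<in> S" "e2 \<in> S" "e3 \<in> S"
    and nofull: "\<And>x y z. comb e1 e2 e3 x y z \<in> S \<Longrightarrow> x = 0 \<or> y = 0 \<or> z = 0"
    and no13: "\<And>x z. comb e1 e2 e3 x 0 z \<in> S \<Longrightarrow> x = 0 \<or> z = 0"
  shows "K4_directions S"
proof -
  obtain p where p: "p \<noteq> 0" "\<And>x y. comb e1 e2 e3 x y 0 \<in> S \<Longrightarrow> x = 0 \<or> y = 0 \<or> y = p * x"
  proof (cases "\<exists>x y. comb e1 e2 e3 x y 0 \<in> S \<and> x \<noteq> 0 \<and> y \<noteq> 0")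
    case True
    then obtain a b where ab: "comb e1 e2 e3 a b 0 \<in> S" "a \<noteq> 0" "b \<noteq> 0" by blast
    have "x = 0 \<or> y = 0 \<or> y = (b / a) * x" if xy: "comb e1 e2 e3 x y 0 \<in> S" for x y
      using coordinate_ratio(3)[OF D e ab(1) xy] ab by (auto simp: field_simps)
    then show thesis using that[of "b / a"] ab by simp
  next
    case False
    then show thesis using that[of 1] by auto
  qed
  obtain q where q: "q \<noteq> 0" "\<And>y z. comb e1 e2 e3 0 y z \<in> S \<Longrightarrow> y = 0 \<or> z = 0 \<or> z = q * y"
  proof (cases "\<exists>y z. comb e1 e2 e3 0 y z \<in> S \<and> y \<noteq> 0 \<and> z \<noteq> 0")
    case True
    then obtain a b where ab: "comb e1 e2 e3 0 a b \<in> S" "a \<noteq> 0" "b \<noteq> 0" by blast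
    have "y = 0 \<or> z = 0 \<or> z = (b / a) * y" if xy: "comb e1 e2 e3 0 y z \<in> S" for y z
      using coordinate_ratio(1)[OF D e ab(1) xy] ab by (auto simp: field_simps)
    then show thesis using that[of "b / a"] ab by simp
  next
    case False
    then show thesis using that[of 1] by auto
  qed
  let ?E1 = "e1" and ?E2 = "p *\<^sub>R e2" and ?E3 = "(p * q) *\<^sub>R e3"
  have "det3 ?E1 ?E2 ?E3 = p * (p * q) * det3 e1 e2 e3" by (simp add: det3_expand algebra_simps)
  then have D': "det3 ?E1 ?E2 ?E3 \<noteq> 0" using D p(1) q(1) by simp
  show ?thesis
  proof (rule K4_path[OF D'])
    fix w assume wS: "w \<in> S"
    obtain x y z where w: "w = comb e1 e2 e3 x y z" using coords[OF D] by blast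
    note full = nofull[of x y z]
    consider "x = 0" "y = 0" | "x = 0" "z = 0" | "y = 0" "z = 0" | "z = 0" "y = p * x" | "x = 0" "z = q * y"
      using full no13[of x z] p(2)[of x y] q(2)[of y z] wS w by auto
    then show "\<exists>v\<in>{?E1, ?E2, ?E3, ?E1 + ?E2, ?E2 + ?E3, ?E1 + ?E2 + ?E3}. \<exists>k. w = k *\<^sub>R v"
    proof cases
      case 1
      then have "w = (z / (p * q)) *\<^sub>R ?E3" using p(1) q(1) by (simp add: w comb_def)
      then show ?thesis by blast
    next
      case 2
      then have "w = (y / p) *\<^sub>R ?E2" using p(1) by (simp add: w comb_def)
      then show ?thesis by blast
    next
      case 3
      then have "w = x *\<^sub>R ?E1" by (simp add: w comb_def)
      then show ?thesis by blast
    next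
      case 4
      then have "w = x *\<^sub>R (?E1 + ?E2)" by (simp add: w comb_def algebra_simps)
      then show ?thesis by blast
    next
      case 5
      then have "w = (y / p) *\<^sub>R (?E2 + ?E3)" using p(1) by (simp add: w comb_def scaleR_right_distrib mult.commute)
      then show ?thesis by blast
    qed
  qed
qed

text \<open>
  The three mixed directions are coplanar, since otherwise four planes would pass through the first of them. This is
  the relation that lets them become the differences of a common basis.
\<close>

lemma K4_three_pairs:
  assumes D: "det3 e1 e2 e3 \<noteq> 0" and e: "e1 \<in> S" "e2 \<in> S" "e3 \<in> S"
    and nofull: "\<And>x y z. comb e1 e2 e3 x y z \<in> S \<Longrightarrow> x = 0 \<or> y = 0 \<or> z = 0"
    and p: "comb e1 e2 e3 p1 p2 0 \<in> S" "p1 \<noteq> 0" "p2 \<noteq> 0"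
    and q: "comb e1 e2 e3 0 q2 q3 \<in> S" "q2 \<noteq> 0" "q3 \<noteq> 0"
    and r: "comb e1 e2 e3 r1 0 r3 \<in> S" "r1 \<noteq> 0" "r3 \<noteq> 0"
  shows "K4_directions S"
proof -
  have c: "comb e1 e2 e3 1 0 0 \<in> S" "comb e1 e2 e3 0 0 1 \<in> S" using e by (simp_all add: comb_def)
  \<comment> \<open>The determinant of the three mixed directions vanishes.\<close>
  have rel: "p1 * q2 * r3 = - (p2 * q3 * r1)"
    using few_planes_comb[OF few D p(1) c(1) c(2) q(1) r(1)] p q r by (auto simp: algebra_simps eq_neg_iff_add_eq_0)
  \<comment> \<open>Scaled so that the first two mixed directions become \<open>E1 + E2\<close> and \<open>E2 +
    E3\<close>; coplanarity makes the third one \<open>E1 - E3\<close>.\<close>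
  let ?E1 = "p1 *\<^sub>R e1" and ?E2 = "p2 *\<^sub>R e2" and ?E3 = "(p2 * q3 / q2) *\<^sub>R e3"
  let ?a = "?E1" and ?b = "?E1 - ?E3" and ?c = "?E1 + ?E2"
  have "det3 (s *\<^sub>R e1) (s *\<^sub>R e1 - t *\<^sub>R e3) (s *\<^sub>R e1 + r *\<^sub>R e2) = s * r * t * det3 e1 e2 e3" for r s t
    by (simp add: det3_expand algebra_simps)
  then have "det3 ?a ?b ?c = p1 * p2 * (p2 * q3 / q2) * det3 e1 e2 e3" .
  then have D': "det3 ?a ?b ?c \<noteq> 0" using D p q by simp
  have "\<exists>v\<in>{?a, ?b, ?c, ?a - ?b, ?b - ?c, ?a - ?c}. \<exists>k. w = k *\<^sub>R v" if wS: "w \<in> S" for w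
  proof -
    obtain x y z where w: "w = comb e1 e2 e3 x y z" using coords[OF D] by blast
    have wS': "comb e1 e2 e3 x y z \<in> S" using wS w by simp
    note ratio = coordinate_ratio(1)[OF D e q(1) wS'] coordinate_ratio(2)[OF D e r(1) wS'] coordinate_ratio(3)[OF D e p(1) wS']
    consider "x = 0" "y = 0" | "x = 0" "z = 0" | "y = 0" "z = 0" | "z = 0" "p1 * y = p2 * x" | "x = 0" "q2 * z = q3 * y" | "y = 0" "r1 * z = r3 * x"
      using nofull[OF wS'] ratio p q r by auto
    then show ?thesis
    proof cases
      case 1
      then have "w = (z / (p2 * q3 / q2)) *\<^sub>R (?a - ?b)" using p q by (simp add: w comb_def)
      then show ?thesis by blast
    next
      case 2
      then have "w = (- y / p2) *\<^sub>R (?a - ?c)" using p by (simp add: w comb_def)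
      then show ?thesis by blast
    next
      case 3
      then have "w = (x / p1) *\<^sub>R ?a" using p by (simp add: w comb_def)
      then show ?thesis by blast
    next
      case 4
      then have "y = (x / p1) * p2" using p by (simp add: field_simps)
      then have "w = (x / p1) *\<^sub>R ?c" using p 4 by (simp add: w comb_def scaleR_right_distrib)
      then show ?thesis by blast
    next
      case 5
      then have "z = (y / p2) * (p2 * q3 / q2)" using p q by (simp add: field_simps)
      then have "w = (- y / p2) *\<^sub>R (?b - ?c)" using p 5 by (simp add: w comb_def scaleR_right_distrib scaleR_right_diff_distrib)
      then show ?thesis by blast
    next
      case 6
      have "z * (q2 * p1 * r1) = q2 * p1 * (r1 * z)" by simp
      also have "\<dots> = (p1 * q2 * r3) * x" using 6 by simp
      also have "\<dots> = - (p2 * q3 * r1) * x" using rel by simp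
      finally have "z * (q2 * p1) * r1 = (- (p2 * q3) * x) * r1" by (simp add: algebra_simps)
      then have "z * (q2 * p1) = - (p2 * q3) * x" using r(2) by (metis mult_right_cancel)
      then have "z = - (x / p1) * (p2 * q3 / q2)" using p q by (simp add: field_simps)
      then have "w = (x / p1) *\<^sub>R ?b" using p 6 by (simp add: w comb_def scaleR_right_diff_distrib)
      then show ?thesis by blast
    qed
  qed
  then show ?thesis unfolding K4_directions_def using D' by blast
qed

text \<open>
  The cases are a direction with three nonzero coordinates, and otherwise mixed directions
  in at most two or in all three coordinate planes.
\<close>

theorem K4_classification:
  assumes D: "det3 e1 e2 e3 \<noteq> 0" and e: "e1 \<in> S" "e2 \<in> S" "e3 \<in> S"
  shows "K4_directions S"
proof (cases "\<exists>x y z. comb e1 e2 e3 x y z \<in> S \<and> x \<noteq> 0 \<and> y \<noteq> 0 \<and> z \<noteq> 0")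
  case True
  then obtain x y z where f: "comb e1 e2 e3 x y z \<in> S" "x \<noteq> 0" "y \<noteq> 0" "z \<noteq> 0" by blast
  have "det3 (x *\<^sub>R e1) (y *\<^sub>R e2) (z *\<^sub>R e3) = x * y * z * det3 e1 e2 e3" by (simp add: det3_expand algebra_simps)
  then have "det3 (x *\<^sub>R e1) (y *\<^sub>R e2) (z *\<^sub>R e3) \<noteq> 0" using D f by simp
  then show ?thesis by (rule K4_full_support) (use f e scale in \<open>auto simp: comb_def\<close>)
next
  case False
  then have nofull: "\<And>x y z. comb e1 e2 e3 x y z \<in> S \<Longrightarrow> x = 0 \<or> y = 0 \<or> z = 0" by blast
  have perm: "comb e2 e1 e3 y x z = comb e1 e2 e3 x y z" "comb e1 e3 e2 x z y = comb e1 e2 e3 x y z" for x y z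
    by (simp_all add: comb_def)
  consider "\<And>x z. comb e1 e2 e3 x 0 z \<in> S \<Longrightarrow> x = 0 \<or> z = 0"
    | "\<And>x y. comb e1 e2 e3 x y 0 \<in> S \<Longrightarrow> x = 0 \<or> y = 0"
    | "\<And>y z. comb e1 e2 e3 0 y z \<in> S \<Longrightarrow> y = 0 \<or> z = 0"
    | p1 p2 q2 q3 r1 r3 where "comb e1 e2 e3 p1 p2 0 \<in> S" "p1 \<noteq> 0" "p2 \<noteq> 0"
      "comb e1 e2 e3 0 q2 q3 \<in> S" "q2 \<noteq> 0" "q3 \<noteq> 0" "comb e1 e2 e3 r1 0 r3 \<in> S" "r1 \<noteq> 0" "r3 \<noteq> 0" by metis
  then show ?thesis
  proof cases
    case 1 then show ?thesis using K4_two_pairs[OF D e nofull] by blast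
  next
    case 2
    have D': "det3 e1 e3 e2 \<noteq> 0" using D by (simp add: det3_expand algebra_simps)
    show ?thesis
    proof (rule K4_two_pairs[OF D' e(1,3,2)])
      show "x = 0 \<or> y = 0 \<or> z = 0" if "comb e1 e3 e2 x y z \<in> S" for x y z using nofull[of x z y] that by (auto simp: perm)
      show "x = 0 \<or> z = 0" if "comb e1 e3 e2 x 0 z \<in> S" for x z using 2[of x z] that by (simp add: perm)
    qed
  next
    case 3
    have D': "det3 e2 e1 e3 \<noteq> 0" using D by (simp add: det3_expand algebra_simps)
    show ?thesis
    proof (rule K4_two_pairs[OF D' e(2,1,3)])
      show "x = 0 \<or> y = 0 \<or> z = 0" if "comb e2 e1 e3 x y z \<in> S" for x y z using nofull[of y x z] that by (auto simp: perm)
      show "x = 0 \<or> z = 0" if "comb e2 e1 e3 x 0 z \<in> S" for x z using 3[of x z] that by (simp add: perm)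
    qed
  next
    case 4
    show ?thesis by (rule K4_three_pairs[OF D e nofull 4])
  qed
qed

end

section \<open>Voronoi cells and face-to-face lattices\<close>

lemma finite_minimizer:
  fixes f :: "'a \<Rightarrow> real"
  assumes "finite S" "s \<in> S"
  obtains u where "u \<in> S" "\<And>m. m \<in> S \<Longrightarrow> f u \<le> f m"
proof
  have "S \<noteq> {}" using assms(2) by blast
  show "arg_min_on f S \<in> S" by (rule arg_min_if_finite(1)[OF assms(1) \<open>S \<noteq> {}\<close>])
  show "f (arg_min_on f S) \<le> f m" if "m \<in> S" for m
    by (rule arg_min_least[OF assms(1) \<open>S \<noteq> {}\<close> that])
qed

text \<open>
  Here \<open>T\<close> is the Gram operator of a positive definite form and \<open>U\<close> a lattice of functionals; the tiling
  lattice is \<open>T ` U\<close>. In terms of \<open>v\<close> with \<open>x = T v\<close>, the cell consists of the \<open>x\<close> for which the origin is a nearest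
  point of \<open>U\<close> to \<open>v\<close> with respect to this form. Keeping \<open>U\<close> and \<open>T ` U\<close> apart avoids inverting \<open>T\<close>.
\<close>

locale voronoi =
  fixes T :: "real^3 \<Rightarrow> real^3" and U :: "(real^3) set"
  assumes linT: "linear T" and sym: "u \<bullet> T v = v \<bullet> T u" and pos: "u \<noteq> 0 \<Longrightarrow> u \<bullet> T u > 0"
    and U0: "0 \<in> U" and Udiff: "u \<in> U \<Longrightarrow> v \<in> U \<Longrightarrow> u - v \<in> U"
    and Ufin: "finite {u\<in>U. norm u \<le> C}"
begin

definition cell :: "(real^3) set" where
  "cell = {x. \<forall>u\<in>U. u \<bullet> x \<le> (u \<bullet> T u) / 2}"

lemma Uneg: "u \<in> U \<Longrightarrow> - u \<in> U" using Udiff[OF U0, of u] by simp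

lemma Uadd: "u \<in> U \<Longrightarrow> v \<in> U \<Longrightarrow> u + v \<in> U" using Udiff[of u "- v"] Uneg[of v] by simp

lemma T_simps: "T (u + v) = T u + T v" "T (u - v) = T u - T v" "T (- u) = - T u" "T 0 = 0" "T (c *\<^sub>R u) = c *\<^sub>R T u"
  using linT by (simp_all add: linear_add linear_diff linear_neg linear_0 linear_cmul)

lemma injT: "inj T"
proof (rule injI)
  fix u v assume "T u = T v"
  then have "(u - v) \<bullet> T (u - v) = 0" by (simp add: T_simps)
  then show "u = v" using pos[of "u - v"] by force
qed

lemma surjT: "surj T" using linear_injective_imp_surjective[OF linT injT] by simp

lemma cell_symmetric: "x \<in> cell \<Longrightarrow> - x \<in> cell"
  unfolding cell_def using Uneg by (force simp: T_simps)

lemma square_diff: "(v - u) \<bullet> T (v - u) = v \<bullet> T v - 2 * (u \<bullet> T v) + u \<bullet> T u"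
  using sym[of v u] by (simp add: T_simps inner_diff_left inner_diff_right)

text \<open>
  On the unit sphere the form attains a positive minimum.
\<close>

lemma finite_sublevel: "finite {u\<in>U. (v - u) \<bullet> T (v - u) \<le> C}"
proof -
  have "continuous_on (sphere 0 1) (\<lambda>x. x \<bullet> T x)" using linT by (intro continuous_intros linear_continuous_on) (simp add: linear_conv_bounded_linear)
  moreover have "sphere 0 1 \<noteq> ({} :: (real^3) set)" by simp
  ultimately obtain x0 :: "real^3" where x0: "norm x0 = 1" "\<And>x. norm x = 1 \<Longrightarrow> x0 \<bullet> T x0 \<le> x \<bullet> T x"
    using continuous_attains_inf[of "sphere 0 1" "\<lambda>x. x \<bullet> T x"] by auto
  define k where "k = x0 \<bullet> T x0"
  have "x0 \<noteq> 0" using x0(1) by auto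
  then have k: "k > 0" using pos unfolding k_def by blast
  have low: "k * (norm x)\<^sup>2 \<le> x \<bullet> T x" for x
  proof (cases "x = 0")
    case True then show ?thesis by (simp add: T_simps)
  next
    case False
    have "k \<le> ((1 / norm x) *\<^sub>R x) \<bullet> T ((1 / norm x) *\<^sub>R x)" unfolding k_def using False by (intro x0(2)) simp
    also have "\<dots> = (x \<bullet> T x) / (norm x)\<^sup>2" by (simp add: T_simps power2_eq_square)
    finally show ?thesis using False by (simp add: field_simps)
  qed
  have "norm u \<le> norm v + sqrt (C / k)" if "(v - u) \<bullet> T (v - u) \<le> C" for u
  proof -
    have "k * (norm (v - u))\<^sup>2 \<le> C" using low[of "v - u"] that by linarith
    then have "(norm (v - u))\<^sup>2 \<le> C / k" using k by (simp add: field_simps)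
    then have "norm (v - u) \<le> sqrt (C / k)" by (rule real_le_rsqrt)
    then show ?thesis using norm_triangle_ineq4[of v "v - u"] by simp
  qed
  then have "{u\<in>U. (v - u) \<bullet> T (v - u) \<le> C} \<subseteq> {u\<in>U. norm u \<le> norm v + sqrt (C / k)}" by auto
  then show ?thesis by (rule finite_subset[OF _ Ufin])
qed

text \<open>
  Choose a lattice point nearest to \<open>v\<close>, where \<open>x = T v\<close>.
\<close>

lemma cell_covering: "\<exists>u\<in>U. x - T u \<in> cell"
proof -
  obtain v where v: "x = T v" using surjT by (metis surjD)
  let ?F = "{u\<in>U. (v - u) \<bullet> T (v - u) \<le> v \<bullet> T v}"
  have "0 \<in> ?F" using U0 by simp
  then obtain u where u: "u \<in> ?F" "\<And>m. m \<in> ?F \<Longrightarrow> (v - u) \<bullet> T (v - u) \<le> (v - m) \<bullet> T (v - m)"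
    by (rule finite_minimizer[where f="\<lambda>u. (v - u) \<bullet> T (v - u)", OF finite_sublevel]) (rule that)
  have min: "(v - u) \<bullet> T (v - u) \<le> (v - m) \<bullet> T (v - m)" if "m \<in> U" for m
    using u that by (cases "m \<in> ?F") auto
  have "x - T u \<in> cell"
    unfolding cell_def
  proof (intro CollectI ballI)
    fix m assume m: "m \<in> U"
    define r where "r = v - u"
    have "r \<bullet> T r \<le> (r - m) \<bullet> T (r - m)" using min[OF Uadd[of u m]] u(1) m by (simp add: r_def algebra_simps)
    then have "2 * (m \<bullet> T r) \<le> m \<bullet> T m" unfolding square_diff by simp
    moreover have "x - T u = T r" by (simp add: v r_def T_simps)
    ultimately show "m \<bullet> (x - T u) \<le> (m \<bullet> T m) / 2" by simp
  qed
  then show ?thesis using u(1) by blast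
qed

lemma cell_packing:
  assumes u: "u \<in> U" and x: "x \<in> interior cell" and y: "x - T u \<in> cell"
  shows "u = 0"
proof (rule ccontr)
  assume nz: "u \<noteq> 0"
  obtain e where e: "e > 0" "cball x e \<subseteq> cell" using x mem_interior_cball by blast
  have "x + (e / norm u) *\<^sub>R u \<in> cball x e" using e nz by (simp add: dist_norm)
  then have "u \<bullet> (x + (e / norm u) *\<^sub>R u) \<le> (u \<bullet> T u) / 2" using e(2) u unfolding cell_def by blast
  moreover have "(e / norm u) * (u \<bullet> u) > 0" using e nz by simp
  ultimately have "u \<bullet> x < (u \<bullet> T u) / 2" unfolding inner_add_right inner_scaleR_right by linarith
  moreover have "(- u) \<bullet> (x - T u) \<le> ((- u) \<bullet> T (- u)) / 2" using y Uneg[OF u] unfolding cell_def by blast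
  then have "u \<bullet> x \<ge> (u \<bullet> T u) / 2" by (simp add: T_simps inner_diff_right)
  ultimately show False by simp
qed

text \<open>
  A common point of two cells is equidistant from their centres. Conversely, if \<open>x\<close> satisfies the
  inequality for \<open>m + u\<close> and equality for \<open>u\<close>, then \<open>x - T u\<close> satisfies the one for \<open>m\<close>.
\<close>

lemma cell_meet: assumes u: "u \<in> U"
  shows "cell \<inter> {x. x - T u \<in> cell} = cell \<inter> {x. u \<bullet> x = (u \<bullet> T u) / 2}"
proof
  show "cell \<inter> {x. x - T u \<in> cell} \<subseteq> cell \<inter> {x. u \<bullet> x = (u \<bullet> T u) / 2}"
  proof
    fix x assume x: "x \<in> cell \<inter> {x. x - T u \<in> cell}"
    have "(- u) \<bullet> (x - T u) \<le> ((- u) \<bullet> T (- u)) / 2" using x Uneg[OF u] unfolding cell_def by blast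
    then have "u \<bullet> x \<ge> (u \<bullet> T u) / 2" by (simp add: T_simps inner_diff_right)
    moreover have "u \<bullet> x \<le> (u \<bullet> T u) / 2" using x u unfolding cell_def by blast
    ultimately show "x \<in> cell \<inter> {x. u \<bullet> x = (u \<bullet> T u) / 2}" using x by simp
  qed
  show "cell \<inter> {x. u \<bullet> x = (u \<bullet> T u) / 2} \<subseteq> cell \<inter> {x. x - T u \<in> cell}"
  proof
    fix x assume x: "x \<in> cell \<inter> {x. u \<bullet> x = (u \<bullet> T u) / 2}"
    have "m \<bullet> (x - T u) \<le> (m \<bullet> T m) / 2" if m: "m \<in> U" for m
    proof -
      have "(m + u) \<bullet> x \<le> ((m + u) \<bullet> T (m + u)) / 2" using x Uadd[OF m u] unfolding cell_def by blast
      then show ?thesis using x sym[of u m] by (simp add: T_simps inner_add_left inner_add_right inner_diff_right)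
    qed
    then show "x \<in> cell \<inter> {x. x - T u \<in> cell}" using x unfolding cell_def by blast
  qed
qed

lemma convex_cell: "convex cell" and closed_cell: "closed cell"
proof -
  have eq: "cell = (\<Inter>u\<in>U. {x. u \<bullet> x \<le> (u \<bullet> T u) / 2})" by (auto simp: cell_def)
  show "convex cell" unfolding eq by (intro convex_INT convex_halfspace_le)
  show "closed cell" unfolding eq by (intro closed_INT ballI closed_halfspace_le)
qed

lemma cell_meet_face: assumes "u \<in> U" shows "cell \<inter> {x. x - T u \<in> cell} face_of cell"
  unfolding cell_meet[OF assms]
  by (rule face_of_Int_supporting_hyperplane_le[OF convex_cell]) (use assms in \<open>auto simp: cell_def\<close>)

end

lemma (in symmetric_tile) boundary_neighbour:
  assumes x: "x \<in> P" "x \<notin> interior P"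
  shows "\<exists>a\<in>L. a \<noteq> 0 \<and> x - a \<in> P"
proof (rule ccontr)
  assume no: "\<not> ?thesis"
  obtain r where r: "r > 0" "\<And>y. dist x y < r \<Longrightarrow> \<exists>a\<in>tiles_at x. y - a \<in> P" using local_cover by blast
  have "tiles_at x \<subseteq> {0}" using no unfolding tiles_at_def by blast
  then have "ball x r \<subseteq> P" using r(2) by fastforce
  then show False using x(2) r(1) by (meson centre_in_ball interior_maximal open_ball subsetD)
qed

text \<open>
  A point in the relative interior of the facet lies in a second tile; face-to-face contact then spreads
  from this point to the whole facet.
\<close>

lemma (in symmetric_tile) facet_vector:
  assumes P: "polytope P" and f2f: "\<And>a. a \<in> L \<Longrightarrow> P \<inter> {x. x - a \<in> P} face_of P" and G: "G facet_of P"
  shows "\<exists>a\<in>L. a \<noteq> 0 \<and> G = P \<inter> {x. x - a \<in> P}"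
proof -
  have Gf: "G face_of P" "G \<noteq> {}" "aff_dim G = aff_dim P - 1" using G by (auto simp: facet_of_def)
  have "convex G" using Gf(1) face_of_imp_convex by blast
  then obtain x where x: "x \<in> rel_interior G" using Gf(2) rel_interior_eq_empty by blast
  have xG: "x \<in> G" using x rel_interior_subset by blast
  have xP: "x \<in> P" using xG Gf(1) face_of_imp_subset by blast
  have "G \<noteq> P" using Gf(3) by auto
  then have "x \<notin> rel_interior P" using face_of_disjoint_rel_interior[OF Gf(1)] xG by blast
  then have "x \<notin> interior P" using interior_subset_rel_interior by blast
  then obtain a where a: "a \<in> L" "a \<noteq> 0" "x - a \<in> P" using boundary_neighbour[OF xP] by blast
  let ?F = "P \<inter> {x. x - a \<in> P}"
  have F: "?F face_of P" by (rule f2f[OF a(1)])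
  have "G \<subseteq> ?F"
  proof (rule subset_of_face_of[OF F])
    show "G \<subseteq> P" using Gf(1) face_of_imp_subset by blast
    show "?F \<inter> rel_interior G \<noteq> {}" using x xP a(3) by blast
  qed
  have "?F \<noteq> P"
  proof
    assume eq: "?F = P"
    obtain y where y: "y \<in> interior P" using interior_nonempty by blast
    have "P \<subseteq> (+) a ` P"
    proof
      fix z assume "z \<in> P"
      then have "z - a \<in> P" using eq by blast
      moreover have "z = a + (z - a)" by simp
      ultimately show "z \<in> (+) a ` P" by blast
    qed
    then have "interior P \<subseteq> interior ((+) a ` P)" by (rule interior_mono)
    then have "y \<in> (+) a ` interior P" using y by (auto simp: interior_translation)
    then have "y - a \<in> interior P" by auto
    then show False using packing[OF a(1) y] a(2) by blast
  qed
  have "?F = G"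
  proof (rule ccontr)
    assume "?F \<noteq> G"
    have "G face_of ?F" using Gf(1) \<open>G \<subseteq> ?F\<close> face_of_imp_subset[OF F] face_of_subset by blast
    moreover have "convex ?F" using F face_of_imp_convex by blast
    ultimately have "aff_dim G < aff_dim ?F" using face_of_aff_dim_lt \<open>?F \<noteq> G\<close> by metis
    moreover have "aff_dim ?F < aff_dim P" using face_of_aff_dim_lt[OF convex F \<open>?F \<noteq> P\<close>] .
    ultimately show False using Gf(3) by linarith
  qed
  then show ?thesis using a by blast
qed

lemma compact_translate_eq:
  fixes G :: "(real^3) set"
  assumes "compact G" "G \<noteq> {}" "\<And>z. z \<in> G \<Longrightarrow> z + d \<in> G" shows "d = 0"
proof -
  have "continuous_on G (\<lambda>x. d \<bullet> x)" by (intro continuous_intros)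
  with assms obtain z where z: "z \<in> G" "\<forall>y\<in>G. d \<bullet> y \<le> d \<bullet> z" using continuous_attains_sup[of G "\<lambda>x. d \<bullet> x"] by blast
  then have "d \<bullet> (z + d) \<le> d \<bullet> z" using assms(3) by blast
  then have "d \<bullet> d \<le> 0" by (simp add: inner_add_right)
  then show ?thesis using inner_gt_zero_iff[of d] by linarith
qed

text \<open>
  A facet that is the contact with the tile \<open>P + a\<close> is symmetric about \<open>a / 2\<close>. Its centre of
  symmetry is unique, so two tilings have the same vector across it.
\<close>

lemma facet_vectors_agree:
  assumes 1: "symmetric_tile P L" and 2: "symmetric_tile P M" and P: "polytope P"
    and f1: "\<And>a. a \<in> L \<Longrightarrow> P \<inter> {x. x - a \<in> P} face_of P" and f2: "\<And>a. a \<in> M \<Longrightarrow> P \<inter> {x. x - a \<in> P} face_of P"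
    and G: "G facet_of P"
  shows "\<exists>a\<in>L \<inter> M. G = P \<inter> {x. x - a \<in> P}"
proof -
  obtain a where a: "a \<in> L" "G = P \<inter> {x. x - a \<in> P}" using symmetric_tile.facet_vector[OF 1 P f1 G] by blast
  obtain b where b: "b \<in> M" "G = P \<inter> {x. x - b \<in> P}" using symmetric_tile.facet_vector[OF 2 P f2 G] by blast
  have symP: "- x \<in> P" if "x \<in> P" for x using symmetric_tile.symmetric[OF 1 that] .
  have ra: "a - z \<in> G" if "z \<in> G" for z
    using that symP[of "z - a"] symP[of z] unfolding a(2) by auto
  have rb: "b - z \<in> G" if "z \<in> G" for z
    using that symP[of "z - b"] symP[of z] unfolding b(2) by auto
  have "G face_of P" "G \<noteq> {}" using G by (auto simp: facet_of_def)
  then have "compact G" using P face_of_polytope_polytope polytope_imp_compact by blast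
  then have "b - a = 0"
  proof (rule compact_translate_eq[OF _ \<open>G \<noteq> {}\<close>])
    fix z assume "z \<in> G"
    then show "z + (b - a) \<in> G" using rb[OF ra, of z] by (simp add: algebra_simps)
  qed
  then show ?thesis using a b(1) by auto
qed

text \<open>
  Take a shortest \<open>u\<close> with \<open>T u \<notin> M\<close>. The segment from the centre to \<open>T u\<close> leaves the cell through a facet,
  and the vector \<open>T m\<close> across this facet is in \<open>M\<close>; as the segment crosses the bisector before its end,
  \<open>u - m\<close> is shorter than \<open>u\<close> and still a counterexample.
\<close>

lemma (in voronoi) lattice_subset:
  assumes 1: "symmetric_tile cell (T ` U)" and 2: "symmetric_tile cell M" and P: "polytope cell"
    and f2: "\<And>a. a \<in> M \<Longrightarrow> cell \<inter> {x. x - a \<in> cell} face_of cell"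
  shows "T ` U \<subseteq> M"
proof (rule ccontr)
  assume "\<not> T ` U \<subseteq> M"
  then obtain u0 where u0: "u0 \<in> U" "T u0 \<notin> M" by blast
  let ?F = "{u\<in>U. T u \<notin> M \<and> u \<bullet> T u \<le> u0 \<bullet> T u0}"
  have "?F \<subseteq> {u\<in>U. (0 - u) \<bullet> T (0 - u) \<le> u0 \<bullet> T u0}" by (auto simp: T_simps)
  then have "finite ?F" by (rule finite_subset[OF _ finite_sublevel])
  moreover have "u0 \<in> ?F" using u0 by simp
  ultimately obtain u where u: "u \<in> ?F" "\<And>m. m \<in> ?F \<Longrightarrow> u \<bullet> T u \<le> m \<bullet> T m"
    by (rule finite_minimizer[where f="\<lambda>u. u \<bullet> T u"]) (rule that)
  have uU: "u \<in> U" "T u \<notin> M" using u(1) by auto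
  have M0: "0 \<in> M" using symmetric_tile.lattice_zero[OF 2] .
  then have "u \<noteq> 0" using uU(2) by (auto simp: T_simps)
  have int0: "0 \<in> interior cell"
  proof -
    obtain x where x: "x \<in> interior cell" using symmetric_tile.interior_nonempty[OF 1] by blast
    obtain e where e: "e > 0" "ball x e \<subseteq> cell" using x mem_interior by blast
    have "ball 0 e \<subseteq> cell"
    proof
      fix y :: "real^3" assume y: "y \<in> ball 0 e"
      then have "x + y \<in> cell" using e(2) by (auto simp: dist_norm subset_iff)
      moreover have "- (x - y) \<in> cell" using e(2) y by (intro cell_symmetric) (auto simp: dist_norm subset_iff)
      ultimately have "(1/2) *\<^sub>R (x + y) + (1/2) *\<^sub>R (- (x - y)) \<in> cell" using convexD[OF convex_cell, of _ _ "1/2" "1/2"] by simp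
      moreover have "(1/2) *\<^sub>R (x + y) + (1/2) *\<^sub>R (- (x - y)) = y" by (simp add: vec_eq_iff field_simps)
      ultimately show "y \<in> cell" by simp
    qed
    then show ?thesis using e(1) mem_interior by blast
  qed
  have "T u \<notin> cell"
  proof
    assume "T u \<in> cell"
    then have "u \<bullet> T u \<le> (u \<bullet> T u) / 2" using uU(1) unfolding cell_def by blast
    then show False using pos[OF \<open>u \<noteq> 0\<close>] by simp
  qed
  have "bounded cell" using P polytope_imp_bounded by blast
  have "T u \<noteq> 0" using \<open>u \<noteq> 0\<close> pos by force
  obtain t where t: "0 < t" "0 + t *\<^sub>R T u \<in> frontier cell" "\<And>e. 0 \<le> e \<Longrightarrow> e < t \<Longrightarrow> 0 + e *\<^sub>R T u \<in> interior cell"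
    using ray_to_frontier[OF \<open>bounded cell\<close> int0 \<open>T u \<noteq> 0\<close>] by metis
  have t1: "t < 1"
  proof (rule ccontr)
    assume "\<not> t < 1"
    then have "t = 1 \<or> 1 < t" by auto
    then have "T u \<in> cell"
    proof
      assume "t = 1" then show ?thesis using t(2) closed_cell by (auto simp: frontier_def)
    next
      assume "1 < t" then show ?thesis using t(3)[of 1] interior_subset by auto
    qed
    then show False using \<open>T u \<notin> cell\<close> by blast
  qed
  have "affine hull cell = UNIV" using int0 affine_hull_nonempty_interior by blast
  then have "rel_frontier cell = frontier cell" using rel_frontier_def frontier_def rel_interior_interior by metis
  then have "t *\<^sub>R T u \<in> \<Union> {F. F facet_of cell}" using t(2) rel_frontier_of_polyhedron[OF polytope_imp_polyhedron[OF P]] by simp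
  then obtain G where G: "G facet_of cell" "t *\<^sub>R T u \<in> G" by blast
  have f1: "cell \<inter> {x. x - a \<in> cell} face_of cell" if "a \<in> T ` U" for a using cell_meet_face that by blast
  obtain a where a: "a \<in> T ` U" "a \<in> M" "G = cell \<inter> {x. x - a \<in> cell}" using facet_vectors_agree[OF 1 2 P f1 f2 G(1)] by blast
  then obtain m where m: "m \<in> U" "a = T m" by blast
  have "G = cell \<inter> {x. m \<bullet> x = (m \<bullet> T m) / 2}" using a(3) m cell_meet by simp
  then have eq: "t * (m \<bullet> T u) = (m \<bullet> T m) / 2" using G(2) by auto
  have "m \<noteq> 0"
  proof
    assume "m = 0"
    then have "G = cell" using a(3) m(2) by (simp add: T_simps)
    then show False using G(1) facet_of_irrefl by blast
  qed
  then have pm: "m \<bullet> T m > 0" using pos by blast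
  then have "m \<bullet> T u > 0" using eq t(1) by (metis half_gt_zero zero_less_mult_pos)
  then have "t * (m \<bullet> T u) < 1 * (m \<bullet> T u)" using t1 by (intro mult_strict_right_mono) auto
  \<comment> \<open>As \<open>t < 1\<close>, the point \<open>T u\<close> lies beyond the bisector of
    \<open>0\<close> and \<open>T m\<close>.\<close>
  then have lt: "(u - m) \<bullet> T (u - m) < u \<bullet> T u" using eq unfolding square_diff by simp
  have "T (u - m) \<notin> M"
  proof
    assume "T (u - m) \<in> M"
    then have "T (u - m) + a \<in> M" using symmetric_tile.lattice_add[OF 2] a(2) by blast
    then show False using uU(2) m(2) by (simp add: T_simps)
  qed
  then have "u - m \<in> ?F" using Udiff[OF uU(1) m(1)] lt u(1) by auto
  then show False using u(2)[of "u - m"] lt by simp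
qed

text \<open>
  A tile of the larger lattice overlaps in its interior with some tile of the smaller one, so the two coincide.
\<close>

lemma tiling_lattices_eq:
  assumes 1: "symmetric_tile P L" and 2: "symmetric_tile P M" and "L \<subseteq> M"
  shows "L = M"
proof
  show "M \<subseteq> L"
  proof
    fix b assume b: "b \<in> M"
    interpret A: symmetric_tile P L by (rule 1)
    interpret B: symmetric_tile P M by (rule 2)
    obtain x where x: "x \<in> interior P" using A.interior_nonempty by blast
    obtain a where a: "a \<in> L" "(x + b) - a \<in> P" using A.covering by blast
    have cl: "closure (interior P) = P"
      using convex_closure_interior[OF A.convex A.interior_nonempty] A.compact compact_imp_closed closure_closed by metis
    have "(+) (a - b) ` interior P \<inter> interior P = {} \<Longrightarrow> False"
    proof -
      assume disj: "(+) (a - b) ` interior P \<inter> interior P = {}"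
      have "open ((+) (b - a) ` interior P)" by (intro open_translation open_interior)
      moreover have "x + (b - a) \<in> (+) (b - a) ` interior P" using x by (auto simp: add.commute)
      moreover have "x + (b - a) \<in> closure (interior P)" using a(2) cl by (simp add: algebra_simps)
      ultimately obtain y where y: "y \<in> interior P" "y \<in> (+) (b - a) ` interior P" by (meson IntE open_Int_closure_eq_empty disjoint_iff)
      then obtain z where z: "z \<in> interior P" "y = (b - a) + z" by blast
      have "z = (a - b) + y" using z(2) by simp
      then show False using disj y(1) z(1) by blast
    qed
    then obtain y z where yz: "y \<in> interior P" "z \<in> interior P" "z = (a - b) + y" by blast
    have "a - b \<in> M" using B.lattice_diff a(1) b assms(3) by blast
    moreover have "z - (a - b) \<in> interior P" using yz by simp
    ultimately have "a - b = 0" using B.packing yz(2) by blast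
    then show "b \<in> L" using a(1) by simp
  qed
qed (rule assms(3))

section \<open>Zonotopes of the complete graph on four vertices\<close>

lemma type3_distinct: "(1::3) \<noteq> 2" "(1::3) \<noteq> 3" "(2::3) \<noteq> 3" "(2::3) \<noteq> 1" "(3::3) \<noteq> 1" "(3::3) \<noteq> 2"
  by simp_all

lemma distinct3_cases:
  fixes i j k :: 3
  assumes "i \<noteq> j" "i \<noteq> k" "j \<noteq> k"
  shows "i = 1 \<and> j = 2 \<and> k = 3 \<or> i = 1 \<and> j = 3 \<and> k = 2 \<or> i = 2 \<and> j = 1 \<and> k = 3 \<or>
    i = 2 \<and> j = 3 \<and> k = 1 \<or> i = 3 \<and> j = 1 \<and> k = 2 \<or> i = 3 \<and> j = 2 \<and> k = 1"
  using assms exhaust_3[of i] exhaust_3[of j] exhaust_3[of k] by metis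

text \<open>
  Summation by parts along the chain of sets \<open>{1}\<close>, \<open>{1, 2}\<close>, \<open>{1, 2, 3}\<close>.
\<close>

lemma chain_sorted:
  fixes x1 x2 x3 n1 n2 n3 q1 q2 q3 p12 p13 p23 :: real
  assumes "x1 \<le> (q1 + p12 + p13) / 2" "x1 + x2 \<le> (q1 + q2 + p13 + p23) / 2" "x1 + x2 + x3 \<le> (q1 + q2 + q3) / 2"
    and n: "n1 \<ge> n2" "n2 \<ge> n3" "n3 \<ge> 0"
  shows "n1 * x1 + n2 * x2 + n3 * x3
    \<le> (q1 * n1 + q2 * n2 + q3 * n3 + p12 * \<bar>n1 - n2\<bar> + p13 * \<bar>n1 - n3\<bar> + p23 * \<bar>n2 - n3\<bar>) / 2"
proof -
  have "(n1 - n2) * x1 \<le> (n1 - n2) * ((q1 + p12 + p13) / 2)"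
    "(n2 - n3) * (x1 + x2) \<le> (n2 - n3) * ((q1 + q2 + p13 + p23) / 2)"
    "n3 * (x1 + x2 + x3) \<le> n3 * ((q1 + q2 + q3) / 2)"
    by (rule mult_left_mono[OF assms(1)], use n in linarith)
      (rule mult_left_mono[OF assms(2)], use n in linarith, rule mult_left_mono[OF assms(3)], use n in linarith)
  moreover have "n1 * x1 + n2 * x2 + n3 * x3 = (n1 - n2) * x1 + (n2 - n3) * (x1 + x2) + n3 * (x1 + x2 + x3)"
    by (simp add: algebra_simps)
  ultimately have "n1 * x1 + n2 * x2 + n3 * x3
    \<le> (n1 - n2) * ((q1 + p12 + p13) / 2) + (n2 - n3) * ((q1 + q2 + p13 + p23) / 2) + n3 * ((q1 + q2 + q3) / 2)"
    by linarith
  also have "\<dots> = (q1 * n1 + q2 * n2 + q3 * n3 + p12 * (n1 - n2) + p13 * (n1 - n3) + p23 * (n2 - n3)) / 2"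
    by (simp add: field_simps)
  finally show ?thesis using n by simp
qed

text \<open>
  Generators of the zonotope are \<open>q i *\<^sub>R a i\<close> and \<open>p i j *\<^sub>R (a i - a j)\<close>, possibly zero.
\<close>

locale K4_body =
  fixes a :: "3 \<Rightarrow> real^3" and q :: "3 \<Rightarrow> real" and p :: "3 \<Rightarrow> 3 \<Rightarrow> real"
  assumes basis: "det3 (a 1) (a 2) (a 3) \<noteq> 0"
    and q_nonneg: "q i \<ge> 0" and p_nonneg: "p i j \<ge> 0" and p_sym: "p i j = p j i"
begin

text \<open>
  Twice the support function of the zonotope centred at the origin.
\<close>

definition h :: "real^3 \<Rightarrow> real" where
  "h u = q 1 * \<bar>u \<bullet> a 1\<bar> + q 2 * \<bar>u \<bullet> a 2\<bar> + q 3 * \<bar>u \<bullet> a 3\<bar>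
    + p 1 2 * \<bar>u \<bullet> a 1 - u \<bullet> a 2\<bar> + p 1 3 * \<bar>u \<bullet> a 1 - u \<bullet> a 3\<bar> + p 2 3 * \<bar>u \<bullet> a 2 - u \<bullet> a 3\<bar>"

definition body :: "(real^3) set" where
  "body = {x. \<forall>u. u \<bullet> x \<le> h u / 2}"

text \<open>
  The graph Laplacian of the complete graph on \<open>{0, 1, 2, 3}\<close> with weights \<open>q\<close> and \<open>p\<close>, acting on
  the potentials \<open>u \<bullet> a i\<close> with value zero at the vertex \<open>0\<close>.
\<close>

definition T :: "real^3 \<Rightarrow> real^3" where
  "T u = (q 1 * (u \<bullet> a 1)) *\<^sub>R a 1 + (q 2 * (u \<bullet> a 2)) *\<^sub>R a 2 + (q 3 * (u \<bullet> a 3)) *\<^sub>R a 3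
    + (p 1 2 * (u \<bullet> a 1 - u \<bullet> a 2)) *\<^sub>R (a 1 - a 2) + (p 1 3 * (u \<bullet> a 1 - u \<bullet> a 3)) *\<^sub>R (a 1 - a 3)
    + (p 2 3 * (u \<bullet> a 2 - u \<bullet> a 3)) *\<^sub>R (a 2 - a 3)"

definition U :: "(real^3) set" where "U = {u. \<forall>i. u \<bullet> a i \<in> \<int>}"

text \<open>
  The functional with prescribed values on the basis.
\<close>

definition dual :: "real \<Rightarrow> real \<Rightarrow> real \<Rightarrow> real^3" where
  "dual x y z = (1 / det3 (a 1) (a 2) (a 3)) *\<^sub>R
     (x *\<^sub>R cross3 (a 2) (a 3) + y *\<^sub>R cross3 (a 3) (a 1) + z *\<^sub>R cross3 (a 1) (a 2))"

lemma dual_simps [simp]: "dual x y z \<bullet> a 1 = x" "dual x y z \<bullet> a 2 = y" "dual x y z \<bullet> a 3 = z"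
proof -
  let ?D = "det3 (a 1) (a 2) (a 3)"
  have c: "cross3 (a 2) (a 3) \<bullet> a 1 = ?D" "cross3 (a 3) (a 1) \<bullet> a 2 = ?D" "cross3 (a 1) (a 2) \<bullet> a 3 = ?D"
    by (simp_all add: det3_expand inner_vec_def sum_3 cross3_def algebra_simps)
  have z: "cross3 (a 3) (a 1) \<bullet> a 1 = 0" "cross3 (a 1) (a 2) \<bullet> a 1 = 0" "cross3 (a 2) (a 3) \<bullet> a 2 = 0"
    "cross3 (a 1) (a 2) \<bullet> a 2 = 0" "cross3 (a 2) (a 3) \<bullet> a 3 = 0" "cross3 (a 3) (a 1) \<bullet> a 3 = 0"
    by (simp_all add: dot_cross_self)
  show "dual x y z \<bullet> a 1 = x" "dual x y z \<bullet> a 2 = y" "dual x y z \<bullet> a 3 = z"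
    using basis by (simp_all add: dual_def inner_add_left c z)
qed

lemma functional_eq:
  assumes "u \<bullet> a 1 = v \<bullet> a 1" "u \<bullet> a 2 = v \<bullet> a 2" "u \<bullet> a 3 = v \<bullet> a 3" shows "u = v"
proof -
  obtain x y z where r: "u - v = x *\<^sub>R a 1 + y *\<^sub>R a 2 + z *\<^sub>R a 3" using cramer3_solve[OF basis] by metis
  have "(u - v) \<bullet> (u - v) = x * ((u - v) \<bullet> a 1) + y * ((u - v) \<bullet> a 2) + z * ((u - v) \<bullet> a 3)"
    by (subst (2) r) (simp add: inner_add_right)
  also have "\<dots> = 0" using assms by (simp add: inner_diff_left)
  finally show ?thesis by simp
qed

lemma dual_of: "dual (u \<bullet> a 1) (u \<bullet> a 2) (u \<bullet> a 3) = u"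
  by (rule functional_eq) simp_all

lemma linear_T: "linear T"
  by (rule linearI) (simp_all add: T_def inner_add_left algebra_simps)

lemma T_form: "v \<bullet> T u = q 1 * (u \<bullet> a 1) * (v \<bullet> a 1) + q 2 * (u \<bullet> a 2) * (v \<bullet> a 2) + q 3 * (u \<bullet> a 3) * (v \<bullet> a 3)
    + p 1 2 * (u \<bullet> a 1 - u \<bullet> a 2) * (v \<bullet> a 1 - v \<bullet> a 2) + p 1 3 * (u \<bullet> a 1 - u \<bullet> a 3) * (v \<bullet> a 1 - v \<bullet> a 3)
    + p 2 3 * (u \<bullet> a 2 - u \<bullet> a 3) * (v \<bullet> a 2 - v \<bullet> a 3)"
  unfolding T_def inner_add_right inner_scaleR_right inner_diff_right by simp

lemma T_sym: "u \<bullet> T v = v \<bullet> T u"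
  unfolding T_form by (simp add: mult_ac)

text \<open>
  Because \<open>\<bar>n\<bar> \<le> n\<^sup>2\<close> for integers, with equality for \<open>n \<in> {- 1, 0, 1}\<close>.
\<close>

lemma h_le_T: assumes "u \<in> U" shows "h u \<le> u \<bullet> T u"
proof -
  have le: "\<bar>x\<bar> \<le> x * x" if x: "x \<in> \<int>" for x :: real
  proof -
    obtain k where k: "x = of_int k" using x Ints_cases by blast
    have "\<bar>k\<bar> * 1 \<le> \<bar>k\<bar> * \<bar>k\<bar>"
    proof (cases "k = 0")
      case False
      then have "1 \<le> \<bar>k\<bar>" by linarith
      then show ?thesis by (intro mult_left_mono) auto
    qed simp
    then have "\<bar>k\<bar> \<le> k * k" by (simp add: abs_mult_self_eq)
    then show ?thesis unfolding k by (metis of_int_abs of_int_le_iff of_int_mult)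
  qed
  have i: "u \<bullet> a i \<in> \<int>" "u \<bullet> a i - u \<bullet> a j \<in> \<int>" for i j using assms by (auto simp: U_def)
  show ?thesis unfolding h_def T_form mult.assoc
    by (intro add_mono mult_left_mono le i q_nonneg p_nonneg)
qed

lemma h_zero_if_T_zero: assumes "u \<bullet> T u \<le> 0" shows "h u = 0"
proof -
  have z: "c * \<bar>x\<bar> = 0" if "c * (x * x) = 0" for c x :: real using that by auto
  have nn: "q i * (x * x) \<ge> 0" "p i j * (x * x) \<ge> 0" for i j x
    using q_nonneg[of i] p_nonneg[of i j] by simp_all
  note all = assms[unfolded T_form mult.assoc]
  have "q 1 * ((u \<bullet> a 1) * (u \<bullet> a 1)) = 0" "q 2 * ((u \<bullet> a 2) * (u \<bullet> a 2)) = 0" "q 3 * ((u \<bullet> a 3) * (u \<bullet> a 3)) = 0"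
    "p 1 2 * ((u \<bullet> a 1 - u \<bullet> a 2) * (u \<bullet> a 1 - u \<bullet> a 2)) = 0" "p 1 3 * ((u \<bullet> a 1 - u \<bullet> a 3) * (u \<bullet> a 1 - u \<bullet> a 3)) = 0"
    "p 2 3 * ((u \<bullet> a 2 - u \<bullet> a 3) * (u \<bullet> a 2 - u \<bullet> a 3)) = 0"
    using all nn(1)[of 1 "u \<bullet> a 1"] nn(1)[of 2 "u \<bullet> a 2"] nn(1)[of 3 "u \<bullet> a 3"] nn(2)[of 1 2 "u \<bullet> a 1 - u \<bullet> a 2"]
      nn(2)[of 1 3 "u \<bullet> a 1 - u \<bullet> a 3"] nn(2)[of 2 3 "u \<bullet> a 2 - u \<bullet> a 3"] by linarith+
  then show ?thesis unfolding h_def by (simp only: z)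
qed

lemma h_generic:
  assumes "i \<noteq> j" "i \<noteq> k" "j \<noteq> k"
  shows "h u = q i * \<bar>u \<bullet> a i\<bar> + q j * \<bar>u \<bullet> a j\<bar> + q k * \<bar>u \<bullet> a k\<bar>
    + p i j * \<bar>u \<bullet> a i - u \<bullet> a j\<bar> + p i k * \<bar>u \<bullet> a i - u \<bullet> a k\<bar> + p j k * \<bar>u \<bullet> a j - u \<bullet> a k\<bar>"
  using distinct3_cases[OF assms] p_sym[of 1 2] p_sym[of 1 3] p_sym[of 2 3]
  by (elim disjE) (simp_all add: h_def abs_minus_commute)

text \<open>
  Indicators of vertex sets. On these \<open>h\<close> agrees with the quadratic form, and their inequalities together
  with those of their negatives cut out the body.
\<close>

definition ind :: "3 set \<Rightarrow> real^3" where
  "ind S = dual (of_bool (1 \<in> S)) (of_bool (2 \<in> S)) (of_bool (3 \<in> S))"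

lemma ind_simp [simp]: "ind S \<bullet> a i = of_bool (i \<in> S)"
  using exhaust_3[of i] by (auto simp: ind_def)

lemma ind_U: "ind S \<in> U" "- ind S \<in> U"
  by (auto simp: U_def)

text \<open>
  Order the values of \<open>u\<close> decreasingly: \<open>u\<close> is a nonnegative combination of the indicators of a chain, and
  \<open>h\<close> is additive on such combinations.
\<close>

lemma body_nonneg_functional:
  assumes x: "\<And>S. ind S \<bullet> x \<le> (ind S \<bullet> T (ind S)) / 2" and u: "\<And>i. u \<bullet> a i \<ge> 0"
  shows "u \<bullet> x \<le> h u / 2"
proof -
  obtain i j k where d: "i \<noteq> j" "i \<noteq> k" "j \<noteq> k" and ord: "u \<bullet> a i \<ge> u \<bullet> a j" "u \<bullet> a j \<ge> u \<bullet> a k"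
    using type3_distinct by (metis linear)
  have cases: "m = i \<or> m = j \<or> m = k" for m :: 3
    using d exhaust_3[of i] exhaust_3[of j] exhaust_3[of k] exhaust_3[of m] by metis
  have form: "v \<bullet> T v = q i * (v \<bullet> a i) * (v \<bullet> a i) + q j * (v \<bullet> a j) * (v \<bullet> a j) + q k * (v \<bullet> a k) * (v \<bullet> a k)
    + p i j * (v \<bullet> a i - v \<bullet> a j) * (v \<bullet> a i - v \<bullet> a j) + p i k * (v \<bullet> a i - v \<bullet> a k) * (v \<bullet> a i - v \<bullet> a k)
    + p j k * (v \<bullet> a j - v \<bullet> a k) * (v \<bullet> a j - v \<bullet> a k)" for v
    using distinct3_cases[OF d] p_sym[of 1 2] p_sym[of 1 3] p_sym[of 2 3]
    by (elim disjE) (simp_all add: T_form algebra_simps)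
  have eqf: "v = w" if "v \<bullet> a i = w \<bullet> a i" "v \<bullet> a j = w \<bullet> a j" "v \<bullet> a k = w \<bullet> a k" for v w
  proof (rule functional_eq)
    have "v \<bullet> a m = w \<bullet> a m" for m using cases[of m] that by (elim disjE) simp_all
    then show "v \<bullet> a 1 = w \<bullet> a 1" "v \<bullet> a 2 = w \<bullet> a 2" "v \<bullet> a 3 = w \<bullet> a 3" by blast+
  qed
  have ij: "ind {i, j} = ind {i} + ind {j}" by (rule eqf) (use d in \<open>simp_all add: inner_add_left\<close>)
  have ijk: "ind {i, j, k} = ind {i} + ind {j} + ind {k}" by (rule eqf) (use d in \<open>simp_all add: inner_add_left\<close>)
  have ueq: "u = (u \<bullet> a i) *\<^sub>R ind {i} + (u \<bullet> a j) *\<^sub>R ind {j} + (u \<bullet> a k) *\<^sub>R ind {k}"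
    by (rule eqf) (use d in \<open>simp_all add: inner_add_left\<close>)
  have 1: "ind {i} \<bullet> x \<le> (q i + p i j + p i k) / 2"
    using x[of "{i}"] d unfolding form by simp
  have 2: "ind {i} \<bullet> x + ind {j} \<bullet> x \<le> (q i + q j + p i k + p j k) / 2"
    using x[of "{i, j}"] d unfolding form by (simp add: ij inner_add_left)
  have 3: "ind {i} \<bullet> x + ind {j} \<bullet> x + ind {k} \<bullet> x \<le> (q i + q j + q k) / 2"
    using x[of "{i, j, k}"] d unfolding form by (simp add: ijk inner_add_left)
  have "u \<bullet> x = (u \<bullet> a i) * (ind {i} \<bullet> x) + (u \<bullet> a j) * (ind {j} \<bullet> x) + (u \<bullet> a k) * (ind {k} \<bullet> x)"
    by (subst ueq) (simp add: inner_add_left)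
  also have "\<dots> \<le> h u / 2"
    using chain_sorted[OF 1 2 3 ord u] u unfolding h_generic[OF d] by simp
  finally show ?thesis .
qed

text \<open>
  The zonotope is the Voronoi cell of the form. For the harder inclusion split \<open>u\<close> into its positive and
  negative part; \<open>h\<close> is additive on this splitting.
\<close>

lemma body_eq: "body = {x. \<forall>u\<in>U. u \<bullet> x \<le> (u \<bullet> T u) / 2}"
proof
  show "body \<subseteq> {x. \<forall>u\<in>U. u \<bullet> x \<le> (u \<bullet> T u) / 2}"
  proof (intro subsetI CollectI ballI)
    fix x u assume "x \<in> body" "u \<in> U"
    then show "u \<bullet> x \<le> (u \<bullet> T u) / 2" using h_le_T[of u] unfolding body_def by (force intro: order_trans)
  qed
  show "{x. \<forall>u\<in>U. u \<bullet> x \<le> (u \<bullet> T u) / 2} \<subseteq> body"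
  proof
    fix x assume x: "x \<in> {x. \<forall>u\<in>U. u \<bullet> x \<le> (u \<bullet> T u) / 2}"
    have pos: "ind S \<bullet> x \<le> (ind S \<bullet> T (ind S)) / 2" for S using x ind_U(1) by blast
    have neg: "ind S \<bullet> (- x) \<le> (ind S \<bullet> T (ind S)) / 2" for S
    proof -
      have "(- ind S) \<bullet> x \<le> ((- ind S) \<bullet> T (- ind S)) / 2" using x ind_U(2) by blast
      then show ?thesis by (simp add: linear_neg[OF linear_T])
    qed
    have "u \<bullet> x \<le> h u / 2" for u
    proof -
      define v where "v = dual (max 0 (u \<bullet> a 1)) (max 0 (u \<bullet> a 2)) (max 0 (u \<bullet> a 3))"
      define w where "w = dual (max 0 (- (u \<bullet> a 1))) (max 0 (- (u \<bullet> a 2))) (max 0 (- (u \<bullet> a 3)))"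
      have "u = v - w" by (rule functional_eq) (auto simp: v_def w_def inner_diff_left max_def)
      moreover have "v \<bullet> x \<le> h v / 2"
      proof (rule body_nonneg_functional[OF pos])
        show "v \<bullet> a i \<ge> 0" for i using exhaust_3[of i] by (auto simp: v_def)
      qed
      moreover have "w \<bullet> (- x) \<le> h w / 2"
      proof (rule body_nonneg_functional[OF neg])
        show "w \<bullet> a i \<ge> 0" for i using exhaust_3[of i] by (auto simp: w_def)
      qed
      moreover have "h u = h v + h w"
      proof -
        have m: "\<bar>s\<bar> = \<bar>max 0 s\<bar> + \<bar>max 0 (- s)\<bar>"
          "\<bar>s - t\<bar> = \<bar>max 0 s - max 0 t\<bar> + \<bar>max 0 (- s) - max 0 (- t)\<bar>" for s t :: real
          by (auto simp: max_def abs_if)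
        show ?thesis unfolding h_def v_def w_def dual_simps
          m(1)[of "u \<bullet> a 1"] m(1)[of "u \<bullet> a 2"] m(1)[of "u \<bullet> a 3"]
          m(2)[of "u \<bullet> a 1" "u \<bullet> a 2"] m(2)[of "u \<bullet> a 1" "u \<bullet> a 3"] m(2)[of "u \<bullet> a 2" "u \<bullet> a 3"]
          by (simp only: distrib_left add_ac)
      qed
      ultimately show ?thesis by (simp add: inner_diff_left)
    qed
    then show "x \<in> body" unfolding body_def by blast
  qed
qed

end

section \<open>The six simplices\<close>

lemma permutation3:
  fixes i j k :: 3
  assumes "i \<noteq> j" "i \<noteq> k" "j \<noteq> k"
  obtains \<sigma> where "\<sigma> permutes (UNIV :: 3 set)" "\<sigma> 1 = i" "\<sigma> 2 = j" "\<sigma> 3 = k"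
proof -
  define \<sigma> where "\<sigma> = (\<lambda>m::3. if m = 1 then i else if m = 2 then j else k)"
  have v: "\<sigma> 1 = i" "\<sigma> 2 = j" "\<sigma> 3 = k" by (simp_all add: \<sigma>_def)
  have "inj \<sigma>"
  proof (rule injI)
    fix x y assume "\<sigma> x = \<sigma> y"
    then show "x = y" using exhaust_3[of x] exhaust_3[of y] v assms by (elim disjE) simp_all
  qed
  then have "bij_betw \<sigma> UNIV UNIV" using finite_UNIV_inj_surj[of \<sigma>] by (simp add: bij_def)
  then have "\<sigma> permutes UNIV" by (rule bij_imp_permutes) simp
  then show thesis using that v by blast
qed

lemma permutes3_distinct:
  fixes \<sigma> :: "3 \<Rightarrow> 3"
  assumes "\<sigma> permutes UNIV" shows "\<sigma> 1 \<noteq> \<sigma> 2" "\<sigma> 1 \<noteq> \<sigma> 3" "\<sigma> 2 \<noteq> \<sigma> 3"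
  using injD[OF permutes_inj[OF assms], of 1 2] injD[OF permutes_inj[OF assms], of 1 3]
    injD[OF permutes_inj[OF assms], of 2 3] type3_distinct by metis+

text \<open>
  The four sign patterns of the vertices of the zonotope that belong to one simplex.
\<close>

lemma signed_sum_le:
  fixes a b c d e f :: real
  shows "(- a - b - c - d - e - f) / 2 \<le> (\<bar>a\<bar> + \<bar>b\<bar> + \<bar>c\<bar> + \<bar>d\<bar> + \<bar>e\<bar> + \<bar>f\<bar>) / 2"
    and "(a - b - c + d + e - f) / 2 \<le> (\<bar>a\<bar> + \<bar>b\<bar> + \<bar>c\<bar> + \<bar>d\<bar> + \<bar>e\<bar> + \<bar>f\<bar>) / 2"
    and "(a + b - c - d + e + f) / 2 \<le> (\<bar>a\<bar> + \<bar>b\<bar> + \<bar>c\<bar> + \<bar>d\<bar> + \<bar>e\<bar> + \<bar>f\<bar>) / 2"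
    and "(a + b + c - d - e - f) / 2 \<le> (\<bar>a\<bar> + \<bar>b\<bar> + \<bar>c\<bar> + \<bar>d\<bar> + \<bar>e\<bar> + \<bar>f\<bar>) / 2"
  by argo+

lemma signed_sum_eq:
  fixes a b c d e f :: real
  shows "\<lbrakk>a \<le> 0; b \<le> 0; c \<le> 0; d \<le> 0; e \<le> 0; f \<le> 0\<rbrakk> \<Longrightarrow> (- a - b - c - d - e - f) / 2 = (\<bar>a\<bar> + \<bar>b\<bar> + \<bar>c\<bar> + \<bar>d\<bar> + \<bar>e\<bar> + \<bar>f\<bar>) / 2"
    and "\<lbrakk>a \<ge> 0; b \<le> 0; c \<le> 0; d \<ge> 0; e \<ge> 0; f \<le> 0\<rbrakk> \<Longrightarrow> (a - b - c + d + e - f) / 2 = (\<bar>a\<bar> + \<bar>b\<bar> + \<bar>c\<bar> + \<bar>d\<bar> + \<bar>e\<bar> + \<bar>f\<bar>) / 2"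
    and "\<lbrakk>a \<ge> 0; b \<ge> 0; c \<le> 0; d \<le> 0; e \<ge> 0; f \<ge> 0\<rbrakk> \<Longrightarrow> (a + b - c - d + e + f) / 2 = (\<bar>a\<bar> + \<bar>b\<bar> + \<bar>c\<bar> + \<bar>d\<bar> + \<bar>e\<bar> + \<bar>f\<bar>) / 2"
    and "\<lbrakk>a \<ge> 0; b \<ge> 0; c \<ge> 0; d \<le> 0; e \<le> 0; f \<le> 0\<rbrakk> \<Longrightarrow> (a + b + c - d - e - f) / 2 = (\<bar>a\<bar> + \<bar>b\<bar> + \<bar>c\<bar> + \<bar>d\<bar> + \<bar>e\<bar> + \<bar>f\<bar>) / 2"
  by (simp_all add: abs_of_nonneg abs_of_nonpos)

text \<open>
  Nondegeneracy: the generators span the space.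
\<close>

locale full_K4_body = K4_body +
  assumes full: "h u = 0 \<Longrightarrow> u = 0"
begin

lemma finite_U: "finite {u\<in>U. norm u \<le> C}"
proof -
  define K where "K = max (\<lceil>C * norm (a 1)\<rceil>) (max (\<lceil>C * norm (a 2)\<rceil>) (\<lceil>C * norm (a 3)\<rceil>))"
  let ?f = "\<lambda>(x, y, z). dual (of_int x) (of_int y) (of_int z)"
  have "{u\<in>U. norm u \<le> C} \<subseteq> ?f ` ({-K..K} \<times> {-K..K} \<times> {-K..K})"
  proof
    fix u assume u: "u \<in> {u\<in>U. norm u \<le> C}"
    have "\<exists>m. u \<bullet> a i = of_int m \<and> m \<in> {-K..K}" for i
    proof -
      have "u \<bullet> a i \<in> \<int>" using u by (simp add: U_def)
      then obtain m where m: "u \<bullet> a i = of_int m" using Ints_cases by blast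
      have "\<bar>u \<bullet> a i\<bar> \<le> norm u * norm (a i)" by (rule Cauchy_Schwarz_ineq2)
      also have "\<dots> \<le> C * norm (a i)" using u by (intro mult_right_mono) auto
      also have "\<dots> \<le> of_int \<lceil>C * norm (a i)\<rceil>" by simp
      also have "\<lceil>C * norm (a i)\<rceil> \<le> K" using exhaust_3[of i] by (auto simp: K_def)
      finally have "\<bar>m\<bar> \<le> K" using m by simp
      then show ?thesis using m by (intro exI[of _ m]) auto
    qed
    then obtain m where m: "\<And>i. u \<bullet> a i = of_int (m i)" "\<And>i. m i \<in> {-K..K}" by metis
    have "u = ?f (m 1, m 2, m 3)" using dual_of[of u] m(1) by simp
    then show "u \<in> ?f ` ({-K..K} \<times> {-K..K} \<times> {-K..K})" using m(2) by blast
  qed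
  then show ?thesis by (rule finite_subset) simp
qed

sublocale voronoi T U
proof (rule voronoi.intro)
  show "linear T" by (rule linear_T)
  show "u \<bullet> T v = v \<bullet> T u" for u v by (rule T_sym)
  show "u \<bullet> T u > 0" if "u \<noteq> 0" for u
    using h_zero_if_T_zero[of u] full[of u] that by force
  show "0 \<in> U" by (simp add: U_def)
  show "u - v \<in> U" if "u \<in> U" "v \<in> U" for u v using that by (simp add: U_def inner_diff_left)
  show "finite {u\<in>U. norm u \<le> C}" for C by (rule finite_U)
qed

lemma cell_body: "cell = body"
  unfolding cell_def body_eq ..

text \<open>
  The images of the vertices of the graph: \<open>B i = q i *\<^sub>R a i + (\<Sum>j. p i j *\<^sub>R (a i - a j))\<close>.
\<close>

definition B :: "3 \<Rightarrow> real^3" where "B i = T (ind {i})"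

lemma T_sum: "T (dual x y z) = x *\<^sub>R B 1 + y *\<^sub>R B 2 + z *\<^sub>R B 3"
proof -
  have "dual x y z = x *\<^sub>R ind {1} + y *\<^sub>R ind {2} + z *\<^sub>R ind {3}"
    by (rule functional_eq) (simp_all add: inner_add_left)
  then show ?thesis by (simp add: T_simps B_def)
qed

lemma B_basis: "lattice_basis B (T ` U)"
proof -
  have zero: "x = 0 \<and> y = 0 \<and> z = 0" if "x *\<^sub>R B 1 + y *\<^sub>R B 2 + z *\<^sub>R B 3 = 0" for x y z
  proof -
    have "T (dual x y z) = T 0" using that by (simp add: T_sum T_simps)
    then have "dual x y z = 0" using injT by (blast dest: injD)
    then have "x = 0 \<bullet> a 1" "y = 0 \<bullet> a 2" "z = 0 \<bullet> a 3" using dual_simps[of x y z] by metis+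
    then show ?thesis by simp
  qed
  have inj: "inj B"
  proof (rule injI, rule ccontr)
    fix i j assume ij: "B i = B j" "i \<noteq> j"
    let ?c = "\<lambda>m. of_bool (m = i) - of_bool (m = j) :: real"
    have "?c 1 *\<^sub>R B 1 + ?c 2 *\<^sub>R B 2 + ?c 3 *\<^sub>R B 3 = 0"
      using ij exhaust_3[of i] exhaust_3[of j] by (elim disjE) simp_all
    then have "?c m = 0" for m using zero exhaust_3[of m] by blast
    then show False using ij(2) by (metis diff_0_right of_bool_eq(1,2) zero_neq_one)
  qed
  have "independent (range B)"
  proof
    assume "dependent (range B)"
    then obtain c where c: "\<exists>v\<in>range B. c v \<noteq> 0" "(\<Sum>v\<in>range B. c v *\<^sub>R v) = 0"
      using dependent_finite[of "range B"] by auto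
    have "(\<Sum>v\<in>range B. c v *\<^sub>R v) = (\<Sum>i\<in>UNIV. c (B i) *\<^sub>R B i)" using inj by (subst sum.reindex) auto
    then have "c (B 1) *\<^sub>R B 1 + c (B 2) *\<^sub>R B 2 + c (B 3) *\<^sub>R B 3 = 0" using c(2) by (simp add: sum_3)
    then have "c (B 1) = 0 \<and> c (B 2) = 0 \<and> c (B 3) = 0" by (rule zero)
    then have "c (B i) = 0" for i using exhaust_3[of i] by auto
    then show False using c(1) by blast
  qed
  moreover have "T ` U = {(\<Sum>i\<in>UNIV. of_int (c i) *\<^sub>R B i) | c :: 3 \<Rightarrow> int. True}"
  proof
    show "T ` U \<subseteq> {(\<Sum>i\<in>UNIV. of_int (c i) *\<^sub>R B i) | c :: 3 \<Rightarrow> int. True}"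
    proof
      fix x assume "x \<in> T ` U"
      then obtain u where u: "u \<in> U" "x = T u" by blast
      have "\<forall>i. \<exists>m. u \<bullet> a i = of_int m" using u(1) unfolding U_def by (metis (mono_tags) Ints_cases mem_Collect_eq)
      then obtain c where c: "\<And>i. u \<bullet> a i = of_int (c i)" by metis
      have "x = T (dual (u \<bullet> a 1) (u \<bullet> a 2) (u \<bullet> a 3))" using u(2) dual_of[of u] by simp
      also have "\<dots> = (\<Sum>i\<in>UNIV. of_int (c i) *\<^sub>R B i)" unfolding T_sum c by (simp add: sum_3)
      finally show "x \<in> {(\<Sum>i\<in>UNIV. of_int (c i) *\<^sub>R B i) | c :: 3 \<Rightarrow> int. True}" by blast
    qed
    show "{(\<Sum>i\<in>UNIV. of_int (c i) *\<^sub>R B i) | c :: 3 \<Rightarrow> int. True} \<subseteq> T ` U"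
    proof
      fix x assume "x \<in> {(\<Sum>i\<in>UNIV. of_int (c i) *\<^sub>R B i) | c :: 3 \<Rightarrow> int. True}"
      then obtain c :: "3 \<Rightarrow> int" where c: "x = (\<Sum>i\<in>UNIV. of_int (c i) *\<^sub>R B i)" by blast
      let ?u = "dual (of_int (c 1)) (of_int (c 2)) (of_int (c 3))"
      have "?u \<bullet> a i \<in> \<int>" for i using exhaust_3[of i] by auto
      then have "?u \<in> U" unfolding U_def by blast
      moreover have "x = T ?u" unfolding T_sum c by (simp add: sum_3)
      ultimately show "x \<in> T ` U" by blast
    qed
  qed
  ultimately show ?thesis using inj unfolding lattice_basis_def by blast
qed

lemma inner_B:
  assumes "i \<noteq> j" "i \<noteq> k" "j \<noteq> k"
  shows "u \<bullet> B i = q i * (u \<bullet> a i) + p i j * (u \<bullet> a i - u \<bullet> a j) + p i k * (u \<bullet> a i - u \<bullet> a k)"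
  using distinct3_cases[OF assms] p_sym[of 1 2] p_sym[of 1 3] p_sym[of 2 3]
  by (elim disjE) (simp_all add: B_def T_form algebra_simps)

text \<open>
  The vertex at which every \<open>u\<close> with \<open>0 \<ge> u \<bullet> a (\<sigma> 3) \<ge> u \<bullet> a (\<sigma> 2) \<ge> u \<bullet> a (\<sigma> 1)\<close> is maximal, that is, the one
  of the ordering \<open>0, \<sigma> 3, \<sigma> 2, \<sigma> 1\<close>.
\<close>

definition corner :: "(3 \<Rightarrow> 3) \<Rightarrow> real^3" where
  "corner \<sigma> = (1/2) *\<^sub>R (- q (\<sigma> 1) *\<^sub>R a (\<sigma> 1) - q (\<sigma> 2) *\<^sub>R a (\<sigma> 2) - q (\<sigma> 3) *\<^sub>R a (\<sigma> 3)
     - p (\<sigma> 1) (\<sigma> 2) *\<^sub>R (a (\<sigma> 1) - a (\<sigma> 2)) - p (\<sigma> 1) (\<sigma> 3) *\<^sub>R (a (\<sigma> 1) - a (\<sigma> 3))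
     - p (\<sigma> 2) (\<sigma> 3) *\<^sub>R (a (\<sigma> 2) - a (\<sigma> 3)))"

definition corner_set :: "(3 \<Rightarrow> 3) \<Rightarrow> (real^3) set" where
  "corner_set \<sigma> = {corner \<sigma>, corner \<sigma> + B (\<sigma> 1), corner \<sigma> + (B (\<sigma> 1) + B (\<sigma> 2)), corner \<sigma> + (B 1 + B 2 + B 3)}"

text \<open>
  Adding \<open>B (\<sigma> 1)\<close> reverses exactly the signs of the three generators at \<open>\<sigma> 1\<close>, which moves \<open>\<sigma> 1\<close> from the end
  of the ordering to its front. Two further steps give the orderings \<open>\<sigma> 2, \<sigma> 1, 0, \<sigma> 3\<close> and
  \<open>\<sigma> 3, \<sigma> 2, \<sigma> 1, 0\<close>.
\<close>

lemma corner_values: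
  assumes s: "\<sigma> permutes (UNIV :: 3 set)"
  defines "i \<equiv> \<sigma> 1" and "j \<equiv> \<sigma> 2" and "k \<equiv> \<sigma> 3"
  defines "Qi \<equiv> \<lambda>u. q i * (u \<bullet> a i)" and "Qj \<equiv> \<lambda>u. q j * (u \<bullet> a j)" and "Qk \<equiv> \<lambda>u. q k * (u \<bullet> a k)"
    and "Aij \<equiv> \<lambda>u. p i j * (u \<bullet> a i - u \<bullet> a j)" and "Aik \<equiv> \<lambda>u. p i k * (u \<bullet> a i - u \<bullet> a k)"
    and "Ajk \<equiv> \<lambda>u. p j k * (u \<bullet> a j - u \<bullet> a k)"
  shows "u \<bullet> corner \<sigma> = (- Qi u - Qj u - Qk u - Aij u - Aik u - Ajk u) / 2"
    and "u \<bullet> (corner \<sigma> + B (\<sigma> 1)) = (Qi u - Qj u - Qk u + Aij u + Aik u - Ajk u) / 2"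
    and "u \<bullet> (corner \<sigma> + (B (\<sigma> 1) + B (\<sigma> 2))) = (Qi u + Qj u - Qk u - Aij u + Aik u + Ajk u) / 2"
    and "u \<bullet> (corner \<sigma> + (B 1 + B 2 + B 3)) = (Qi u + Qj u + Qk u - Aij u - Aik u - Ajk u) / 2"
    and "h u = \<bar>Qi u\<bar> + \<bar>Qj u\<bar> + \<bar>Qk u\<bar> + \<bar>Aij u\<bar> + \<bar>Aik u\<bar> + \<bar>Ajk u\<bar>"
proof -
  note d = permutes3_distinct[OF s, folded i_def j_def k_def]
  have c: "u \<bullet> corner \<sigma> = (- Qi u - Qj u - Qk u - Aij u - Aik u - Ajk u) / 2"
    unfolding corner_def Qi_def Qj_def Qk_def Aij_def Aik_def Ajk_def i_def[symmetric] j_def[symmetric] k_def[symmetric]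
    by (simp add: inner_diff_right)
  have bi: "u \<bullet> B i = Qi u + Aij u + Aik u" unfolding inner_B[OF d] Qi_def Aij_def Aik_def ..
  have "u \<bullet> B j = q j * (u \<bullet> a j) + p j i * (u \<bullet> a j - u \<bullet> a i) + p j k * (u \<bullet> a j - u \<bullet> a k)"
    using d by (intro inner_B) auto
  then have bj: "u \<bullet> B j = Qj u - Aij u + Ajk u" unfolding Qj_def Aij_def Ajk_def using p_sym[of i j] by (simp add: algebra_simps)
  have "u \<bullet> B k = q k * (u \<bullet> a k) + p k i * (u \<bullet> a k - u \<bullet> a i) + p k j * (u \<bullet> a k - u \<bullet> a j)"
    using d by (intro inner_B) auto
  then have bk: "u \<bullet> B k = Qk u - Aik u - Ajk u"
    unfolding Qk_def Aik_def Ajk_def using p_sym[of i k] p_sym[of j k] by (simp add: algebra_simps)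
  have B3: "B 1 + B 2 + B 3 = B i + B j + B k" using distinct3_cases[OF d] by (elim disjE) (simp_all add: add_ac)
  show "u \<bullet> corner \<sigma> = (- Qi u - Qj u - Qk u - Aij u - Aik u - Ajk u) / 2" by (rule c)
  show "u \<bullet> (corner \<sigma> + B (\<sigma> 1)) = (Qi u - Qj u - Qk u + Aij u + Aik u - Ajk u) / 2"
    unfolding i_def[symmetric] inner_add_right c bi by (simp add: field_simps)
  show "u \<bullet> (corner \<sigma> + (B (\<sigma> 1) + B (\<sigma> 2))) = (Qi u + Qj u - Qk u - Aij u + Aik u + Ajk u) / 2"
    unfolding i_def[symmetric] j_def[symmetric] inner_add_right c bi bj by (simp add: field_simps)
  show "u \<bullet> (corner \<sigma> + (B 1 + B 2 + B 3)) = (Qi u + Qj u + Qk u - Aij u - Aik u - Ajk u) / 2"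
    unfolding B3 inner_add_right c bi bj bk by (simp add: field_simps)
  show "h u = \<bar>Qi u\<bar> + \<bar>Qj u\<bar> + \<bar>Qk u\<bar> + \<bar>Aij u\<bar> + \<bar>Aik u\<bar> + \<bar>Ajk u\<bar>"
    unfolding h_generic[OF d] Qi_def Qj_def Qk_def Aij_def Aik_def Ajk_def abs_mult
    using q_nonneg p_nonneg by simp
qed

lemma corner_set_in_body: assumes "\<sigma> permutes UNIV" shows "corner_set \<sigma> \<subseteq> body"
proof -
  have "u \<bullet> y \<le> h u / 2" if y: "y \<in> corner_set \<sigma>" for u y
  proof -
    note v = corner_values[OF assms, of u]
    from y consider "y = corner \<sigma>" | "y = corner \<sigma> + B (\<sigma> 1)" | "y = corner \<sigma> + (B (\<sigma> 1) + B (\<sigma> 2))"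
      | "y = corner \<sigma> + (B 1 + B 2 + B 3)" unfolding corner_set_def by blast
    then show ?thesis
    proof cases
      case 1 show ?thesis unfolding 1 v(1,5) by (rule signed_sum_le)
    next
      case 2 show ?thesis unfolding 2 v(2,5) by (rule signed_sum_le)
    next
      case 3 show ?thesis unfolding 3 v(3,5) by (rule signed_sum_le)
    next
      case 4 show ?thesis unfolding 4 v(4,5) by (rule signed_sum_le)
    qed
  qed
  then show ?thesis unfolding body_def by blast
qed

text \<open>
  Sort the values \<open>u \<bullet> a i\<close> together with \<open>0\<close>. The position of \<open>0\<close> says which of the four vertices
  of a simplex to take, and the rest of the ordering determines the permutation.
\<close>

lemma corner_attains: "\<exists>\<sigma>. \<sigma> permutes UNIV \<and> (\<exists>y\<in>corner_set \<sigma>. u \<bullet> y = h u / 2)"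
proof -
  obtain i j k where d: "i \<noteq> j" "i \<noteq> k" "j \<noteq> k" and ord: "u \<bullet> a i \<ge> u \<bullet> a j" "u \<bullet> a j \<ge> u \<bullet> a k"
    using type3_distinct by (metis linear)
  have s1: "q m * x \<ge> 0" "p m n * x \<ge> 0" if "x \<ge> 0" for m n x using that q_nonneg p_nonneg by simp_all
  have s2: "q m * x \<le> 0" "p m n * x \<le> 0" if "x \<le> 0" for m n x using that q_nonneg p_nonneg by (simp_all add: mult_nonneg_nonpos)
  consider "0 \<ge> u \<bullet> a i" | "u \<bullet> a i \<ge> 0" "0 \<ge> u \<bullet> a j" | "u \<bullet> a j \<ge> 0" "0 \<ge> u \<bullet> a k" | "u \<bullet> a k \<ge> 0" by linarith
  then show ?thesis
  proof cases
    case 1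
    obtain \<sigma> where s: "\<sigma> permutes UNIV" "\<sigma> 1 = k" "\<sigma> 2 = j" "\<sigma> 3 = i" using permutation3[of k j i] d by metis
    note v = corner_values[OF s(1), of u, unfolded s(2-4)]
    have n: "u \<bullet> a i \<le> 0" "u \<bullet> a j \<le> 0" "u \<bullet> a k \<le> 0"
      "u \<bullet> a k - u \<bullet> a j \<le> 0" "u \<bullet> a k - u \<bullet> a i \<le> 0" "u \<bullet> a j - u \<bullet> a i \<le> 0"
      using 1 ord by linarith+
    have "u \<bullet> corner \<sigma> = h u / 2"
      unfolding v(1,5)
      by (rule signed_sum_eq(1)[OF s2(1)[OF n(3), of k] s2(1)[OF n(2), of j] s2(1)[OF n(1), of i]
        s2(2)[OF n(4), of k j] s2(2)[OF n(5), of k i] s2(2)[OF n(6), of j i]])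
    then show ?thesis using s unfolding corner_set_def by blast
  next
    case 2
    obtain \<sigma> where s: "\<sigma> permutes UNIV" "\<sigma> 1 = i" "\<sigma> 2 = k" "\<sigma> 3 = j" using permutation3[of i k j] d by metis
    note v = corner_values[OF s(1), of u, unfolded s(2-4)]
    have n: "u \<bullet> a i \<ge> 0" "u \<bullet> a j \<le> 0" "u \<bullet> a k \<le> 0"
      "u \<bullet> a i - u \<bullet> a k \<ge> 0" "u \<bullet> a i - u \<bullet> a j \<ge> 0" "u \<bullet> a k - u \<bullet> a j \<le> 0"
      using 2 ord by linarith+
    have "u \<bullet> (corner \<sigma> + B i) = h u / 2"
      unfolding v(2,5)
      by (rule signed_sum_eq(2)[OF s1(1)[OF n(1), of i] s2(1)[OF n(3), of k] s2(1)[OF n(2), of j]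
        s1(2)[OF n(4), of i k] s1(2)[OF n(5), of i j] s2(2)[OF n(6), of k j]])
    then show ?thesis using s unfolding corner_set_def by blast
  next
    case 3
    obtain \<sigma> where s: "\<sigma> permutes UNIV" "\<sigma> 1 = j" "\<sigma> 2 = i" "\<sigma> 3 = k" using permutation3[of j i k] d by metis
    note v = corner_values[OF s(1), of u, unfolded s(2-4)]
    have n: "u \<bullet> a i \<ge> 0" "u \<bullet> a j \<ge> 0" "u \<bullet> a k \<le> 0"
      "u \<bullet> a j - u \<bullet> a i \<le> 0" "u \<bullet> a j - u \<bullet> a k \<ge> 0" "u \<bullet> a i - u \<bullet> a k \<ge> 0"
      using 3 ord by linarith+
    have "u \<bullet> (corner \<sigma> + (B j + B i)) = h u / 2"
      unfolding v(3,5)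
      by (rule signed_sum_eq(3)[OF s1(1)[OF n(2), of j] s1(1)[OF n(1), of i] s2(1)[OF n(3), of k]
        s2(2)[OF n(4), of j i] s1(2)[OF n(5), of j k] s1(2)[OF n(6), of i k]])
    then show ?thesis using s unfolding corner_set_def by blast
  next
    case 4
    obtain \<sigma> where s: "\<sigma> permutes UNIV" "\<sigma> 1 = k" "\<sigma> 2 = j" "\<sigma> 3 = i" using permutation3[of k j i] d by metis
    note v = corner_values[OF s(1), of u, unfolded s(2-4)]
    have n: "u \<bullet> a i \<ge> 0" "u \<bullet> a j \<ge> 0" "u \<bullet> a k \<ge> 0"
      "u \<bullet> a k - u \<bullet> a j \<le> 0" "u \<bullet> a k - u \<bullet> a i \<le> 0" "u \<bullet> a j - u \<bullet> a i \<le> 0"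
      using 4 ord by linarith+
    have "u \<bullet> (corner \<sigma> + (B 1 + B 2 + B 3)) = h u / 2"
      unfolding v(4,5)
      by (rule signed_sum_eq(4)[OF s1(1)[OF n(3), of k] s1(1)[OF n(2), of j] s1(1)[OF n(1), of i]
        s2(2)[OF n(4), of k j] s2(2)[OF n(5), of k i] s2(2)[OF n(6), of j i]])
    then show ?thesis using s unfolding corner_set_def by blast
  qed
qed

lemma convex_body: "convex body"
  using convex_cell cell_body by simp

lemma translate_Delta: "(+) (corner \<sigma>) ` Delta \<sigma> B = convex hull corner_set \<sigma>"
  unfolding Delta_def convex_hull_translation[symmetric] corner_set_def by simp

text \<open>
  Both sides have the same support function.
\<close>

theorem body_as_hull:
  "body = convex hull (\<Union>\<sigma>\<in>{\<sigma>. \<sigma> permutes (UNIV :: 3 set)}. (+) (corner \<sigma>) ` Delta \<sigma> B)"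
proof
  show "convex hull (\<Union>\<sigma>\<in>{\<sigma>. \<sigma> permutes (UNIV :: 3 set)}. (+) (corner \<sigma>) ` Delta \<sigma> B) \<subseteq> body"
    unfolding translate_Delta
    by (intro hull_minimal convex_body UN_least hull_minimal corner_set_in_body) simp
  let ?V = "\<Union>\<sigma>\<in>{\<sigma>. \<sigma> permutes (UNIV :: 3 set)}. corner_set \<sigma>"
  have fin: "finite ?V" using finite_permutations[of "UNIV :: 3 set"] by (auto simp: corner_set_def)
  have "body \<subseteq> convex hull ?V"
  proof (rule ccontr)
    assume "\<not> body \<subseteq> convex hull ?V"
    then obtain x where x: "x \<in> body" "x \<notin> convex hull ?V" by blast
    obtain b c where bc: "b \<bullet> x < c" "\<forall>y\<in>convex hull ?V. b \<bullet> y > c"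
      using separating_hyperplane_closed_point[OF convex_convex_hull _ x(2)] fin
      by (metis compact_imp_closed finite_imp_compact_convex_hull)
    obtain \<sigma> y where y: "\<sigma> permutes UNIV" "y \<in> corner_set \<sigma>" "(- b) \<bullet> y = h (- b) / 2" using corner_attains[of "- b"] by blast
    have "y \<in> convex hull ?V" using y(1,2) by (intro hull_inc) blast
    then have "(- b) \<bullet> y < - c" using bc(2) by simp
    moreover have "(- b) \<bullet> x \<le> h (- b) / 2" using x(1) unfolding body_def by blast
    ultimately show False using y(3) bc(1) by simp
  qed
  also have "\<dots> \<subseteq> convex hull (\<Union>\<sigma>\<in>{\<sigma>. \<sigma> permutes (UNIV :: 3 set)}. (+) (corner \<sigma>) ` Delta \<sigma> B)"
    unfolding translate_Delta by (intro hull_mono UN_mono hull_subset) simp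
  finally show "body \<subseteq> convex hull (\<Union>\<sigma>\<in>{\<sigma>. \<sigma> permutes (UNIV :: 3 set)}. (+) (corner \<sigma>) ` Delta \<sigma> B)" .
qed

end

section \<open>The shape of a lattice tile\<close>

lemma zonotope_upper:
  "z \<in> zonotope ws \<Longrightarrow> u \<bullet> z \<le> (u \<bullet> sum_list ws + (\<Sum>w\<leftarrow>ws. \<bar>u \<bullet> w\<bar>)) / 2"
proof (induction ws arbitrary: z)
  case (Cons w ws)
  then obtain t y where ty: "z = t *\<^sub>R w + y" "0 \<le> t" "t \<le> 1" "y \<in> zonotope ws" by auto
  have "t * (u \<bullet> w) \<le> (u \<bullet> w + \<bar>u \<bullet> w\<bar>) / 2"
  proof (cases "u \<bullet> w \<ge> 0")
    case True
    then have "t * (u \<bullet> w) \<le> 1 * (u \<bullet> w)" using ty by (intro mult_right_mono) auto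
    then show ?thesis using True by simp
  next
    case False
    then show ?thesis using ty by (simp add: mult_nonneg_nonpos)
  qed
  then show ?case using Cons.IH[OF ty(4)] by (simp add: ty(1) inner_add_right field_simps)
qed simp

lemma zonotope_attains:
  "\<exists>z\<in>zonotope ws. u \<bullet> z = (u \<bullet> sum_list ws + (\<Sum>w\<leftarrow>ws. \<bar>u \<bullet> w\<bar>)) / 2"
proof (induction ws)
  case (Cons w ws)
  then obtain y where y: "y \<in> zonotope ws" "u \<bullet> y = (u \<bullet> sum_list ws + (\<Sum>w\<leftarrow>ws. \<bar>u \<bullet> w\<bar>)) / 2" by blast
  define t :: real where "t = (if u \<bullet> w \<ge> 0 then 1 else 0)"
  have "t *\<^sub>R w + y \<in> zonotope (w # ws)" using y(1) by (auto simp: t_def intro!: exI[of _ t])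
  moreover have "u \<bullet> (t *\<^sub>R w + y) = (u \<bullet> sum_list (w # ws) + (\<Sum>w\<leftarrow>w # ws. \<bar>u \<bullet> w\<bar>)) / 2"
    using y(2) by (simp add: t_def inner_add_right field_simps)
  ultimately show ?case by blast
qed simp

text \<open>
  A closed convex set is the intersection of its supporting half-spaces. The centre is half the sum of the generators.
\<close>

lemma zonotope_support_form:
  assumes P: "P = (+) c ` zonotope ws" and "closed P" "convex P"
  shows "P = {x. \<forall>u. u \<bullet> (x - (c + (1/2) *\<^sub>R sum_list ws)) \<le> (\<Sum>w\<leftarrow>ws. \<bar>u \<bullet> w\<bar>) / 2}"
proof
  show "P \<subseteq> {x. \<forall>u. u \<bullet> (x - (c + (1/2) *\<^sub>R sum_list ws)) \<le> (\<Sum>w\<leftarrow>ws. \<bar>u \<bullet> w\<bar>) / 2}"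
  proof (intro subsetI CollectI allI)
    fix x u assume "x \<in> P"
    then obtain z where z: "x = c + z" "z \<in> zonotope ws" using P by blast
    show "u \<bullet> (x - (c + (1/2) *\<^sub>R sum_list ws)) \<le> (\<Sum>w\<leftarrow>ws. \<bar>u \<bullet> w\<bar>) / 2"
      using zonotope_upper[OF z(2), of u] by (simp add: z(1) inner_diff_right field_simps)
  qed
  show "{x. \<forall>u. u \<bullet> (x - (c + (1/2) *\<^sub>R sum_list ws)) \<le> (\<Sum>w\<leftarrow>ws. \<bar>u \<bullet> w\<bar>) / 2} \<subseteq> P"
  proof (rule ccontr)
    assume "\<not> ?thesis"
    then obtain x where x: "\<And>u. u \<bullet> (x - (c + (1/2) *\<^sub>R sum_list ws)) \<le> (\<Sum>w\<leftarrow>ws. \<bar>u \<bullet> w\<bar>) / 2" "x \<notin> P" by blast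
    obtain a b where ab: "a \<bullet> x < b" "\<forall>y\<in>P. a \<bullet> y > b" using separating_hyperplane_closed_point[OF assms(3,2) x(2)] by blast
    obtain z where z: "z \<in> zonotope ws" "(- a) \<bullet> z = ((- a) \<bullet> sum_list ws + (\<Sum>w\<leftarrow>ws. \<bar>(- a) \<bullet> w\<bar>)) / 2"
      using zonotope_attains by blast
    have "c + z \<in> P" using z(1) P by blast
    then have "a \<bullet> (c + z) > b" using ab(2) by blast
    moreover have "(- a) \<bullet> (x - (c + (1/2) *\<^sub>R sum_list ws)) \<le> (\<Sum>w\<leftarrow>ws. \<bar>(- a) \<bullet> w\<bar>) / 2" by (rule x(1))
    ultimately show False using z(2) ab(1) by (simp add: inner_diff_right inner_add_right field_simps)
  qed
qed

lemma zonotope_segment_through: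
  assumes "w \<in> set ws" "y \<in> zonotope ws"
  shows "\<exists>z t. y = z + t *\<^sub>R w \<and> z \<in> zonotope ws \<and> z + w \<in> zonotope ws"
  using assms
proof (induction ws arbitrary: y)
  case (Cons v ws)
  then obtain t x where tx: "y = t *\<^sub>R v + x" "0 \<le> t" "t \<le> 1" "x \<in> zonotope ws" by auto
  have mem: "s *\<^sub>R v + x' \<in> zonotope (v # ws)" if "0 \<le> s" "s \<le> 1" "x' \<in> zonotope ws" for s x' using that by auto
  show ?case
  proof (cases "w = v")
    case True
    have "x \<in> zonotope (v # ws)" "x + w \<in> zonotope (v # ws)" using mem[of 0 x] mem[of 1 x] tx True by (simp_all add: add.commute)
    then show ?thesis using tx(1) True by (intro exI[of _ x] exI[of _ t]) (simp add: add.commute)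
  next
    case False
    then obtain z s where z: "x = z + s *\<^sub>R w" "z \<in> zonotope ws" "z + w \<in> zonotope ws"
      using Cons.IH[of x] Cons.prems tx(4) by auto
    have "t *\<^sub>R v + z \<in> zonotope (v # ws)" "t *\<^sub>R v + z + w \<in> zonotope (v # ws)"
      using mem[OF tx(2,3) z(2)] mem[OF tx(2,3) z(3)] by (simp_all add: add.assoc)
    then show ?thesis using tx(1) z(1) by (intro exI[of _ "t *\<^sub>R v + z"] exI[of _ s]) (simp add: add.assoc)
  qed
qed simp

lemma det3_zero_in_plane:
  "det3 w (\<alpha> *\<^sub>R z + \<beta> *\<^sub>R w) (\<gamma> *\<^sub>R z + \<delta> *\<^sub>R w) = 0"
  by (simp add: det3_expand algebra_simps)

text \<open>
  For a generator \<open>v\<close> not parallel to \<open>w\<close>, the face with normal \<open>cross3 w v\<close> contains a translate of the segment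
  from \<open>0\<close> to \<open>v\<close>. By \<open>three_planes\<close> there are only three possible planes spanned by \<open>v\<close> and \<open>w\<close>.
\<close>

lemma (in symmetric_tile) few_planes_edges:
  assumes P: "P = (+) c ` zonotope ws" and ws: "set ws \<subseteq> edge_vectors P"
  shows "few_planes (set ws)"
  unfolding few_planes_def
proof (intro ballI)
  fix w a b d e assume w: "w \<in> set ws" and abde: "a \<in> set ws" "b \<in> set ws" "d \<in> set ws" "e \<in> set ws"
  obtain u y where w0: "w \<noteq> 0" and u: "u \<bullet> w = 0" and F: "support_face P u = closed_segment y (y + w)"
    using w ws unfolding edge_vectors_def by blast
  have "on_line w (support_face P u)" unfolding F by (rule on_line_segment)
  moreover have "y \<in> support_face P u" "y + 1 *\<^sub>R w \<in> support_face P u" unfolding F by simp_all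
  ultimately obtain z1 z2 z3 where z: "\<And>g r v. g \<noteq> 0 \<Longrightarrow> g \<bullet> w = 0 \<Longrightarrow> r \<in> support_face P g \<Longrightarrow> r + v \<in> support_face P g \<Longrightarrow>
       \<exists>z\<in>{z1, z2, z3}. \<exists>\<alpha> \<beta>. v = \<alpha> *\<^sub>R z + \<beta> *\<^sub>R w"
    using three_planes[OF w0 u, of y 1] by (metis zero_neq_one)
  have plane: "\<exists>z\<in>{z1, z2, z3}. \<exists>\<alpha> \<beta>. v = \<alpha> *\<^sub>R z + \<beta> *\<^sub>R w" if v: "v \<in> set ws" for v
  proof (cases "cross3 w v = 0")
    case True
    then have "collinear {0, w, v}" by (simp add: cross_eq_0)
    then obtain k where "v = k *\<^sub>R w" using w0 by (auto simp: collinear_lemma)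
    then have "v = 0 *\<^sub>R z1 + k *\<^sub>R w" by simp
    then show ?thesis by blast
  next
    case False
    define g where "g = cross3 w v"
    have g: "g \<noteq> 0" "g \<bullet> w = 0" "g \<bullet> v = 0" using False by (simp_all add: g_def dot_cross_self)
    obtain x where x: "x \<in> support_face P g" using support_face_nonempty by blast
    then obtain x0 where "x = c + x0" "x0 \<in> zonotope ws" using P unfolding support_face_def by blast
    then obtain r t where r: "x0 = r + t *\<^sub>R v" "r \<in> zonotope ws" "r + v \<in> zonotope ws"
      using zonotope_segment_through[OF v] by blast
    have "c + r \<in> P" "c + r + v \<in> P" using r(2,3) P by (auto simp: add.assoc)
    moreover have "g \<bullet> (c + r) = g \<bullet> x" "g \<bullet> (c + r + v) = g \<bullet> x"
      using \<open>x = c + x0\<close> r(1) g(3) by (simp_all add: inner_add_right)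
    ultimately have "c + r \<in> support_face P g" "c + r + v \<in> support_face P g"
      unfolding support_face_eq[OF x] by simp_all
    then show ?thesis using z[OF g(1,2)] by blast
  qed
  have same: "det3 w p q = 0" if "\<exists>\<alpha> \<beta>. p = \<alpha> *\<^sub>R z + \<beta> *\<^sub>R w" "\<exists>\<alpha> \<beta>. q = \<alpha> *\<^sub>R z + \<beta> *\<^sub>R w" for p q z
    using that det3_zero_in_plane by auto
  obtain za where za: "za \<in> {z1, z2, z3}" "\<exists>\<alpha> \<beta>. a = \<alpha> *\<^sub>R za + \<beta> *\<^sub>R w" using plane[OF abde(1)] by blast
  obtain zb where zb: "zb \<in> {z1, z2, z3}" "\<exists>\<alpha> \<beta>. b = \<alpha> *\<^sub>R zb + \<beta> *\<^sub>R w" using plane[OF abde(2)] by blast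
  obtain zd where zd: "zd \<in> {z1, z2, z3}" "\<exists>\<alpha> \<beta>. d = \<alpha> *\<^sub>R zd + \<beta> *\<^sub>R w" using plane[OF abde(3)] by blast
  obtain ze where ze: "ze \<in> {z1, z2, z3}" "\<exists>\<alpha> \<beta>. e = \<alpha> *\<^sub>R ze + \<beta> *\<^sub>R w" using plane[OF abde(4)] by blast
  \<comment> \<open>Two of the four vectors share one of the three planes.\<close>
  from za(1) zb(1) zd(1) ze(1) consider "za = zb" | "za = zd" | "za = ze" | "zb = zd" | "zb = ze" | "zd = ze" by auto
  then show "det3 w a b = 0 \<or> det3 w a d = 0 \<or> det3 w a e = 0 \<or> det3 w b d = 0 \<or> det3 w b e = 0 \<or> det3 w d e = 0"
  proof cases
    case 1 then show ?thesis using same[OF za(2)] zb(2) by blast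
  next
    case 2 then show ?thesis using same[OF za(2)] zd(2) by blast
  next
    case 3 then show ?thesis using same[OF za(2)] ze(2) by blast
  next
    case 4 then show ?thesis using same[OF zb(2)] zd(2) by blast
  next
    case 5 then show ?thesis using same[OF zb(2)] ze(2) by blast
  next
    case 6 then show ?thesis using same[OF zd(2)] ze(2) by blast
  qed
qed

text \<open>
  Otherwise some functional would be constant on \<open>P\<close>.
\<close>

lemma (in symmetric_tile) edges_span:
  assumes P: "P = {x. \<forall>u. u \<bullet> (x - c) \<le> (\<Sum>w\<leftarrow>ws. \<bar>u \<bullet> w\<bar>) / 2}"
  shows "\<exists>x\<in>set ws. \<exists>y\<in>set ws. \<exists>z\<in>set ws. det3 x y z \<noteq> 0"
proof (rule ccontr)
  assume no: "\<not> ?thesis"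
  have "\<exists>g. g \<noteq> 0 \<and> (\<forall>w\<in>set ws. g \<bullet> w = 0)"
  proof (cases "\<exists>y\<in>set ws. \<exists>z\<in>set ws. cross3 y z \<noteq> 0")
    case True
    then obtain y z where yz: "y \<in> set ws" "z \<in> set ws" "cross3 y z \<noteq> 0" by blast
    have "cross3 y z \<bullet> w = 0" if "w \<in> set ws" for w
      using no that yz(1,2) unfolding det3_def by (metis inner_commute)
    then show ?thesis using yz(3) by blast
  next
    case False
    show ?thesis
    proof (cases "\<exists>w\<in>set ws. w \<noteq> 0")
      case True
      then obtain w where w: "w \<in> set ws" "w \<noteq> 0" by blast
      obtain g where g: "g \<noteq> 0" "orthogonal w g" using orthogonal_to_vector_exists[of w] by auto
      have "g \<bullet> v = 0" if v: "v \<in> set ws" for v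
      proof -
        have "cross3 w v = 0" using False w(1) v by blast
        then have "collinear {0, w, v}" by (simp add: cross_eq_0)
        then obtain k where "v = k *\<^sub>R w" using w(2) by (auto simp: collinear_lemma)
        then show ?thesis using g(2) by (simp add: orthogonal_def inner_commute)
      qed
      then show ?thesis using g(1) by blast
    next
      case False
      then have "\<forall>w\<in>set ws. (axis 1 1 :: real^3) \<bullet> w = 0" by (metis inner_zero_right)
      moreover have "(axis 1 1 :: real^3) \<noteq> 0" by (simp add: axis_eq_0_iff)
      ultimately show ?thesis by blast
    qed
  qed
  then obtain g where g: "g \<noteq> 0" "\<forall>w\<in>set ws. g \<bullet> w = 0" by blast
  have "(\<Sum>w\<leftarrow>ws. \<bar>g \<bullet> w\<bar>) = (\<Sum>w\<leftarrow>ws. 0)"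
    by (rule arg_cong[where f = sum_list]) (use g(2) in simp)
  then have s: "(\<Sum>w\<leftarrow>ws. \<bar>g \<bullet> w\<bar>) = 0" by simp
  have eq: "g \<bullet> x = g \<bullet> c" if x: "x \<in> P" for x
  proof -
    have "g \<bullet> (x - c) \<le> 0" "(- g) \<bullet> (x - c) \<le> 0"
      using x[unfolded P, simplified, rule_format, of g] x[unfolded P, simplified, rule_format, of "- g"] s by simp_all
    then show ?thesis by (simp add: inner_diff_right)
  qed
  have "g \<bullet> x = 0" if "x \<in> P" for x using eq[OF that] eq[OF zero_in_P] by simp
  then show False using no_functional_vanishes g(1) by blast
qed

text \<open>
  Generators of the same direction contribute the same absolute value up to a nonnegative factor.
\<close>

lemma group_parallel_terms:
  assumes "\<forall>w\<in>set ws. \<exists>v\<in>{a, b, c, a - b, b - c, a - c}. \<exists>k. w = k *\<^sub>R v"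
  shows "\<exists>qa qb qc pab pac pbc. qa \<ge> 0 \<and> qb \<ge> 0 \<and> qc \<ge> 0 \<and> pab \<ge> 0 \<and> pac \<ge> 0 \<and> pbc \<ge> (0::real) \<and>
    (\<forall>u::real^3. (\<Sum>w\<leftarrow>ws. \<bar>u \<bullet> w\<bar>) = qa * \<bar>u \<bullet> a\<bar> + qb * \<bar>u \<bullet> b\<bar> + qc * \<bar>u \<bullet> c\<bar>
      + pab * \<bar>u \<bullet> a - u \<bullet> b\<bar> + pac * \<bar>u \<bullet> a - u \<bullet> c\<bar> + pbc * \<bar>u \<bullet> b - u \<bullet> c\<bar>)"
  using assms
proof (induction ws)
  case Nil
  show ?case by (intro exI[of _ 0]) simp
next
  case (Cons w ws)
  have "\<forall>w\<in>set ws. \<exists>v\<in>{a, b, c, a - b, b - c, a - c}. \<exists>k. w = k *\<^sub>R v" using Cons.prems by simp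
  then obtain qa qb qc pab pac pbc where nn: "qa \<ge> 0" "qb \<ge> 0" "qc \<ge> 0" "pab \<ge> 0" "pac \<ge> 0" "pbc \<ge> (0::real)"
    and eq: "\<And>u::real^3. (\<Sum>w\<leftarrow>ws. \<bar>u \<bullet> w\<bar>) = qa * \<bar>u \<bullet> a\<bar> + qb * \<bar>u \<bullet> b\<bar> + qc * \<bar>u \<bullet> c\<bar>
      + pab * \<bar>u \<bullet> a - u \<bullet> b\<bar> + pac * \<bar>u \<bullet> a - u \<bullet> c\<bar> + pbc * \<bar>u \<bullet> b - u \<bullet> c\<bar>"
    using Cons.IH by blast
  obtain v k where vk: "v \<in> {a, b, c, a - b, b - c, a - c}" "w = k *\<^sub>R v" using Cons.prems by auto
  have k: "\<bar>k\<bar> \<ge> 0" by simp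
  have e: "(\<Sum>w\<leftarrow>w # ws. \<bar>u \<bullet> w\<bar>) = \<bar>k\<bar> * \<bar>u \<bullet> v\<bar> + (\<Sum>w\<leftarrow>ws. \<bar>u \<bullet> w\<bar>)" for u by (simp add: vk(2) abs_mult)
  from vk(1) consider "v = a" | "v = b" | "v = c" | "v = a - b" | "v = b - c" | "v = a - c" by blast
  then show ?case
  proof cases
    case 1 show ?thesis unfolding e eq 1
      by (rule exI[of _ "qa + \<bar>k\<bar>"], rule exI[of _ qb], rule exI[of _ qc], rule exI[of _ pab], rule exI[of _ pac], rule exI[of _ pbc], simp add: nn algebra_simps)
  next
    case 2 show ?thesis unfolding e eq 2
      by (rule exI[of _ qa], rule exI[of _ "qb + \<bar>k\<bar>"], rule exI[of _ qc], rule exI[of _ pab], rule exI[of _ pac], rule exI[of _ pbc], simp add: nn algebra_simps)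
  next
    case 3 show ?thesis unfolding e eq 3
      by (rule exI[of _ qa], rule exI[of _ qb], rule exI[of _ "qc + \<bar>k\<bar>"], rule exI[of _ pab], rule exI[of _ pac], rule exI[of _ pbc], simp add: nn algebra_simps)
  next
    case 4 show ?thesis unfolding e eq 4 inner_diff_right
      by (rule exI[of _ qa], rule exI[of _ qb], rule exI[of _ qc], rule exI[of _ "pab + \<bar>k\<bar>"], rule exI[of _ pac], rule exI[of _ pbc], simp add: nn distrib_right)
  next
    case 5 show ?thesis unfolding e eq 5 inner_diff_right
      by (rule exI[of _ qa], rule exI[of _ qb], rule exI[of _ qc], rule exI[of _ pab], rule exI[of _ pac], rule exI[of _ "pbc + \<bar>k\<bar>"], simp add: nn distrib_right)
  next
    case 6 show ?thesis unfolding e eq 6 inner_diff_right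
      by (rule exI[of _ qa], rule exI[of _ qb], rule exI[of _ qc], rule exI[of _ pab], rule exI[of _ "pac + \<bar>k\<bar>"], rule exI[of _ pbc], simp add: nn distrib_right)
  qed
qed

text \<open>
  Combines the equality of parallel edges, the zonotope structure and the classification of directions.
  Parallel generators are merged in the support function.
\<close>

theorem (in symmetric_tile) tile_is_K4_body:
  assumes poly: "polytope P"
  obtains c a q p where "full_K4_body a q p" "P = (+) c ` K4_body.body a q p"
proof -
  have ne: "P \<noteq> {}" using zero_in_P by blast
  have "equal_edges P" unfolding equal_edges_def using edges_equal_length by blast
  then obtain c0 ws where zon: "P = (+) c0 ` zonotope ws" and ws: "set ws \<subseteq> edge_vectors P"
    using zonotope_if_equal_edges[OF poly ne] by blast
  define c where "c = c0 + (1/2) *\<^sub>R sum_list ws"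
  have form: "P = {x. \<forall>u. u \<bullet> (x - c) \<le> (\<Sum>w\<leftarrow>ws. \<bar>u \<bullet> w\<bar>) / 2}"
    unfolding c_def by (rule zonotope_support_form[OF zon compact_imp_closed[OF compact] convex])
  have few: "few_planes (set ws)" by (rule few_planes_edges[OF zon ws])
  \<comment> \<open>The classification works with directions, so the generators are closed under scaling.\<close>
  define S where "S = {k *\<^sub>R w | k w. k \<noteq> 0 \<and> w \<in> set ws}"
  have "few_planes S"
    unfolding few_planes_def
  proof (intro ballI)
    fix w a b d e assume "w \<in> S" "a \<in> S" "b \<in> S" "d \<in> S" "e \<in> S"
    then obtain kw w' ka a' kb b' kd d' ke e' where k: "w = kw *\<^sub>R w'" "a = ka *\<^sub>R a'" "b = kb *\<^sub>R b'" "d = kd *\<^sub>R d'" "e = ke *\<^sub>R e'"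
      "w' \<in> set ws" "a' \<in> set ws" "b' \<in> set ws" "d' \<in> set ws" "e' \<in> set ws" unfolding S_def by blast
    have m: "det3 (r *\<^sub>R x) (s *\<^sub>R y) (t *\<^sub>R z) = r * s * t * det3 x y z" for r s t x y z
      by (simp add: det3_expand algebra_simps)
    show "det3 w a b = 0 \<or> det3 w a d = 0 \<or> det3 w a e = 0 \<or> det3 w b d = 0 \<or> det3 w b e = 0 \<or> det3 w d e = 0"
      unfolding k(1-5) m using few[unfolded few_planes_def, rule_format, OF k(6-10)] by (elim disjE) simp_all
  qed
  moreover have "k *\<^sub>R w \<in> S" if wS: "w \<in> S" "k \<noteq> 0" for w k
  proof -
    obtain l v where "w = l *\<^sub>R v" "l \<noteq> 0" "v \<in> set ws" using wS(1) unfolding S_def by blast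
    then have "k *\<^sub>R w = (k * l) *\<^sub>R v" "k * l \<noteq> 0" using wS(2) by simp_all
    then show ?thesis using \<open>v \<in> set ws\<close> unfolding S_def by blast
  qed
  ultimately interpret fpd: few_plane_directions S by unfold_locales
  have sub: "w \<in> S" if "w \<in> set ws" for w unfolding S_def using that by (intro CollectI exI[of _ 1] exI[of _ w]) simp
  obtain x y z where "x \<in> set ws" "y \<in> set ws" "z \<in> set ws" "det3 x y z \<noteq> 0" using edges_span[OF form] by blast
  then have "K4_directions S" using fpd.K4_classification sub by blast
  then obtain a1 a2 a3 where D: "det3 a1 a2 a3 \<noteq> 0"
    and dir: "\<And>w. w \<in> S \<Longrightarrow> \<exists>v\<in>{a1, a2, a3, a1 - a2, a2 - a3, a1 - a3}. \<exists>k. w = k *\<^sub>R v" unfolding K4_directions_def by blast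
  have "\<forall>w\<in>set ws. \<exists>v\<in>{a1, a2, a3, a1 - a2, a2 - a3, a1 - a3}. \<exists>k. w = k *\<^sub>R v"
    using dir sub by blast
  from group_parallel_terms[OF this] obtain q1 q2 q3 p12 p13 p23
    where nn: "q1 \<ge> 0" "q2 \<ge> 0" "q3 \<ge> 0" "p12 \<ge> 0" "p13 \<ge> 0" "p23 \<ge> 0"
      and sum: "\<forall>u. (\<Sum>w\<leftarrow>ws. \<bar>u \<bullet> w\<bar>) = q1 * \<bar>u \<bullet> a1\<bar> + q2 * \<bar>u \<bullet> a2\<bar> + q3 * \<bar>u \<bullet> a3\<bar>
        + p12 * \<bar>u \<bullet> a1 - u \<bullet> a2\<bar> + p13 * \<bar>u \<bullet> a1 - u \<bullet> a3\<bar> + p23 * \<bar>u \<bullet> a2 - u \<bullet> a3\<bar>" by (elim exE conjE) (rule that)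
  define a where "a = (\<lambda>i::3. if i = 1 then a1 else if i = 2 then a2 else a3)"
  define q where "q = (\<lambda>i::3. if i = 1 then q1 else if i = 2 then q2 else q3)"
  define p where "p = (\<lambda>i j::3. if {i, j} = {1, 2} then p12 else if {i, j} = {1, 3} then p13 else p23)"
  have av: "a 1 = a1" "a 2 = a2" "a 3 = a3" and qv: "q 1 = q1" "q 2 = q2" "q 3 = q3" by (simp_all add: a_def q_def)
  have pv: "p 1 2 = p12" "p 1 3 = p13" "p 2 3 = p23" by (auto simp: p_def doubleton_eq_iff)
  interpret K: K4_body a q p
  proof
    show "det3 (a 1) (a 2) (a 3) \<noteq> 0" unfolding av by (rule D)
    show "q i \<ge> 0" for i using nn by (simp add: q_def)
    show "p i j \<ge> 0" for i j using nn by (simp add: p_def)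
    show "p i j = p j i" for i j by (simp add: p_def insert_commute)
  qed
  have h: "K.h u = (\<Sum>w\<leftarrow>ws. \<bar>u \<bullet> w\<bar>)" for u unfolding K.h_def av qv pv by (simp add: sum)
  have mem: "x \<in> P \<longleftrightarrow> x - c \<in> K.body" for x unfolding K.body_def h using form by auto
  have "P = (+) c ` K.body"
  proof
    show "P \<subseteq> (+) c ` K.body"
    proof
      fix x assume "x \<in> P"
      then have "x - c \<in> K.body" using mem by blast
      moreover have "x = c + (x - c)" by simp
      ultimately show "x \<in> (+) c ` K.body" by blast
    qed
    show "(+) c ` K.body \<subseteq> P"
    proof
      fix x assume "x \<in> (+) c ` K.body"
      then obtain z where z: "z \<in> K.body" "x = c + z" by blast
      then have "x - c \<in> K.body" by simp
      then show "x \<in> P" unfolding mem .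
    qed
  qed
  moreover have "full_K4_body a q p"
  proof (unfold_locales)
    fix u assume u: "K.h u = 0"
    then have u': "K.h (- u) = 0" unfolding h by simp
    have eq: "u \<bullet> x = u \<bullet> c" if x: "x \<in> P" for x
    proof -
      have "x - c \<in> K.body" using mem x by blast
      then have "u \<bullet> (x - c) \<le> K.h u / 2" "(- u) \<bullet> (x - c) \<le> K.h (- u) / 2" unfolding K.body_def by blast+
      then show ?thesis using u u' by (simp add: inner_diff_right)
    qed
    have "u \<bullet> x = 0" if "x \<in> P" for x using eq[OF that] eq[OF zero_in_P] by simp
    then show "u = 0" by (rule no_functional_vanishes)
  qed
  ultimately show thesis using that by blast
qed

section \<open>The translation lattice\<close>

lemma lattice_basis_facts:
  assumes "lattice_basis B L"
  shows "0 \<in> L" "\<And>a b. a \<in> L \<Longrightarrow> b \<in> L \<Longrightarrow> a - b \<in> L" "finite {a\<in>L. norm a \<le> C}"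
proof -
  have L: "L = {(\<Sum>i\<in>UNIV. of_int (c i) *\<^sub>R B i) | c :: 3 \<Rightarrow> int. True}" and inj: "inj B" and ind: "independent (range B)"
    using assms by (auto simp: lattice_basis_def)
  show "0 \<in> L" unfolding L by (intro CollectI exI[of _ "\<lambda>_. 0"]) simp
  show "a - b \<in> L" if ab: "a \<in> L" "b \<in> L" for a b
  proof -
    obtain c d :: "3 \<Rightarrow> int" where cd: "a = (\<Sum>i\<in>UNIV. of_int (c i) *\<^sub>R B i)" "b = (\<Sum>i\<in>UNIV. of_int (d i) *\<^sub>R B i)"
      using ab unfolding L by blast
    have "a - b = (\<Sum>i\<in>UNIV. of_int (c i - d i) *\<^sub>R B i)" by (simp add: cd sum_subtractf scaleR_left_diff_distrib)
    then show ?thesis unfolding L by (intro CollectI exI[of _ "\<lambda>i. c i - d i"]) simp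
  qed
  define F where "F = (\<lambda>x::real^3. \<Sum>i\<in>UNIV. (x $ i) *\<^sub>R B i)"
  have linF: "linear F" by (rule linearI) (simp_all add: F_def scaleR_left_distrib sum.distrib scaleR_sum_right)
  have "inj F"
  proof (rule linear_injective_0[THEN iffD2, OF linF, rule_format])
    fix x assume F0: "F x = 0"
    have "(\<Sum>v\<in>range B. (x $ (inv B v)) *\<^sub>R v) = (\<Sum>i\<in>UNIV. (x $ i) *\<^sub>R B i)"
      using inj by (subst sum.reindex) (auto simp: inv_f_f)
    then have "(\<Sum>v\<in>range B. (x $ (inv B v)) *\<^sub>R v) = 0" using F0 by (simp add: F_def)
    then have "\<forall>v\<in>range B. x $ (inv B v) = 0" using ind dependent_finite[of "range B"] by auto
    then have "x $ i = 0" for i using inj by (auto simp: inv_f_f)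
    then show "x = 0" by (simp add: vec_eq_iff)
  qed
  then obtain m where m: "m > 0" "\<And>x. m * norm x \<le> norm (F x)" using linear_inj_bounded_below_pos[OF linF] by blast
  define K where "K = \<lceil>C / m\<rceil>"
  let ?S = "{c :: 3 \<Rightarrow> int. \<forall>i. c i \<in> {-K..K}}"
  have "?S = PiE UNIV (\<lambda>_. {-K..K})" by (auto simp: PiE_def Pi_def extensional_def)
  then have "finite ?S" by (simp add: finite_PiE)
  moreover have "{a\<in>L. norm a \<le> C} \<subseteq> (\<lambda>c. \<Sum>i\<in>UNIV. of_int (c i) *\<^sub>R B i) ` ?S"
  proof
    fix a assume a: "a \<in> {a\<in>L. norm a \<le> C}"
    then obtain c :: "3 \<Rightarrow> int" where c: "a = (\<Sum>i\<in>UNIV. of_int (c i) *\<^sub>R B i)" unfolding L by blast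
    define x :: "real^3" where "x = (\<chi> i. of_int (c i))"
    have "a = F x" by (simp add: c F_def x_def)
    then have "m * norm x \<le> C" using m(2)[of x] a by simp
    then have "norm x \<le> C / m" using m(1) by (simp add: field_simps)
    have "c i \<in> {-K..K}" for i
    proof -
      have "\<bar>x $ i\<bar> \<le> C / m" using component_le_norm_cart[of x i] \<open>norm x \<le> C / m\<close> by linarith
      then have "of_int \<bar>c i\<bar> \<le> C / m" by (simp add: x_def)
      then have "\<bar>c i\<bar> \<le> K" unfolding K_def by linarith
      then show ?thesis by auto
    qed
    then show "a \<in> (\<lambda>c. \<Sum>i\<in>UNIV. of_int (c i) *\<^sub>R B i) ` ?S" using c by blast
  qed
  ultimately show "finite {a\<in>L. norm a \<le> C}" using finite_subset finite_imageI by blast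
qed

lemma lattice_tiling_facts:
  assumes "lattice_tiling P L"
  shows "\<And>x. \<exists>a\<in>L. x - a \<in> P" "\<And>a y. a \<in> L \<Longrightarrow> y \<in> interior P \<Longrightarrow> y - a \<in> interior P \<Longrightarrow> a = 0"
    "0 \<in> L" "\<And>a b. a \<in> L \<Longrightarrow> b \<in> L \<Longrightarrow> a - b \<in> L" "finite {a\<in>L. norm a \<le> C}"
proof -
  obtain B where B: "lattice_basis B L" using assms unfolding lattice_tiling_def full_rank_lattice_def by blast
  note f = lattice_basis_facts[OF B]
  show "0 \<in> L" "\<And>a b. a \<in> L \<Longrightarrow> b \<in> L \<Longrightarrow> a - b \<in> L" "finite {a\<in>L. norm a \<le> C}" using f by blast+
  show "\<exists>a\<in>L. x - a \<in> P" for x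
  proof -
    have "x \<in> (\<Union>a\<in>L. (+) a ` P)" using assms unfolding lattice_tiling_def by simp
    then obtain a z where "a \<in> L" "z \<in> P" "x = a + z" by blast
    then show ?thesis by (intro bexI[of _ a]) simp_all
  qed
  show "a = 0" if a: "a \<in> L" "y \<in> interior P" "y - a \<in> interior P" for a y
  proof (rule ccontr)
    assume "a \<noteq> 0"
    then have "interior ((+) a ` P) \<inter> interior ((+) 0 ` P) = {}" using assms a(1) f(1) unfolding lattice_tiling_def by blast
    moreover have "y = a + (y - a)" by simp
    then have "y \<in> interior ((+) a ` P)" using a(3) by (metis imageI interior_translation)
    ultimately show False using a(2) by (auto simp: interior_translation)
  qed
qed

lemma symmetric_tileI:
  assumes "compact P" "convex P" "interior P \<noteq> {}" "\<And>x. x \<in> P \<Longrightarrow> - x \<in> P" "lattice_tiling P L"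
  shows "symmetric_tile P L"
  by (rule symmetric_tile.intro) (use assms lattice_tiling_facts[OF assms(5)] in blast)+

lemma lattice_tiling_translate:
  assumes "lattice_tiling P L" shows "lattice_tiling ((+) c ` P) L"
proof -
  have swap: "(+) x ` (+) c ` P = (+) c ` (+) x ` P" for x by (simp add: image_image add.left_commute)
  have "(\<Union>x\<in>L. (+) x ` (+) c ` P) = (+) c ` (\<Union>x\<in>L. (+) x ` P)" unfolding swap by blast
  also have "\<dots> = UNIV" using assms unfolding lattice_tiling_def by (simp add: surj_plus)
  finally have "(\<Union>x\<in>L. (+) x ` (+) c ` P) = UNIV" .
  moreover have "interior ((+) x ` (+) c ` P) \<inter> interior ((+) y ` (+) c ` P) = {}" if "x \<in> L" "y \<in> L" "x \<noteq> y" for x y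
  proof -
    have "interior ((+) x ` P) \<inter> interior ((+) y ` P) = {}" using assms that unfolding lattice_tiling_def by blast
    then show ?thesis unfolding swap interior_translation[of c] by (auto simp: image_Int[symmetric])
  qed
  ultimately show ?thesis using assms unfolding lattice_tiling_def by blast
qed

lemma face_to_face_tiling_translate:
  assumes "face_to_face_tiling P L" shows "face_to_face_tiling ((+) c ` P) L"
proof -
  have swap: "(+) x ` (+) c ` P = (+) c ` (+) x ` P" for x by (simp add: image_image add.left_commute)
  have int: "(+) c ` A \<inter> (+) c ` B = (+) c ` (A \<inter> B)" for A B :: "(real^3) set" by (rule image_Int[symmetric]) simp
  show ?thesis
    using assms lattice_tiling_translate[of P L c] unfolding face_to_face_tiling_def swap int face_of_translation_eq by blast
qed

lemma face_to_face_tiling_translate_iff: "face_to_face_tiling ((+) c ` P) L \<longleftrightarrow> face_to_face_tiling P L"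
proof
  assume "face_to_face_tiling ((+) c ` P) L"
  then have "face_to_face_tiling ((+) (- c) ` (+) c ` P) L" by (rule face_to_face_tiling_translate)
  then show "face_to_face_tiling P L" by (simp add: image_image)
qed (rule face_to_face_tiling_translate)

lemma translation_lattice_translate: "translation_lattice ((+) c ` P) = translation_lattice P"
  unfolding translation_lattice_def face_to_face_tiling_translate_iff ..

context full_K4_body
begin

lemma body_symmetric: "x \<in> body \<Longrightarrow> - x \<in> body"
  using cell_symmetric cell_body by simp

lemma body_face_to_face: "face_to_face_tiling body (T ` U)"
proof -
  note Lf = lattice_basis_facts[OF B_basis]
  have "full_rank_lattice (T ` U)" using B_basis unfolding full_rank_lattice_def by blast
  moreover have "(\<Union>x\<in>T ` U. (+) x ` body) = UNIV"
  proof -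
    have "x \<in> (\<Union>x\<in>T ` U. (+) x ` body)" for x
    proof -
      obtain u where u: "u \<in> U" "x - T u \<in> body" using cell_covering[of x] cell_body by auto
      have "x = T u + (x - T u)" by simp
      then show ?thesis using u by blast
    qed
    then show ?thesis by blast
  qed
  moreover have "interior ((+) x ` body) \<inter> interior ((+) y ` body) = {}" if xy: "x \<in> T ` U" "y \<in> T ` U" "x \<noteq> y" for x y
  proof (rule ccontr)
    assume "\<not> ?thesis"
    then obtain z1 z2 where z: "z1 \<in> interior body" "z2 \<in> interior body" "x + z1 = y + z2" by (auto simp: interior_translation)
    obtain u where u: "u \<in> U" "y - x = T u" using Lf(2)[OF xy(2,1)] by blast
    have "z1 - T u = z2" using z(3) u(2) by (simp add: algebra_simps)
    then have "u = 0" using cell_packing[OF u(1)] z(1,2) interior_subset cell_body by (metis subsetD)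
    then show False using u(2) xy(3) by (simp add: T_simps)
  qed
  ultimately have tiling: "lattice_tiling body (T ` U)" unfolding lattice_tiling_def by blast
  have face: "((+) x ` body \<inter> (+) y ` body) face_of ((+) x ` body)" if xy: "x \<in> T ` U" "y \<in> T ` U" for x y
  proof -
    obtain u where u: "u \<in> U" "y - x = T u" using Lf(2)[OF xy(2,1)] by blast
    have "(+) x ` body \<inter> (+) y ` body = (+) x ` (body \<inter> {z. z - T u \<in> body})"
    proof
      show "(+) x ` body \<inter> (+) y ` body \<subseteq> (+) x ` (body \<inter> {z. z - T u \<in> body})"
      proof
        fix v assume "v \<in> (+) x ` body \<inter> (+) y ` body"
        then obtain z1 z2 where z: "z1 \<in> body" "z2 \<in> body" "v = x + z1" "v = y + z2" by blast
        have "z1 - T u = z2" using z(3,4) unfolding u(2)[symmetric] by (simp add: algebra_simps)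
        then show "v \<in> (+) x ` (body \<inter> {z. z - T u \<in> body})" using z by blast
      qed
      show "(+) x ` (body \<inter> {z. z - T u \<in> body}) \<subseteq> (+) x ` body \<inter> (+) y ` body"
      proof
        fix v assume "v \<in> (+) x ` (body \<inter> {z. z - T u \<in> body})"
        then obtain z where z: "z \<in> body" "z - T u \<in> body" "v = x + z" by blast
        have "v = y + (z - T u)" using z(3) unfolding u(2)[symmetric] by simp
        then show "v \<in> (+) x ` body \<inter> (+) y ` body" using z by blast
      qed
    qed
    then show ?thesis using cell_meet_face[OF u(1)] unfolding cell_body by (simp only: face_of_translation_eq)
  qed
  show ?thesis unfolding face_to_face_tiling_def
    using tiling face by (metis Int_commute)
qed

text \<open>
  Any other face-to-face lattice contains the Voronoi lattice by \<open>lattice_subset\<close>, and a tiling lattice has no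
  proper extension.
\<close>

lemma body_translation_lattice:
  assumes poly: "polytope body" and int: "interior body \<noteq> {}"
  shows "translation_lattice body = T ` U"
  unfolding translation_lattice_def
proof (rule the_equality)
  show "face_to_face_tiling body (T ` U)" by (rule body_face_to_face)
  fix M assume M: "face_to_face_tiling body M"
  have comp: "compact body" using poly polytope_imp_compact by blast
  have 1: "symmetric_tile body (T ` U)"
    using body_face_to_face comp convex_body int body_symmetric unfolding face_to_face_tiling_def by (intro symmetric_tileI) auto
  have 2: "symmetric_tile body M"
    using M comp convex_body int body_symmetric unfolding face_to_face_tiling_def by (intro symmetric_tileI) auto
  have face: "body \<inter> {x. x - a \<in> body} face_of body" if a: "a \<in> M" for a
  proof -
    have "0 \<in> M" by (rule symmetric_tile.lattice_zero[OF 2])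
    then have "((+) 0 ` body \<inter> (+) a ` body) face_of ((+) 0 ` body)" using M a unfolding face_to_face_tiling_def by blast
    moreover have "(+) a ` body = {x. x - a \<in> body}"
    proof
      show "{x. x - a \<in> body} \<subseteq> (+) a ` body"
      proof
        fix x assume "x \<in> {x. x - a \<in> body}"
        moreover have "x = a + (x - a)" by simp
        ultimately show "x \<in> (+) a ` body" by blast
      qed
    qed auto
    ultimately show ?thesis by simp
  qed
  have "T ` U \<subseteq> M" using lattice_subset[unfolded cell_body, OF 1 2 poly face] .
  then show "M = T ` U" using tiling_lattices_eq[OF 1 2] by simp
qed

end

theorem proposition3p10:
  fixes P :: "(real^3) set"
  assumes "parallelohedron P"
  shows "\<exists>(B :: 3 \<Rightarrow> real^3) (t :: (3 \<Rightarrow> 3) \<Rightarrow> real^3).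
           lattice_basis B (translation_lattice P) \<and>
           P = convex hull (\<Union>\<sigma>\<in>{\<sigma>. \<sigma> permutes (UNIV :: 3 set)}. (+) (t \<sigma>) ` Delta \<sigma> B)"
proof -
  obtain L where poly: "polytope P" and dim: "aff_dim P = 3" and L: "lattice_tiling P L"
    using assms unfolding parallelohedron_def by blast
  have conv: "convex P" and comp: "compact P" using poly polytope_imp_convex polytope_imp_compact by auto
  have int: "interior P \<noteq> {}"
  proof -
    have "affine hull P = UNIV" using dim aff_dim_eq_full[of P] by simp
    then have "rel_interior P = interior P" by (rule rel_interior_interior)
    moreover have "P \<noteq> {}" using dim by auto
    ultimately show ?thesis using conv rel_interior_eq_empty by metis
  qed
  note facts = lattice_tiling_facts[OF L]
  have "countable L"
  proof -
    have "L = (\<Union>n::nat. {a\<in>L. norm a \<le> real n})" using real_arch_simple by auto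
    moreover have "countable (\<Union>n::nat. {a\<in>L. norm a \<le> real n})" using facts(5) by (auto intro: countable_finite)
    ultimately show ?thesis by simp
  qed
  then have "\<exists>c. \<forall>x\<in>P. 2 *\<^sub>R c - x \<in> P"
    by (rule lattice_tile_centrally_symmetric[OF comp conv int _ facts(3,4,1,2)])
  then obtain c where c: "\<forall>x\<in>P. 2 *\<^sub>R c - x \<in> P" ..
  define Q where "Q = (+) (- c) ` P"
  have "polytope Q" unfolding Q_def using poly by (simp only: polytope_translation_eq)
  then have Q: "polytope Q" "convex Q" "compact Q" using polytope_imp_convex polytope_imp_compact by auto
  have intQ: "interior Q \<noteq> {}" unfolding Q_def interior_translation using int by simp
  have symQ: "- x \<in> Q" if xQ: "x \<in> Q" for x
  proof -
    obtain y where y: "y \<in> P" "x = - c + y" using xQ unfolding Q_def by blast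
    have "- x = - c + (2 *\<^sub>R c - y)" by (simp add: y(2) scaleR_2)
    then show ?thesis using c y(1) unfolding Q_def by blast
  qed
  interpret symmetric_tile Q L
    using Q intQ symQ lattice_tiling_translate[OF L, of "- c"] by (intro symmetric_tileI) (simp_all add: Q_def)
  obtain d a q p where K: "full_K4_body a q p" "Q = (+) d ` K4_body.body a q p" by (rule tile_is_K4_body[OF Q(1)])
  interpret K: full_K4_body a q p by (rule K(1))
  have body: "P = (+) (c + d) ` K.body"
  proof -
    have "P = (+) c ` Q" unfolding Q_def by (simp add: image_image)
    then show ?thesis unfolding K(2) by (simp add: image_image add.assoc)
  qed
  have "polytope K.body" using Q(1) unfolding K(2) by (simp only: polytope_translation_eq)
  moreover have "interior K.body \<noteq> {}" using intQ unfolding K(2) interior_translation by simp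
  ultimately have lat: "translation_lattice P = K.T ` K.U"
    unfolding body translation_lattice_translate by (rule K.body_translation_lattice)
  have "P = convex hull ((+) (c + d) ` (\<Union>\<sigma>\<in>{\<sigma>. \<sigma> permutes (UNIV :: 3 set)}. (+) (K.corner \<sigma>) ` Delta \<sigma> K.B))"
    unfolding body convex_hull_translation using K.body_as_hull by simp
  also have "\<dots> = convex hull (\<Union>\<sigma>\<in>{\<sigma>. \<sigma> permutes (UNIV :: 3 set)}. (+) ((c + d) + K.corner \<sigma>) ` Delta \<sigma> K.B)"
    by (simp add: image_UN image_image add.assoc)
  finally have hull: "P = convex hull (\<Union>\<sigma>\<in>{\<sigma>. \<sigma> permutes (UNIV :: 3 set)}. (+) ((c + d) + K.corner \<sigma>) ` Delta \<sigma> K.B)" .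
  show ?thesis
    by (intro exI[of _ K.B] exI[of _ "\<lambda>\<sigma>. (c + d) + K.corner \<sigma>"] conjI)
      (use K.B_basis lat hull in simp_all)
qed

end
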